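(* For each $p_0\in(0,\infty)$ there exists a Bergman-Carleson measure $\mu$ on the unit disk $\mathbb D$ such that $$\mathcal C_B(\mu)=(0,\infty)\setminus\{p_0\},$$ where $\mathcal C_B(\mu)$ denotes the set of those $p\in(0,\infty)$ for which the embedding operator $J_p(\mu):A^p\hookrightarrow L^p(\mu)$ has closed range in $L^p(\mu)$.
   Context: $\mathbb D=\{z\in\mathbb C:|z|<1\}$ and $\sigma$ is normalized area measure on $\mathbb D$. For a positive Borel measure $\mu$ on $\mathbb D$ and $0<p<\infty$, $L^p(\mu)=L^p(\mathbb D,\mu)$ is the usual (quasi-)normed Lebesgue space of (classes of) complex-valued Borel measurable functions on $\mathbb D$. The Bergman space $A^p$ is the set of holomorphic functions on $\mathbb D$ that are in $L^p(\sigma)$, with $\|f\|_{A^p}=\|f\|_{L^p(\sigma)}$. A Bergman-Carleson measure is a positive Borel measure $\mu$ on $\mathbb D$ with $A^p\subset L^p(\mu)$ for some (equivalently, every) $p\in(0,\infty)$. For such $\mu$ and every $p\in(0,\infty)$, $J_p(\mu):A^p\to L^p(\mu)$ is the (automatically bounded) linear operator sending $f\in A^p$ to its restriction to the support of $\mu$, i.e. to $f$ viewed as an element of $L^p(\mu)$. *)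

theory Defs
  imports "HOL-Complex_Analysis.Complex_Analysis"
begin

abbreviation unit_disk :: "complex set" where
  "unit_disk \<equiv> ball 0 1"

text \<open>Elements of \<open>L\<^sup>p(M)\<close> are almost-everywhere classes of the functions in \<open>Lp_fun p M\<close>.
  Values of a function outside \<open>space M\<close> are irrelevant: functions that agree on \<open>space M\<close> have
  the same class. All notions below are meant for \<open>0 < p\<close>.\<close>

definition Lp_fun :: "real \<Rightarrow> 'a measure \<Rightarrow> ('a \<Rightarrow> complex) set" where
  "Lp_fun p M = {f \<in> borel_measurable M. integrable M (\<lambda>x. norm (f x) powr p)}"

definition Lp_norm :: "real \<Rightarrow> 'a measure \<Rightarrow> ('a \<Rightarrow> complex) \<Rightarrow> real" where
  "Lp_norm p M f = (\<integral>x. norm (f x) powr p \<partial>M) powr (1 / p)"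

definition ae_class :: "'a measure \<Rightarrow> ('a \<Rightarrow> complex) \<Rightarrow> ('a \<Rightarrow> complex) set" where
  "ae_class M f = {g \<in> borel_measurable M. AE x in M. g x = f x}"

definition Lp_space :: "real \<Rightarrow> 'a measure \<Rightarrow> ('a \<Rightarrow> complex) set set" where
  "Lp_space p M = ae_class M ` Lp_fun p M"

definition Lp_ball :: "real \<Rightarrow> 'a measure \<Rightarrow> ('a \<Rightarrow> complex) \<Rightarrow> real \<Rightarrow> ('a \<Rightarrow> complex) set set" where
  "Lp_ball p M f r = ae_class M ` {g \<in> Lp_fun p M. Lp_norm p M (\<lambda>x. g x - f x) < r}"

text \<open>The topology of the (quasi-)norm. For \<open>p < 1\<close> it is also the topology of the metric
  \<open>\<parallel>f - g\<parallel>\<^sup>p\<close>, since the balls of this metric are the balls of the quasi-norm.\<close>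

definition Lp_open :: "real \<Rightarrow> 'a measure \<Rightarrow> ('a \<Rightarrow> complex) set set \<Rightarrow> bool" where
  "Lp_open p M U \<longleftrightarrow> U \<subseteq> Lp_space p M \<and>
     (\<forall>f \<in> Lp_fun p M. ae_class M f \<in> U \<longrightarrow> (\<exists>r>0. Lp_ball p M f r \<subseteq> U))"

definition Lp_topology :: "real \<Rightarrow> 'a measure \<Rightarrow> ('a \<Rightarrow> complex) set topology" where
  "Lp_topology p M = topology (Lp_open p M)"

lemma Lp_ball_mono: "r \<le> s \<Longrightarrow> Lp_ball p M f r \<subseteq> Lp_ball p M f s"
  unfolding Lp_ball_def by (intro image_mono) auto

lemma istopology_Lp_open: "istopology (Lp_open p M)"
  unfolding istopology_def
proof (intro conjI allI impI)
  fix S T assume S: "Lp_open p M S" and T: "Lp_open p M T"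
  show "Lp_open p M (S \<inter> T)"
    unfolding Lp_open_def
  proof (intro conjI ballI impI)
    show "S \<inter> T \<subseteq> Lp_space p M" using S by (auto simp: Lp_open_def)
    fix f assume f: "f \<in> Lp_fun p M" "ae_class M f \<in> S \<inter> T"
    obtain r where r: "r > 0" "Lp_ball p M f r \<subseteq> S" using S f unfolding Lp_open_def by blast
    obtain s where s: "s > 0" "Lp_ball p M f s \<subseteq> T" using T f unfolding Lp_open_def by blast
    have "Lp_ball p M f (min r s) \<subseteq> S \<inter> T"
      using r s Lp_ball_mono[of "min r s" r p M f] Lp_ball_mono[of "min r s" s p M f] by auto
    then show "\<exists>r>0. Lp_ball p M f r \<subseteq> S \<inter> T"
      using r s by (intro exI[of _ "min r s"]) auto
  qed
next
  fix K assume K: "\<forall>S\<in>K. Lp_open p M S"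
  show "Lp_open p M (\<Union>K)"
    unfolding Lp_open_def
  proof (intro conjI ballI impI)
    show "\<Union>K \<subseteq> Lp_space p M" using K by (auto simp: Lp_open_def)
    fix f assume f: "f \<in> Lp_fun p M" "ae_class M f \<in> \<Union>K"
    then obtain S where S: "S \<in> K" "ae_class M f \<in> S" by blast
    then obtain r where "r > 0" "Lp_ball p M f r \<subseteq> S" using K f unfolding Lp_open_def by blast
    then show "\<exists>r>0. Lp_ball p M f r \<subseteq> \<Union>K" using S by blast
  qed
qed

lemma openin_Lp_topology: "openin (Lp_topology p M) U \<longleftrightarrow> Lp_open p M U"
  by (simp add: Lp_topology_def istopology_Lp_open)

lemma topspace_Lp_topology: "topspace (Lp_topology p M) = Lp_space p M"
proof -
  have "Lp_ball p M f 1 \<subseteq> Lp_space p M" for f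
    unfolding Lp_ball_def Lp_space_def by (intro image_mono) auto
  then have "Lp_open p M (Lp_space p M)"
    unfolding Lp_open_def by (auto intro!: exI[of _ "1::real"])
  then show ?thesis
    unfolding topspace_def openin_Lp_topology by (auto simp: Lp_open_def)
qed

definition disk_area :: "complex measure" where
  "disk_area = restrict_space (uniform_measure lborel unit_disk) unit_disk"

definition bergman_space :: "real \<Rightarrow> (complex \<Rightarrow> complex) set" where
  "bergman_space p = {f. f holomorphic_on unit_disk \<and> f \<in> Lp_fun p disk_area}"

text \<open>The inclusion \<open>A\<^sup>p \<subseteq> L\<^sup>p(\<mu>)\<close> holds for every \<open>p > 0\<close> as soon as it holds for one. With
  every exponent required, \<open>bergman_embedding\<close> below maps \<open>A\<^sup>p\<close> into \<open>L\<^sup>p(\<mu>)\<close> for all \<open>p\<close>.\<close>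

definition bergman_carleson :: "complex measure \<Rightarrow> bool" where
  "bergman_carleson \<mu> \<longleftrightarrow> sets \<mu> = sets (restrict_space borel unit_disk) \<and>
     (\<forall>p>0. bergman_space p \<subseteq> Lp_fun p \<mu>)"

definition bergman_embedding ::
  "complex measure \<Rightarrow> (complex \<Rightarrow> complex) \<Rightarrow> (complex \<Rightarrow> complex) set" where
  "bergman_embedding \<mu> f = ae_class \<mu> f"

lemma bergman_embedding_in_Lp_space:
  "bergman_carleson \<mu> \<Longrightarrow> 0 < p \<Longrightarrow> bergman_embedding \<mu> ` bergman_space p \<subseteq> Lp_space p \<mu>"
  unfolding bergman_carleson_def bergman_embedding_def Lp_space_def by (intro image_mono) auto

definition closed_range_exponents :: "complex measure \<Rightarrow> real set" where
  "closed_range_exponents \<mu> =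
     {p. 0 < p \<and> closedin (Lp_topology p \<mu>) (bergman_embedding \<mu> ` bergman_space p)}"

end

theory Submission
  imports Defs
begin

text \<open>For \<open>0 < a < 1\<close> put \<open>2 ^ q\<close> equally spaced points of mass \<open>1 / 4 ^ q\<close> on the circle of radius
  \<open>a powr (1 / 2 ^ q)\<close>, for every \<open>q\<close>. With \<open>E w = (1 - w / a) / (1 - a * w)\<close>, which has modulus
  \<open>1 / a\<close> on the unit circle, the product of \<open>E (z ^ 2 ^ i)\<close> over \<open>i < n\<close> vanishes exactly on the
  levels below \<open>n\<close> and has modulus comparable to \<open>(1 / a) ^ n\<close> on the circle of level \<open>n\<close>. As the
  annulus between consecutive circles has area comparable to \<open>1 / 2 ^ q\<close>, this growth is \<open>p\<close>-integrable
  if and only if \<open>a powr p > 1 / 2\<close>; the choice \<open>a = 2 powr (- 1 / p0)\<close> makes \<open>p0\<close> critical.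

  For \<open>p < p0\<close> these products, localised by powers of Fejer-type kernels, interpolate arbitrary
  \<open>p\<close>-summable data, so the embedding is onto. For \<open>p > p0\<close>, subtract from \<open>f\<close> an interpolant on \<open>j\<close>
  consecutive levels, divide by the product over these levels and use that \<open>p\<close>-th means over
  circles increase with the radius: the remainder shrinks by a factor comparable to
  \<open>a powr (p * j)\<close>, which beats \<open>2 ^ j\<close>, so the norm of \<open>f\<close> is controlled by its values at the points.
  For \<open>p = p0\<close> the same division shows that \<open>f\<close> is determined by these values, while a slowly
  converging combination of the products lies just outside the Bergman space although its values
  are a limit of restrictions of Bergman functions.\<close>

section \<open>Means over circles\<close>

text \<open>The exponents include \<open>p < 1\<close>, where neither convexity nor duality is
  available. Hence Bergman norms are handled through circle means, which are monotone in the radius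
  for every \<open>p > 0\<close>, and interpolation uses explicit functions whose localisation is
  sharpened by raising a kernel to a power. One measure has to serve all exponents. The mass
  \<open>1 / 4 ^ q\<close> is comparable to the area of one of \<open>2 ^ q\<close> equal sectors of
  the annulus of level \<open>q\<close>, so only the radii decide between surplus and shortage of
  points. Taking repeated square roots of \<open>a\<close> makes the points of level
  \<open>q\<close> the roots of \<open>z ^ 2 ^ q = a\<close>, and squaring carries each level to the
  previous one: estimates then depend only on the difference of two levels. At \<open>p0\<close> a
  product over \<open>n\<close> levels has p-th mean of order \<open>2 ^ n\<close> on circle
  \<open>n\<close>, exactly the reciprocal of the annulus weight. No geometric factor is left in
  either direction: neither surjectivity nor a lower bound survives, and the failure of closedness
  comes down to the divergence of the harmonic series.\<close>

definition circle_mean :: "real \<Rightarrow> (complex \<Rightarrow> complex) \<Rightarrow> complex \<Rightarrow> real" where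
  "circle_mean p f z = integral {0..1} (\<lambda>t. norm (f (z * cis (2 * pi * t))) powr p)"

lemma norm_mult_cis [simp]: "norm (z * cis t) = norm z"
  by (simp add: norm_mult)

lemma continuous_on_circle:
  assumes "continuous_on (sphere 0 (norm z)) f"
  shows "continuous_on A (\<lambda>t. f (z * cis (2 * pi * t)))"
  by (rule continuous_on_compose2[OF assms]) (auto intro!: continuous_intros)

lemma continuous_on_norm_powr:
  assumes "continuous_on A (f :: _ \<Rightarrow> 'a :: real_normed_vector)" "0 < p"
  shows "continuous_on A (\<lambda>t. norm (f t) powr p)"
  using assms by (intro continuous_on_powr' continuous_intros) auto

lemma integrable_circle_mean:
  assumes "continuous_on (sphere 0 (norm z)) f" "0 < p"
  shows "(\<lambda>t. norm (f (z * cis (2 * pi * t))) powr p) integrable_on {0..1}"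
  by (intro integrable_continuous_interval continuous_on_norm_powr[OF continuous_on_circle[OF assms(1)]] assms(2))

lemma circle_mean_nonneg: "0 \<le> circle_mean p f z"
  unfolding circle_mean_def
  by (cases "(\<lambda>t. norm (f (z * cis (2 * pi * t))) powr p) integrable_on {0..1}")
     (auto intro: integral_nonneg simp: not_integrable_integral)

lemma holomorphic_continuous_on_sphere:
  assumes "f holomorphic_on ball 0 R" "norm z < R"
  shows "continuous_on (sphere 0 (norm z)) f"
  using assms by (intro holomorphic_on_imp_continuous_on holomorphic_on_subset[OF assms(1)]) auto

lemma integral_periodic_shift:
  fixes g :: "real \<Rightarrow> real"
  assumes cont: "continuous_on UNIV g" and per: "\<And>t. g (t + 1) = g t" and s: "0 \<le> s" "s \<le> 1"
  shows "integral {0..1} (\<lambda>t. g (s + t)) = integral {0..1} g"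
proof -
  have int: "g integrable_on {u..v}" for u v
    using cont by (intro integrable_continuous_interval) (auto intro: continuous_on_subset)
  have shift: "integral {u..v} (\<lambda>t. g (t + c)) = integral {u + c..v + c} g" for u v c
    using integral_shift_Icc_real[of u v g c] by (simp add: o_def add.commute)
  have "integral {0..1} (\<lambda>t. g (s + t)) = integral {s..1 + s} g"
    using shift[of 0 1 s] by (simp add: add.commute)
  also have "\<dots> = integral {s..1} g + integral {1..1 + s} g"
    using s by (intro Henstock_Kurzweil_Integration.integral_combine[symmetric] int) auto
  also have "integral {1..1 + s} g = integral {0..s} (\<lambda>t. g (t + 1))"
    using shift[of 0 s 1] by (simp add: add.commute)
  also have "\<dots> = integral {0..s} g" by (simp add: per)
  also have "integral {s..1} g + integral {0..s} g = integral {0..1} g"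
    using s Henstock_Kurzweil_Integration.integral_combine[of 0 s 1 g] int by simp
  finally show ?thesis .
qed

text \<open>Points of equal modulus differ by a rotation, which shifts the parameter of a 1-periodic
  function.\<close>

lemma circle_mean_norm_cong:
  assumes cont: "continuous_on (sphere 0 (norm w)) f" and "norm z = norm w" and "0 < p"
  shows "circle_mean p f z = circle_mean p f w"
proof (cases "w = 0")
  case True
  then show ?thesis using assms by simp
next
  case False
  define s where "s = Arg2pi (z / w) / (2 * pi)"
  have s: "0 \<le> s" "s \<le> 1"
    using Arg2pi[of "z / w"] by (auto simp: s_def field_simps)
  have "z / w = cis (2 * pi * s)"
    using Arg2pi[of "z / w"] assms False
    by (simp add: is_Arg_def s_def norm_divide cis_conv_exp del: Arg2pi_eq_iff)
  then have z: "z = w * cis (2 * pi * s)" using False by (simp add: field_simps)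
  define g where "g = (\<lambda>t. norm (f (w * cis (2 * pi * t))) powr p)"
  have eq: "(\<lambda>t. norm (f (z * cis (2 * pi * t))) powr p) = (\<lambda>t. g (s + t))"
    unfolding g_def z by (simp add: mult.assoc cis_mult ring_distribs)
  have "cis (2 * pi * (t + 1)) = cis (2 * pi * t)" for t
    by (simp add: ring_distribs cis_mult[symmetric])
  then have "integral {0..1} (\<lambda>t. g (s + t)) = integral {0..1} g"
    using cont s \<open>0 < p\<close>
    by (intro integral_periodic_shift) (auto simp: g_def intro!: continuous_on_norm_powr continuous_on_circle)
  then show ?thesis by (simp only: circle_mean_def eq g_def)
qed

text \<open>Averaging the rotations of \<open>q\<close> against the conjugate phases of \<open>q\<close> on the inner circle gives
  a holomorphic function, to which the maximum principle applies.\<close>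

lemma circle_mean_1_mono:
  assumes q: "q holomorphic_on ball 0 R" and nz: "\<And>z. z \<in> ball 0 R \<Longrightarrow> q z \<noteq> 0"
    and zw: "norm z \<le> norm w" and w: "norm w < R"
  shows "circle_mean 1 q z \<le> circle_mean 1 q w"
proof -
  define \<psi> where "\<psi> = (\<lambda>t. cnj (sgn (q (z * cis (2 * pi * t)))))"
  define Q where "Q = (\<lambda>x. integral (cbox 0 1) (\<lambda>t. q (x * cis (2 * pi * t)) * \<psi> t))"
  have qc: "continuous_on (ball 0 R) q" using q by (rule holomorphic_on_imp_continuous_on)
  have q'c: "continuous_on (ball 0 R) (deriv q)"
    using q by (intro holomorphic_on_imp_continuous_on holomorphic_deriv) auto
  \<comment> \<open>\<open>sgn\<close> is continuous only away from 0; this is where the absence of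
    zeros of \<open>q\<close> enters.\<close>
  have \<psi>c: "continuous_on UNIV \<psi>"
    unfolding \<psi>_def using zw w nz
    by (intro continuous_intros continuous_on_circle holomorphic_continuous_on_sphere[OF q]) auto
  have \<psi>n: "norm (\<psi> t) \<le> 1" for t by (simp add: \<psi>_def norm_sgn)
  have "Q holomorphic_on ball 0 R"
    unfolding Q_def
  proof (rule leibniz_rule_holomorphic)
    fix x :: complex and t :: real assume x: "x \<in> ball 0 R" and t: "t \<in> cbox (0::real) 1"
    have 1: "(q has_field_derivative deriv q (x * cis (2 * pi * t))) (at (x * cis (2 * pi * t)))"
      using q x by (intro holomorphic_derivI[of _ "ball 0 R"]) auto
    have 2: "((\<lambda>x. x * cis (2 * pi * t)) has_field_derivative cis (2 * pi * t)) (at x)"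
      using DERIV_cmult_right[OF DERIV_ident[of "at x"], of "cis (2 * pi * t)"] by simp
    have "((\<lambda>x. q (x * cis (2 * pi * t))) has_field_derivative
        deriv q (x * cis (2 * pi * t)) * cis (2 * pi * t)) (at x)"
      by (rule DERIV_chain2[OF 1 2])
    then show "((\<lambda>x. q (x * cis (2 * pi * t)) * \<psi> t) has_field_derivative
        deriv q (x * cis (2 * pi * t)) * cis (2 * pi * t) * \<psi> t) (at x within ball 0 R)"
      by (rule has_field_derivative_at_within[OF DERIV_cmult_right])
  next
    fix x :: complex assume x: "x \<in> ball 0 R"
    have "continuous_on (cbox 0 (1::real)) (\<lambda>t. q (x * cis (2 * pi * t)) * \<psi> t)"
      using x by (intro continuous_intros continuous_on_circle holomorphic_continuous_on_sphere[OF q]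
          continuous_on_subset[OF \<psi>c]) auto
    then show "(\<lambda>t. q (x * cis (2 * pi * t)) * \<psi> t) integrable_on cbox 0 1"
      by (rule integrable_continuous)
  next
    have "continuous_on (ball 0 R \<times> cbox 0 1) (\<lambda>x. deriv q (fst x * cis (2 * pi * snd x)))"
      by (rule continuous_on_compose2[OF q'c]) (auto intro!: continuous_intros)
    then show "continuous_on (ball 0 R \<times> cbox 0 1) (\<lambda>(x, t). deriv q (x * cis (2 * pi * t)) * cis (2 * pi * t) * \<psi> t)"
      by (auto simp: case_prod_unfold intro!: continuous_intros continuous_on_compose2[OF \<psi>c])
  qed simp
  then have Qh: "Q holomorphic_on ball 0 R" .
  have Qn: "norm (Q x) \<le> circle_mean 1 q x" if "norm x < R" for x
    unfolding Q_def circle_mean_def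
  proof (simp only: cbox_interval, rule integral_norm_bound_integral)
    show "(\<lambda>t. q (x * cis (2 * pi * t)) * \<psi> t) integrable_on {0..1}"
      using that by (intro integrable_continuous_interval continuous_intros continuous_on_circle
          holomorphic_continuous_on_sphere[OF q] continuous_on_subset[OF \<psi>c]) auto
    show "(\<lambda>t. norm (q (x * cis (2 * pi * t))) powr 1) integrable_on {0..1}"
      using that by (intro integrable_circle_mean holomorphic_continuous_on_sphere[OF q]) auto
    show "norm (q (x * cis (2 * pi * t)) * \<psi> t) \<le> norm (q (x * cis (2 * pi * t))) powr 1" for t
      using \<psi>n[of t] by (simp add: norm_mult mult_left_le)
  qed
  have "norm (Q z) \<le> circle_mean 1 q w"
  proof (rule maximum_modulus_frontier[of Q "cball 0 (norm w)"])
    show "Q holomorphic_on interior (cball 0 (norm w))"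
      using w by (intro holomorphic_on_subset[OF Qh]) auto
    show "continuous_on (closure (cball 0 (norm w))) Q"
      using w by (intro holomorphic_on_imp_continuous_on holomorphic_on_subset[OF Qh]) auto
    show "norm (Q x) \<le> circle_mean 1 q w" if "x \<in> frontier (cball 0 (norm w))" for x
    proof -
      have x: "norm x = norm w" using that by (auto simp: frontier_def)
      then show ?thesis using Qn[of x] w
         circle_mean_norm_cong[OF holomorphic_continuous_on_sphere[OF q w] x, of 1] by simp
    qed
  qed (use zw in auto)
  moreover have "Q z = of_real (circle_mean 1 q z)"
  proof -
    have "u * cnj (sgn u) = of_real (norm u powr 1)" for u :: complex
    proof (cases "u = 0")
      case False
      have "u * cnj (sgn u) = (u * cnj u) / of_real (norm u)"
        by (simp add: sgn_div_norm scaleR_conv_of_real field_simps)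
      also have "\<dots> = of_real (norm u)"
        using False by (simp add: complex_norm_square[symmetric] power2_eq_square)
      finally show ?thesis by simp
    qed auto
    then have "Q z = integral {0..1} (\<lambda>t. of_real (norm (q (z * cis (2 * pi * t))) powr 1))"
      by (simp only: Q_def \<psi>_def cbox_interval)
    also have "\<dots> = of_real (circle_mean 1 q z)"
      unfolding circle_mean_def
      using integral_linear[OF integrable_circle_mean[OF holomorphic_continuous_on_sphere[OF q], of z 1]
          bounded_linear_of_real[where ?'a = complex]] zw w by (simp add: o_def)
    finally show ?thesis .
  qed
  ultimately show ?thesis by (simp add: circle_mean_nonneg)
qed

text \<open>Cauchy's formula on the circle through \<open>w\<close>: there the factor
  \<open>u / (u - z)\<close> has modulus at most \<open>norm w / (norm w - norm z)\<close>.\<close>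

lemma norm_le_circle_mean_1:
  assumes q: "q holomorphic_on ball 0 R" and zw: "norm z < norm w" and w: "norm w < R"
  shows "norm (q z) \<le> norm w / (norm w - norm z) * circle_mean 1 q w"
proof -
  define r where "r = norm w"
  define u where "u = (\<lambda>t. of_real r * cis (2 * pi * t))"
  have r: "r > 0" "norm z < r" using zw by (auto simp: r_def)
  have un: "norm (u t) = r" for t using r by (simp add: u_def norm_mult)
  have "((\<lambda>x. q x / (x - z)) has_contour_integral (2 * of_real pi * \<i> * q z)) (circlepath 0 r)"
    using w zw q by (intro Cauchy_integral_circlepath_simple holomorphic_on_subset[OF q]) (auto simp: r_def)
  then have "((\<lambda>t. q (u t) / (u t - z) * (2 * pi * \<i> * u t)) has_integral (2 * of_real pi * \<i> * q z)) {0..1}"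
    unfolding has_contour_integral_def
    by (rule has_integral_eq[rotated])
       (simp add: u_def vector_derivative_circlepath01, simp add: circlepath cis_conv_exp mult_ac)
  then have "((\<lambda>t. 1 / (2 * pi * \<i>) * (q (u t) / (u t - z) * (2 * pi * \<i> * u t))) has_integral
      1 / (2 * pi * \<i>) * (2 * of_real pi * \<i> * q z)) {0..1}"
    by (rule has_integral_mult_right)
  then have hi: "((\<lambda>t. q (u t) * (u t / (u t - z))) has_integral q z) {0..1}"
    by (simp add: field_simps)
  have "norm (q z) \<le> integral {0..1} (\<lambda>t. r / (r - norm z) * norm (q (u t)) powr 1)"
    unfolding integral_unique[OF hi, symmetric]
  proof (rule integral_norm_bound_integral)
    show "(\<lambda>t. q (u t) * (u t / (u t - z))) integrable_on {0..1}" using hi by blast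
    have "(\<lambda>t. norm (q (u t)) powr 1) integrable_on {0..1}"
      unfolding u_def using w r
      by (intro integrable_circle_mean holomorphic_continuous_on_sphere[OF q]) (auto simp: r_def)
    then show "(\<lambda>t. r / (r - norm z) * norm (q (u t)) powr 1) integrable_on {0..1}"
      by (rule integrable_on_mult_right)
    fix t :: real
    have "norm (u t - z) \<ge> r - norm z" using norm_triangle_ineq2[of "u t" z] by (simp add: un)
    then have "norm (u t / (u t - z)) \<le> r / (r - norm z)"
      using r by (simp add: norm_divide un frac_le)
    then have "norm (q (u t)) * norm (u t / (u t - z)) \<le> norm (q (u t)) * (r / (r - norm z))"
      by (intro mult_left_mono) auto
    then show "norm (q (u t) * (u t / (u t - z))) \<le> r / (r - norm z) * norm (q (u t)) powr 1"
      by (simp add: norm_mult norm_divide mult_ac)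
  qed
  also have "\<dots> = r / (r - norm z) * circle_mean 1 q (of_real r)"
    by (simp add: circle_mean_def u_def)
  also have "circle_mean 1 q (of_real r) = circle_mean 1 q w"
    using w by (intro circle_mean_norm_cong holomorphic_continuous_on_sphere[OF q]) (auto simp: r_def)
  finally show ?thesis by (simp add: r_def)
qed

section \<open>Reduction of p-th means to zero-free functions\<close>

lemma circle_mean_cong:
  assumes "\<And>u. norm u = norm z \<Longrightarrow> norm (f u) = norm (g u)"
  shows "circle_mean p f z = circle_mean p g z"
  unfolding circle_mean_def using assms by (intro integral_cong) auto

lemma circle_mean_mono:
  assumes "continuous_on (sphere 0 (norm z)) f" "continuous_on (sphere 0 (norm z)) g" "0 < p"
    and "\<And>u. norm u = norm z \<Longrightarrow> norm (f u) \<le> norm (g u)"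
  shows "circle_mean p f z \<le> circle_mean p g z"
  unfolding circle_mean_def
  using assms by (intro integral_le integrable_circle_mean powr_mono2) auto

text \<open>On a disk a zero-free function has a holomorphic logarithm, hence holomorphic powers of
  any real exponent. Estimates for exponent 1 thereby extend to every exponent.\<close>

lemma nonvanishing_powr:
  fixes f :: "complex \<Rightarrow> complex"
  assumes "f holomorphic_on ball 0 R" "\<And>z. z \<in> ball 0 R \<Longrightarrow> f z \<noteq> 0" "0 < R"
  obtains q where "q holomorphic_on ball 0 R" "\<And>z. z \<in> ball 0 R \<Longrightarrow> q z \<noteq> 0"
    "\<And>z. z \<in> ball 0 R \<Longrightarrow> norm (q z) = norm (f z) powr p"
proof -
  obtain g where g: "g holomorphic_on ball 0 R" "\<And>x. x \<in> ball 0 R \<Longrightarrow> exp (g x) = f x"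
    using holomorphic_logarithm_exists[of "ball 0 R" f 0] assms by auto
  show ?thesis
  proof (rule that[of "\<lambda>z. exp (of_real p * g z)"])
    show "(\<lambda>z. exp (of_real p * g z)) holomorphic_on ball 0 R"
      by (intro holomorphic_intros g)
    show "norm (exp (of_real p * g z)) = norm (f z) powr p" if "z \<in> ball 0 R" for z
      using that g(2)[of z, symmetric] by (simp add: powr_def norm_exp_eq_Re)
  qed auto
qed

lemma circle_mean_mono_nonvanishing:
  assumes f: "f holomorphic_on ball 0 R" "\<And>z. z \<in> ball 0 R \<Longrightarrow> f z \<noteq> 0"
    and zw: "norm z \<le> norm w" "norm w < R" and p: "0 < p"
  shows "circle_mean p f z \<le> circle_mean p f w"
proof -
  have "0 < R" using zw by (meson le_less_trans norm_ge_zero)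
  then obtain q where q: "q holomorphic_on ball 0 R" "\<And>z. z \<in> ball 0 R \<Longrightarrow> q z \<noteq> 0"
    "\<And>z. z \<in> ball 0 R \<Longrightarrow> norm (q z) = norm (f z) powr p"
    using nonvanishing_powr[OF f] by blast
  have "circle_mean p f u = circle_mean 1 q u" if "norm u < R" for u
    unfolding circle_mean_def using that by (intro integral_cong) (simp add: q(3))
  then show ?thesis using circle_mean_1_mono[OF q(1,2) zw] zw by simp
qed

lemma norm_powr_le_circle_mean_nonvanishing:
  assumes f: "f holomorphic_on ball 0 R" "\<And>z. z \<in> ball 0 R \<Longrightarrow> f z \<noteq> 0"
    and zw: "norm z < norm w" "norm w < R" and p: "0 < p"
  shows "norm (f z) powr p \<le> norm w / (norm w - norm z) * circle_mean p f w"
proof -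
  have "0 < R" using zw by (meson le_less_trans norm_ge_zero less_trans)
  then obtain q where q: "q holomorphic_on ball 0 R" "\<And>z. z \<in> ball 0 R \<Longrightarrow> q z \<noteq> 0"
    "\<And>z. z \<in> ball 0 R \<Longrightarrow> norm (q z) = norm (f z) powr p"
    using nonvanishing_powr[OF f] by blast
  have "circle_mean p f w = circle_mean 1 q w"
    unfolding circle_mean_def using zw by (intro integral_cong) (simp add: q(3))
  then show ?thesis using norm_le_circle_mean_1[OF q(1) zw] zw q(3)[of z] by simp
qed

text \<open>The factorisation near the zero and the quotient away from it agree on the overlap, so
  two holomorphic pieces glue over an open cover of \<open>S\<close>.\<close>

lemma holomorphic_divide_zero:
  assumes f: "f holomorphic_on S" and S: "open S" "connected S" "\<xi> \<in> S"
    and "f \<xi> = 0" "\<not> f constant_on S"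
  obtains g n where "0 < n" "g holomorphic_on S" "\<And>w. w \<in> S \<Longrightarrow> f w = (w - \<xi>) ^ n * g w" "g \<xi> \<noteq> 0"
proof -
  obtain g r n where g: "0 < n" "0 < r" "ball \<xi> r \<subseteq> S" "g holomorphic_on ball \<xi> r"
    "\<And>w. w \<in> ball \<xi> r \<Longrightarrow> f w = (w - \<xi>) ^ n * g w" "\<And>w. w \<in> ball \<xi> r \<Longrightarrow> g w \<noteq> 0"
    using holomorphic_factor_zero_nonconstant[OF f S assms(5,6)] by metis
  define h where "h = (\<lambda>w. if w \<in> ball \<xi> r then g w else f w / (w - \<xi>) ^ n)"
  have "h holomorphic_on ball \<xi> r"
    using g(4) by (rule holomorphic_transform) (simp add: h_def)
  moreover have "h holomorphic_on (S - {\<xi>})"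
  proof (rule holomorphic_transform)
    show "(\<lambda>w. f w / (w - \<xi>) ^ n) holomorphic_on (S - {\<xi>})"
      by (intro holomorphic_intros holomorphic_on_subset[OF f]) auto
    show "f w / (w - \<xi>) ^ n = h w" if "w \<in> S - {\<xi>}" for w
      using that g(5)[of w] by (simp add: h_def)
  qed
  ultimately have "h holomorphic_on (ball \<xi> r \<union> (S - {\<xi>}))"
    using S by (intro holomorphic_on_Un) auto
  moreover have "ball \<xi> r \<union> (S - {\<xi>}) = S" using g S by auto
  ultimately have "h holomorphic_on S" by simp
  moreover have "f w = (w - \<xi>) ^ n * h w" if "w \<in> S" for w
    using that g by (auto simp: h_def)
  moreover have "h \<xi> \<noteq> 0" using g by (simp add: h_def)
  ultimately show ?thesis using that g(1) by blast
qed

text \<open>The factor \<open>R - cnj \<xi> * z / R\<close> has the modulus of \<open>z - \<xi>\<close> on the circle of radius \<open>R\<close>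
  and no zero inside it.\<close>

lemma norm_reflected_factor:
  assumes "norm \<xi> \<le> R" "norm z \<le> R" "0 < R"
  shows "norm (z - \<xi>) \<le> norm (of_real R - cnj \<xi> * z / of_real R)"
    and "norm z = R \<Longrightarrow> norm (of_real R - cnj \<xi> * z / of_real R) = norm (z - \<xi>)"
proof -
  have id: "(norm (of_real R - cnj \<xi> * z / of_real R))\<^sup>2 - (norm (z - \<xi>))\<^sup>2
      = (R\<^sup>2 - (norm z)\<^sup>2) * (R\<^sup>2 - (norm \<xi>)\<^sup>2) / R\<^sup>2"
    using \<open>0 < R\<close> unfolding cmod_power2
    by (simp add: field_simps power2_eq_square complex_eq_iff)
  have "(norm z)\<^sup>2 \<le> R\<^sup>2" "(norm \<xi>)\<^sup>2 \<le> R\<^sup>2" using assms by (auto intro: power_mono)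
  then have "(norm (z - \<xi>))\<^sup>2 \<le> (norm (of_real R - cnj \<xi> * z / of_real R))\<^sup>2"
    using id by (smt (verit) divide_nonneg_nonneg mult_nonneg_nonneg zero_le_power2)
  then show "norm (z - \<xi>) \<le> norm (of_real R - cnj \<xi> * z / of_real R)"
    by (rule power2_le_imp_le) simp
  assume "norm z = R"
  then show "norm (of_real R - cnj \<xi> * z / of_real R) = norm (z - \<xi>)"
    using id by (metis diff_self divide_eq_0_iff eq_iff_diff_eq_0 mult_eq_0_iff norm_ge_zero power2_eq_imp_eq)
qed

text \<open>Each zero inside the circle is traded for the reflected factor, which is at least as
  large inside the circle and equally large on it. Means over smaller circles can only increase
  while the mean over the circle of radius \<open>R\<close> is kept, so an estimate of the former by
  the latter may be proved for \<open>g\<close> in place of \<open>f\<close>. Zeros on the circle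
  itself remain.\<close>

lemma nonvanishing_majorant:
  assumes R: "0 < R" "R < 1"
  shows "f holomorphic_on ball 0 1 \<Longrightarrow> \<exists>z\<in>ball 0 1. f z \<noteq> 0 \<Longrightarrow>
    \<exists>g. g holomorphic_on ball 0 1 \<and> (\<forall>z\<in>ball 0 R. g z \<noteq> 0) \<and>
      (\<forall>z\<in>cball 0 R. norm (f z) \<le> norm (g z)) \<and> (\<forall>z\<in>sphere 0 R. norm (g z) = norm (f z))"
proof (induction "card {z\<in>ball 0 R. f z = 0}" arbitrary: f rule: less_induct)
  case less
  have fin: "finite {z\<in>ball 0 R. f z = 0}"
  proof (cases "f constant_on ball 0 1")
    case True
    then have "{z\<in>ball 0 R. f z = 0} = {}" using less.prems R unfolding constant_on_def by force
    then show ?thesis by (simp only: finite.emptyI)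
  next
    case False
    then have "finite {z\<in>cball 0 R. f z = 0}"
      using R less.prems by (intro holomorphic_compact_finite_zeros[of f "ball 0 1"]) auto
    then show ?thesis by (rule rev_finite_subset) auto
  qed
  show ?case
  proof (cases "\<exists>\<xi>\<in>ball 0 R. f \<xi> = 0")
    case False
    then show ?thesis using less.prems by (intro exI[of _ f]) auto
  next
    case True
    then obtain \<xi> where \<xi>: "norm \<xi> < R" "f \<xi> = 0" by auto
    have "\<not> f constant_on ball 0 1"
    proof
      assume "f constant_on ball 0 1"
      then obtain c where "\<And>z. norm z < 1 \<Longrightarrow> f z = c" unfolding constant_on_def by auto
      then show False using \<xi> R less.prems by auto
    qed
    then obtain g n where g: "0 < n" "g holomorphic_on ball 0 1"
      "\<And>w. w \<in> ball 0 1 \<Longrightarrow> f w = (w - \<xi>) ^ n * g w" "g \<xi> \<noteq> 0"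
      using \<xi> R less.prems by (elim holomorphic_divide_zero[of f "ball 0 1" \<xi>]) auto
    define B where "B = (\<lambda>z. of_real R - cnj \<xi> * z / of_real R)"
    define h where "h = (\<lambda>z. B z ^ n * g z)"
    have Bnz: "B z \<noteq> 0" if "norm z \<le> R" for z
    proof -
      have "norm (cnj \<xi> * z / of_real R) = norm \<xi> * norm z / R" using R by (simp add: norm_mult norm_divide)
      also have "\<dots> \<le> norm \<xi>" using mult_left_mono[OF that, of "norm \<xi>"] R by (simp add: field_simps)
      finally have "norm (cnj \<xi> * z / of_real R) < norm (of_real R :: complex)" using \<xi> R by simp
      then show ?thesis by (auto simp: B_def)
    qed
    have hol: "h holomorphic_on ball 0 1"
      unfolding h_def B_def using R by (intro holomorphic_intros g) auto
    have h\<xi>: "h \<xi> \<noteq> 0" using Bnz[of \<xi>] \<xi> g by (auto simp: h_def)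
    \<comment> \<open>The induction counts distinct zeros: this one is gone with its full
      multiplicity, and the reflected factor adds none in the disk.\<close>
    have sub: "{z\<in>ball 0 R. h z = 0} \<subseteq> {z\<in>ball 0 R. f z = 0} - {\<xi>}"
      using Bnz g R h\<xi> by (auto simp: h_def)
    also have "\<dots> \<subset> {z\<in>ball 0 R. f z = 0}" using \<xi> by auto
    finally have "card {z\<in>ball 0 R. h z = 0} < card {z\<in>ball 0 R. f z = 0}"
      using fin by (intro psubset_card_mono)
    moreover have "\<exists>z\<in>ball 0 1. h z \<noteq> 0" using h\<xi> \<xi> R by (intro bexI[of _ \<xi>]) auto
    ultimately obtain G where G: "G holomorphic_on ball 0 1" "\<forall>z\<in>ball 0 R. G z \<noteq> 0"
      "\<forall>z\<in>cball 0 R. norm (h z) \<le> norm (G z)" "\<forall>z\<in>sphere 0 R. norm (G z) = norm (h z)"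
      using less.hyps[OF _ hol] by blast
    have le: "norm (f z) \<le> norm (h z)" if "norm z \<le> R" for z
      using norm_reflected_factor(1)[of \<xi> R z] g(3)[of z] that \<xi> R
      by (auto simp: h_def B_def norm_mult norm_power intro!: mult_right_mono power_mono)
    have eq: "norm (h z) = norm (f z)" if "norm z = R" for z
      using norm_reflected_factor(2)[of \<xi> R z] g(3)[of z] that \<xi> R
      by (simp add: h_def B_def norm_mult norm_power)
    show ?thesis
      using G le eq by (intro exI[of _ G]) (force intro: order_trans)
  qed
qed

lemma continuous_on_circle_mean:
  assumes f: "continuous_on (cball 0 R) f" and "0 < p"
  shows "continuous_on {0..R} (\<lambda>r. circle_mean p f (of_real r))"
proof -
  have "continuous_on ({0..R} \<times> cbox 0 1) (\<lambda>x. f (of_real (fst x) * cis (2 * pi * snd x)))"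
    by (rule continuous_on_compose2[OF f]) (auto intro!: continuous_intros)
  then have "continuous_on ({0..R} \<times> cbox 0 1)
      (\<lambda>(r, t). norm (f (of_real r * cis (2 * pi * t))) powr p)"
    using \<open>0 < p\<close> by (simp add: case_prod_unfold continuous_on_norm_powr)
  from integral_continuous_on_param[OF this] show ?thesis by (simp add: circle_mean_def)
qed

text \<open>The zero-free majorant may still vanish on the circle of radius \<open>R\<close>, so
  estimates are first obtained for radii \<open>r < R\<close>; continuity of the mean in the radius
  carries them to \<open>R\<close>. The factor \<open>D\<close> accommodates the constant
  \<open>r / (r - norm z)\<close> of the point estimate.\<close>

lemma circle_mean_le_limit:
  assumes f: "f holomorphic_on ball 0 1" and R: "0 < R" "R < 1" and "0 < p" and "0 \<le> r0" "r0 < R"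
    and le: "\<And>r. r0 < r \<Longrightarrow> r < R \<Longrightarrow> C \<le> D r * circle_mean p f (of_real r)"
    and D: "isCont D R"
  shows "C \<le> D R * circle_mean p f (of_real R)"
proof -
  have "continuous_on (cball 0 R) f"
    using f R by (intro holomorphic_on_imp_continuous_on holomorphic_on_subset[OF f]) auto
  then have "continuous_on {0..R} (\<lambda>r. circle_mean p f (of_real r))"
    using \<open>0 < p\<close> by (rule continuous_on_circle_mean)
  then have "((\<lambda>r. circle_mean p f (of_real r)) \<longlongrightarrow> circle_mean p f (of_real R)) (at R within {0..R})"
    using R by (auto simp: continuous_on_def)
  then have "((\<lambda>r. circle_mean p f (of_real r)) \<longlongrightarrow> circle_mean p f (of_real R)) (at_left R)"
    using R by (simp add: at_within_Icc_at_left)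
  moreover have "(D \<longlongrightarrow> D R) (at_left R)"
    using D by (simp add: isCont_def filterlim_at_split)
  ultimately have "((\<lambda>r. D r * circle_mean p f (of_real r)) \<longlongrightarrow> D R * circle_mean p f (of_real R)) (at_left R)"
    by (intro tendsto_intros)
  moreover have "eventually (\<lambda>r. C \<le> D r * circle_mean p f (of_real r)) (at_left R)"
    using eventually_at_left_real[OF \<open>r0 < R\<close>] by eventually_elim (auto intro: le)
  ultimately show ?thesis by (rule tendsto_lowerbound) auto
qed

lemma circle_mean_zero: "(\<And>u. norm u = norm z \<Longrightarrow> f u = 0) \<Longrightarrow> circle_mean p f z = 0"
  by (simp add: circle_mean_def)

text \<open>Replacing \<open>f\<close> by a zero-free majorant raises the inner mean and leaves the
  outer one unchanged, so zeros cause no obstruction and subharmonicity of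
  \<open>norm (f z) powr p\<close> is never invoked.\<close>

theorem circle_mean_norm_mono:
  assumes f: "f holomorphic_on ball 0 1" and zw: "norm z \<le> norm w" "norm w < 1" and p: "0 < p"
  shows "circle_mean p f z \<le> circle_mean p f w"
proof (cases "norm z < norm w \<and> (\<exists>z\<in>ball 0 1. f z \<noteq> 0)")
  case False
  note cs = holomorphic_continuous_on_sphere[OF f]
  show ?thesis
  proof (cases "norm z < norm w")
    case True
    then have "circle_mean p f z = 0" using False zw by (intro circle_mean_zero) auto
    then show ?thesis by (simp add: circle_mean_nonneg)
  next
    case False
    then have "circle_mean p f z = circle_mean p f w"
      using zw p by (intro circle_mean_norm_cong cs) auto
    then show ?thesis by simp
  qed
next
  case True
  define R where "R = norm w"
  have R: "0 < R" "R < 1" "norm z < R" using zw True by (auto simp: R_def intro: le_less_trans[of _ "norm z"])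
  obtain g where g: "g holomorphic_on ball 0 1" "\<forall>z\<in>ball 0 R. g z \<noteq> 0"
     "\<forall>z\<in>cball 0 R. norm (f z) \<le> norm (g z)" "\<forall>z\<in>sphere 0 R. norm (g z) = norm (f z)"
    using nonvanishing_majorant[OF R(1,2) f] True by blast
  have gR: "g holomorphic_on ball 0 R" using R by (intro holomorphic_on_subset[OF g(1)]) auto
  have "circle_mean p f z \<le> circle_mean p g z"
    using R g p by (intro circle_mean_mono holomorphic_continuous_on_sphere[of _ 1] f) auto
  also have "circle_mean p g z \<le> (\<lambda>_. 1) R * circle_mean p g (of_real R)"
  proof (rule circle_mean_le_limit[OF g(1) R(1,2) p norm_ge_zero R(3)])
    show "circle_mean p g z \<le> 1 * circle_mean p g (of_real r)" if "norm z < r" "r < R" for r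
      using circle_mean_mono_nonvanishing[OF gR, of z "of_real r" p] g(2) that p R norm_ge_zero[of z]
      by (simp del: norm_ge_zero)
  qed auto
  also have "\<dots> = circle_mean p g w"
    using R by (simp, intro circle_mean_norm_cong holomorphic_continuous_on_sphere[OF g(1)] p) (auto simp: R_def)
  also have "\<dots> = circle_mean p f w"
    using g(4) by (intro circle_mean_cong) (auto simp: R_def)
  finally show ?thesis .
qed

text \<open>The same majorant argument, ending in Cauchy's formula instead of the maximum
  principle.\<close>

theorem norm_powr_le_circle_mean:
  assumes f: "f holomorphic_on ball 0 1" and zw: "norm z < norm w" "norm w < 1" and p: "0 < p"
  shows "norm (f z) powr p \<le> norm w / (norm w - norm z) * circle_mean p f w"
proof (cases "\<exists>z\<in>ball 0 1. f z \<noteq> 0")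
  case False
  then have "f z = 0" using zw by auto
  then show ?thesis using zw by (simp add: circle_mean_nonneg)
next
  case True
  define R where "R = norm w"
  have R: "0 < R" "R < 1" "norm z < R" using zw by (auto simp: R_def intro: le_less_trans[of _ "norm z"])
  obtain g where g: "g holomorphic_on ball 0 1" "\<forall>z\<in>ball 0 R. g z \<noteq> 0"
     "\<forall>z\<in>cball 0 R. norm (f z) \<le> norm (g z)" "\<forall>z\<in>sphere 0 R. norm (g z) = norm (f z)"
    using nonvanishing_majorant[OF R(1,2) f True] by blast
  have gR: "g holomorphic_on ball 0 R" using R by (intro holomorphic_on_subset[OF g(1)]) auto
  have "norm (f z) powr p \<le> norm (g z) powr p"
    using R g p by (intro powr_mono2) auto
  also have "norm (g z) powr p \<le> (\<lambda>r. r / (r - norm z)) R * circle_mean p g (of_real R)"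
  proof (rule circle_mean_le_limit[OF g(1) R(1,2) p norm_ge_zero R(3)])
    show "norm (g z) powr p \<le> r / (r - norm z) * circle_mean p g (of_real r)" if "norm z < r" "r < R" for r
      using norm_powr_le_circle_mean_nonvanishing[OF gR, of z "of_real r" p] g(2) that p R norm_ge_zero[of z]
      by (simp del: norm_ge_zero)
  qed (use R in \<open>auto intro!: continuous_intros\<close>)
  also have "circle_mean p g (of_real R) = circle_mean p g w"
    using R by (intro circle_mean_norm_cong holomorphic_continuous_on_sphere[OF g(1)] p) (auto simp: R_def)
  also have "\<dots> = circle_mean p f w"
    using g(4) by (intro circle_mean_cong) (auto simp: R_def)
  finally show ?thesis by (simp add: R_def)
qed

section \<open>Area integrals and circle means\<close>

text \<open>The shears below act on one coordinate with the other one fixed; for that, planar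
  Lebesgue measure has to be seen as a product measure.\<close>

lemma lborel_complex: "lborel = distr (lborel \<Otimes>\<^sub>M lborel) borel (\<lambda>(x, y). Complex x y)"
proof (rule lborel_eqI)
  have m: "(\<lambda>(x, y). Complex x y) \<in> borel_measurable (lborel \<Otimes>\<^sub>M lborel)"
    unfolding Complex_eq case_prod_unfold by measurable
  fix l u :: complex assume le: "\<And>b. b \<in> Basis \<Longrightarrow> l \<bullet> b \<le> u \<bullet> b"
  have "(\<lambda>(x, y). Complex x y) -` box l u \<inter> space (lborel \<Otimes>\<^sub>M lborel) =
      {Re l<..<Re u} \<times> {Im l<..<Im u}"
    by (auto simp: in_box_complex_iff space_pair_measure)
  moreover have "Re l \<le> Re u" "Im l \<le> Im u"
    using le[of 1] le[of \<i>] by (auto simp: Basis_complex_def)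
  ultimately show "emeasure (distr (lborel \<Otimes>\<^sub>M lborel) borel (\<lambda>(x, y). Complex x y)) (box l u) =
      ennreal (\<Prod>b\<in>Basis. (u - l) \<bullet> b)"
    by (simp add: emeasure_distr[OF m] lborel.emeasure_pair_measure_Times Basis_complex_def
        ennreal_mult)
qed simp

lemma nn_integral_lborel_complex:
  fixes f :: "complex \<Rightarrow> ennreal"
  assumes [measurable]: "f \<in> borel_measurable borel"
  shows "(\<integral>\<^sup>+z. f z \<partial>lborel) = (\<integral>\<^sup>+x. \<integral>\<^sup>+y. f (Complex x y) \<partial>lborel \<partial>lborel)"
    and "(\<integral>\<^sup>+z. f z \<partial>lborel) = (\<integral>\<^sup>+y. \<integral>\<^sup>+x. f (Complex x y) \<partial>lborel \<partial>lborel)"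
proof -
  have [measurable]: "(\<lambda>(x, y). Complex x y) \<in> borel_measurable (lborel \<Otimes>\<^sub>M lborel)"
    unfolding Complex_eq case_prod_unfold by measurable
  have [measurable]: "(\<lambda>(x, y). f (Complex x y)) \<in> borel_measurable (lborel \<Otimes>\<^sub>M lborel)"
    unfolding Complex_eq case_prod_unfold by measurable
  have "(\<integral>\<^sup>+z. f z \<partial>lborel) = (\<integral>\<^sup>+xy. f (case xy of (x, y) \<Rightarrow> Complex x y) \<partial>(lborel \<Otimes>\<^sub>M lborel))"
    by (subst lborel_complex) (simp add: nn_integral_distr)
  also have "\<dots> = (\<integral>\<^sup>+x. \<integral>\<^sup>+y. f (Complex x y) \<partial>lborel \<partial>lborel)"
    by (subst lborel.nn_integral_fst[symmetric]) (simp_all add: case_prod_unfold)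
  finally show "(\<integral>\<^sup>+z. f z \<partial>lborel) = (\<integral>\<^sup>+x. \<integral>\<^sup>+y. f (Complex x y) \<partial>lborel \<partial>lborel)" .
  also have "\<dots> = (\<integral>\<^sup>+y. \<integral>\<^sup>+x. f (Complex x y) \<partial>lborel \<partial>lborel)"
    by (rule lborel_pair.Fubini'[symmetric]) simp
  finally show "(\<integral>\<^sup>+z. f z \<partial>lborel) = (\<integral>\<^sup>+y. \<integral>\<^sup>+x. f (Complex x y) \<partial>lborel \<partial>lborel)" .
qed

text \<open>On each line in the sheared direction the map is a translation, so Tonelli and
  translation invariance in one variable suffice.\<close>

lemma nn_integral_lborel_shear:
  fixes f :: "complex \<Rightarrow> ennreal"
  assumes [measurable]: "f \<in> borel_measurable borel"
  shows "(\<integral>\<^sup>+z. f (Complex (Re z + t * Im z) (Im z)) \<partial>lborel) = (\<integral>\<^sup>+z. f z \<partial>lborel)"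
    and "(\<integral>\<^sup>+z. f (Complex (Re z) (Im z + t * Re z)) \<partial>lborel) = (\<integral>\<^sup>+z. f z \<partial>lborel)"
proof -
  have [measurable]: "(\<lambda>z. f (Complex (Re z + t * Im z) (Im z))) \<in> borel_measurable borel"
    "(\<lambda>z. f (Complex (Re z) (Im z + t * Re z))) \<in> borel_measurable borel"
    unfolding Complex_eq by measurable
  have [measurable]: "(\<lambda>x. f (Complex x y)) \<in> borel_measurable borel"
    "(\<lambda>y. f (Complex x y)) \<in> borel_measurable borel" for x y
    unfolding Complex_eq by measurable
  have shift: "(\<integral>\<^sup>+x. g (x + c) \<partial>lborel) = (\<integral>\<^sup>+x. g x \<partial>lborel)"
    if "g \<in> borel_measurable borel" for g :: "real \<Rightarrow> ennreal" and c
    using nn_integral_real_affine[OF that, of 1 c] by (simp add: add.commute)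
  show "(\<integral>\<^sup>+z. f (Complex (Re z + t * Im z) (Im z)) \<partial>lborel) = (\<integral>\<^sup>+z. f z \<partial>lborel)"
    by (simp add: nn_integral_lborel_complex(2) shift[where g="\<lambda>x. f (Complex x y)" for y])
  show "(\<integral>\<^sup>+z. f (Complex (Re z) (Im z + t * Re z)) \<partial>lborel) = (\<integral>\<^sup>+z. f z \<partial>lborel)"
    by (simp add: nn_integral_lborel_complex(1) shift[where g="\<lambda>y. f (Complex x y)" for x])
qed

text \<open>A rotation that is not a half-turn is a product of three shears.\<close>

lemma nn_integral_lborel_rotate:
  fixes f :: "complex \<Rightarrow> ennreal"
  assumes [measurable]: "f \<in> borel_measurable borel"
  shows "(\<integral>\<^sup>+z. f (z * cis \<theta>) \<partial>lborel) = (\<integral>\<^sup>+z. f z \<partial>lborel)"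
proof -
  have generic: "(\<integral>\<^sup>+z. f (z * cis \<theta>) \<partial>lborel) = (\<integral>\<^sup>+z. f z \<partial>lborel)"
    if "cos \<theta> \<noteq> -1" and [measurable]: "f \<in> borel_measurable borel" for f :: "complex \<Rightarrow> ennreal" and \<theta>
  proof -
    \<comment> \<open>This is \<open>- tan (\<theta> / 2)\<close>, the coefficient of the outer two
      of the three shears.\<close>
    define \<alpha> where "\<alpha> = - sin \<theta> / (1 + cos \<theta>)"
    define X where "X = (\<lambda>z. Complex (Re z + \<alpha> * Im z) (Im z))"
    define Y where "Y = (\<lambda>z. Complex (Re z) (Im z + sin \<theta> * Re z))"
    have [measurable]: "X \<in> borel_measurable borel" "Y \<in> borel_measurable borel"
      unfolding X_def Y_def Complex_eq by measurable
    have m: "(\<lambda>z. f (X (Y z))) \<in> borel_measurable borel" "(\<lambda>z. f (X z)) \<in> borel_measurable borel"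
      by measurable
    have nz: "1 + cos \<theta> \<noteq> 0" using that(1) by auto
    have 1: "1 + \<alpha> * sin \<theta> = cos \<theta>"
      using nz sin_cos_squared_add[of \<theta>] by (simp add: \<alpha>_def field_simps power2_eq_square)
    have "\<alpha> * (1 + cos \<theta>) = - sin \<theta>" using nz by (simp add: \<alpha>_def)
    then have 2: "\<alpha> + \<alpha> * cos \<theta> = - sin \<theta>" by (simp add: ring_distribs)
    have "X (Y (X z)) = z * cis \<theta>" for z
    proof (rule complex_eqI)
      have "Re (X (Y (X z))) = Re z * (1 + \<alpha> * sin \<theta>) + Im z * (\<alpha> + \<alpha> * (1 + \<alpha> * sin \<theta>))"
        by (simp add: X_def Y_def algebra_simps)
      then show "Re (X (Y (X z))) = Re (z * cis \<theta>)" unfolding 1 2 by (simp add: algebra_simps)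
      have "Im (X (Y (X z))) = Im z * (1 + \<alpha> * sin \<theta>) + Re z * sin \<theta>"
        by (simp add: X_def Y_def algebra_simps)
      then show "Im (X (Y (X z))) = Im (z * cis \<theta>)" unfolding 1 by (simp add: algebra_simps)
    qed
    then have "(\<integral>\<^sup>+z. f (z * cis \<theta>) \<partial>lborel) = (\<integral>\<^sup>+z. f (X (Y (X z))) \<partial>lborel)" by simp
    also have "\<dots> = (\<integral>\<^sup>+z. f (X (Y z)) \<partial>lborel)"
      using nn_integral_lborel_shear(1)[OF m(1), of \<alpha>] by (simp add: X_def)
    also have "\<dots> = (\<integral>\<^sup>+z. f (X z) \<partial>lborel)"
      using nn_integral_lborel_shear(2)[OF m(2), of "sin \<theta>"] by (simp add: Y_def)
    also have "\<dots> = (\<integral>\<^sup>+z. f z \<partial>lborel)"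
      using nn_integral_lborel_shear(1)[OF that(2), of \<alpha>] by (simp add: X_def)
    finally show ?thesis .
  qed
  show ?thesis
  proof (cases "cos \<theta> = -1")
    case False
    then show ?thesis by (rule generic) simp
  next
    case True
    then have "sin \<theta> = 0" using sin_cos_squared_add[of \<theta>] by simp
    \<comment> \<open>The excluded half-turn is the square of a quarter-turn, to which the generic
      case applies twice.\<close>
    then have "cis \<theta> = \<i> * \<i>" using True by (simp add: complex_eq_iff)
    then have "(\<integral>\<^sup>+z. f (z * cis \<theta>) \<partial>lborel) = (\<integral>\<^sup>+z. f (z * cis (pi / 2) * cis (pi / 2)) \<partial>lborel)"
      by (simp add: mult.assoc)
    also have "\<dots> = (\<integral>\<^sup>+z. f (z * cis (pi / 2)) \<partial>lborel)"
      by (rule generic[where f="\<lambda>z. f (z * cis (pi / 2))"]) (auto simp del: cis_pi_half)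
    also have "\<dots> = (\<integral>\<^sup>+z. f z \<partial>lborel)" by (rule generic) auto
    finally show ?thesis .
  qed
qed

text \<open>Area is invariant under each rotation, so the integral equals its average over all
  rotations; exchanging the order of integration turns the integrand into its circle mean. This
  takes the place of polar coordinates.\<close>

lemma nn_integral_disk_circle_mean:
  assumes f: "f holomorphic_on ball 0 1" and p: "0 < p"
  shows "(\<integral>\<^sup>+z. ennreal (norm (f z) powr p) * indicator (ball 0 1) z \<partial>lborel) =
    (\<integral>\<^sup>+z. ennreal (circle_mean p f z) * indicator (ball 0 1) z \<partial>lborel)"
proof -
  define h where "h = (\<lambda>z. ennreal (norm (f z) powr p) * indicator (ball 0 1) z)"
  have "(\<lambda>z. norm (f z) powr p) \<in> borel_measurable (restrict_space borel (ball 0 1))"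
    using f p by (intro borel_measurable_continuous_on_restrict continuous_on_norm_powr
        holomorphic_on_imp_continuous_on)
  then have "(\<lambda>z. ennreal (norm (f z) powr p)) \<in> borel_measurable (restrict_space borel (ball 0 1))"
    by measurable
  then have [measurable]: "h \<in> borel_measurable borel"
    unfolding h_def by (subst (asm) borel_measurable_restrict_space_iff_ennreal) auto
  have [measurable]: "(\<lambda>x. indicator {0..1} (snd x) :: ennreal) \<in> borel_measurable ((lborel :: complex measure) \<Otimes>\<^sub>M (lborel :: real measure))"
    by (rule measurable_compose[OF measurable_snd]) simp
  have [measurable]: "(\<lambda>t. cis (2 * pi * t)) \<in> borel_measurable borel"
    by (intro borel_measurable_continuous_onI continuous_intros)
  have "(\<integral>\<^sup>+z. h z \<partial>lborel) = (\<integral>\<^sup>+t. (\<integral>\<^sup>+z. h z \<partial>lborel) * indicator {0..1::real} t \<partial>lborel)"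
    by (simp add: nn_integral_cmult_indicator)
  also have "\<dots> = (\<integral>\<^sup>+t. (\<integral>\<^sup>+z. h (z * cis (2 * pi * t)) \<partial>lborel) * indicator {0..1::real} t \<partial>lborel)"
    by (simp add: nn_integral_lborel_rotate)
  also have "\<dots> = (\<integral>\<^sup>+t. (\<integral>\<^sup>+z. h (z * cis (2 * pi * t)) * indicator {0..1::real} t \<partial>lborel) \<partial>lborel)"
    by (intro nn_integral_cong nn_integral_multc[symmetric]) simp
  also have "\<dots> = (\<integral>\<^sup>+z. (\<integral>\<^sup>+t. h (z * cis (2 * pi * t)) * indicator {0..1::real} t \<partial>lborel) \<partial>lborel)"
    by (rule lborel_pair.Fubini') measurable
  also have "\<dots> = (\<integral>\<^sup>+z. ennreal (circle_mean p f z) * indicator (ball 0 1) z \<partial>lborel)"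
  proof (rule nn_integral_cong)
    fix z :: complex
    show "(\<integral>\<^sup>+t. h (z * cis (2 * pi * t)) * indicator {0..1::real} t \<partial>lborel) =
      ennreal (circle_mean p f z) * indicator (ball 0 1) z"
    proof (cases "norm z < 1")
      case True
      note cs = holomorphic_continuous_on_sphere[OF f True]
      have "continuous_on UNIV (\<lambda>t. norm (f (z * cis (2 * pi * t))) powr p)"
        by (intro continuous_on_norm_powr[OF continuous_on_circle[OF cs]] p)
      then have m: "(\<lambda>t. norm (f (z * cis (2 * pi * t))) powr p) \<in> borel_measurable borel"
        by (rule borel_measurable_continuous_onI)
      have "((\<lambda>t. norm (f (z * cis (2 * pi * t))) powr p) has_integral circle_mean p f z) {0..1}"
        unfolding circle_mean_def by (intro integrable_integral integrable_circle_mean[OF cs p])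
      then have "((\<lambda>t. if t \<in> {0..1} then norm (f (z * cis (2 * pi * t))) powr p else 0)
          has_integral circle_mean p f z) UNIV"
        by (simp only: has_integral_restrict_UNIV)
      then have "(\<integral>\<^sup>+t. ennreal (if t \<in> {0..1} then norm (f (z * cis (2 * pi * t))) powr p else 0) \<partial>lborel) =
          ennreal (circle_mean p f z)"
        using m by (intro nn_integral_has_integral_lborel) auto
      also have "(\<lambda>t. ennreal (if t \<in> {0..1} then norm (f (z * cis (2 * pi * t))) powr p else 0)) =
          (\<lambda>t. h (z * cis (2 * pi * t)) * indicator {0..1} t)"
        using True by (auto simp: h_def fun_eq_iff indicator_def)
      finally show ?thesis using True by simp
    qed (simp add: h_def)
  qed
  finally show ?thesis by (simp add: h_def)
qed

section \<open>Dyadic circles and products of Blaschke factors\<close>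

text \<open>Once \<open>b n > 1 / 2\<close>, \<open>- ln (b n) \<le> 2 * (1 - b n)\<close>, so the
  negative logarithms are summable. As no factor exceeds 1, their total bounds all finite
  subproducts at once, whichever indices they use.\<close>

lemma prod_lower_bound:
  fixes b :: "nat \<Rightarrow> real"
  assumes b: "\<And>n. 0 < b n" "\<And>n. b n \<le> 1" and s: "summable (\<lambda>n. 1 - b n)"
  obtains c where "0 < c" "\<And>I. finite I \<Longrightarrow> c \<le> prod b I"
proof -
  have "eventually (\<lambda>n. norm (- ln (b n)) \<le> 2 * (1 - b n)) sequentially"
    using order_tendstoD(2)[OF summable_LIMSEQ_zero[OF s], of "1/2", simplified]
  proof eventually_elim
    case (elim n)
    have "- ln (b n) = ln (1 / b n)" using b(1)[of n] by (simp add: ln_div)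
    also have "\<dots> \<le> 1 / b n - 1" using b(1)[of n] by (intro ln_le_minus_one) auto
    also have "\<dots> = (1 - b n) / b n" using b(1)[of n] by (simp add: field_simps)
    also have "\<dots> \<le> (1 - b n) / (1 / 2)" using b[of n] elim by (intro divide_left_mono) auto
    finally show ?case using b[of n] by simp
  qed
  then have sln: "summable (\<lambda>n. - ln (b n))"
    by (rule summable_comparison_test_ev) (intro summable_mult s)
  show ?thesis
  proof (rule that[of "exp (- suminf (\<lambda>n. - ln (b n)))"])
    fix I :: "nat set" assume I: "finite I"
    have "(\<Sum>n\<in>I. - ln (b n)) \<le> suminf (\<lambda>n. - ln (b n))"
      using b I by (intro sum_le_suminf sln) auto
    then have "exp (- suminf (\<lambda>n. - ln (b n))) \<le> exp (\<Sum>n\<in>I. ln (b n))"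
      by (simp add: sum_negf)
    also have "\<dots> = prod b I" using b I by (simp add: exp_sum)
    finally show "exp (- suminf (\<lambda>n. - ln (b n))) \<le> prod b I" .
  qed simp
qed

locale dyadic_circles =
  fixes a :: real
  assumes a_pos: "0 < a" and a_lt_1: "a < 1"
begin

text \<open>Repeated square roots of \<open>a\<close>: the power \<open>2 ^ i\<close> carries the
  circle of level \<open>q\<close> to that of level \<open>q - i\<close> if
  \<open>i \<le> q\<close>, and to radius \<open>a ^ 2 ^ (i - q)\<close>, doubly exponentially
  small, if \<open>i \<ge> q\<close>.\<close>

definition rad :: "nat \<Rightarrow> real" where
  "rad q = a powr (1 / 2 ^ q)"

lemma rad_0 [simp]: "rad 0 = a"
  using a_pos by (simp add: rad_def)

lemma rad_pos [simp]: "0 < rad q"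
  using a_pos by (simp add: rad_def)

lemma rad_nonzero [simp]: "rad q \<noteq> 0"
  using rad_pos[of q] by linarith

lemma rad_nonneg [simp]: "0 \<le> rad q"
  using rad_pos[of q] by linarith

lemma abs_rad [simp]: "\<bar>rad q\<bar> = rad q"
  using rad_pos[of q] by simp

lemma rad_lt_1 [simp]: "rad q < 1"
  using a_pos a_lt_1 by (simp add: rad_def powr01_less_one)

lemma rad_power: "i \<le> q \<Longrightarrow> rad q ^ 2 ^ i = rad (q - i)"
  using a_pos by (simp add: rad_def powr_power power_diff)

lemma rad_power': "q \<le> i \<Longrightarrow> rad q ^ 2 ^ i = a ^ 2 ^ (i - q)"
proof -
  assume "q \<le> i"
  then have "rad q ^ 2 ^ i = (rad q ^ 2 ^ q) ^ 2 ^ (i - q)"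
    by (simp add: power_mult[symmetric] power_add[symmetric])
  then show ?thesis by (simp add: rad_power)
qed

lemma rad_Suc_square: "rad (Suc q) ^ 2 = rad q"
  using rad_power[of 1 "Suc q"] by simp

lemma rad_less_Suc: "rad q < rad (Suc q)"
  using rad_Suc_square[of q] rad_pos[of "Suc q"] rad_lt_1[of "Suc q"]
  by (metis mult.right_neutral mult_strict_left_mono power2_eq_square)

lemma rad_strict_mono: "strict_mono rad"
  using rad_less_Suc by (simp add: strict_mono_Suc_iff)

lemma rad_mono: "q \<le> q' \<Longrightarrow> rad q \<le> rad q'"
  using rad_strict_mono by (simp add: strict_mono_less_eq)

lemma a_less_rad: "0 < q \<Longrightarrow> a < rad q"
  using strict_monoD[OF rad_strict_mono, of 0 q] by simp

lemma a_le_rad: "a \<le> rad q"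
  using rad_mono[of 0 q] by simp

text \<open>Bernoulli's inequality for the \<open>2 ^ q\<close>-th power of \<open>rad q\<close>,
  which is \<open>a\<close>.\<close>

lemma one_minus_rad_ge: "(1 - a) / 2 ^ q \<le> 1 - rad q"
proof -
  have "1 + real (2 ^ q) * (- (1 - rad q)) \<le> (1 + - (1 - rad q)) ^ 2 ^ q"
    using rad_pos[of q] by (intro Bernoulli_inequality) linarith
  then have "1 - 2 ^ q * (1 - rad q) \<le> a" using rad_power[of q q] by (simp add: algebra_simps)
  then show ?thesis by (simp add: field_simps)
qed

text \<open>When \<open>1 - rad q\<close> is split off from \<open>1 - rad q ^ 2 ^ q\<close>, the
  remaining geometric sum has \<open>2 ^ q\<close> terms, each at least \<open>a\<close>.\<close>

lemma one_minus_rad_le: "1 - rad q \<le> (1 - a) / (a * 2 ^ q)"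
proof -
  have "a \<le> rad q ^ n" if "n < 2 ^ q" for n
    using power_decreasing[of n "2 ^ q" "rad q"] that rad_power[of q q] rad_lt_1[of q] by simp
  then have "(\<Sum>n<(2::nat) ^ q. a) \<le> (\<Sum>n<2 ^ q. rad q ^ n)" by (intro sum_mono) auto
  then have "(1 - rad q) * (2 ^ q * a) \<le> (1 - rad q) * (\<Sum>n<2 ^ q. rad q ^ n)"
    by (intro mult_left_mono) (auto intro: less_imp_le)
  also have "\<dots> = 1 - a"
    by (simp add: one_diff_power_eq[symmetric] rad_power)
  finally show ?thesis using a_pos by (simp add: field_simps)
qed

lemma rad_tendsto_1: "rad \<longlonglongrightarrow> 1"
proof -
  have "(\<lambda>q. 1 - rad q) \<longlonglongrightarrow> 0"
  proof (rule tendsto_sandwich[of "\<lambda>_. 0"])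
    show "(\<lambda>q. (1 - a) / a * (1 / 2) ^ q) \<longlonglongrightarrow> 0"
      by (intro tendsto_mult_right_zero LIMSEQ_power_zero) simp
    show "eventually (\<lambda>q. 1 - rad q \<le> (1 - a) / a * (1 / 2) ^ q) sequentially"
      using one_minus_rad_le by (simp add: field_simps)
  qed (auto intro!: always_eventually less_imp_le)
  then show ?thesis using tendsto_diff[OF tendsto_const[of 1], of "\<lambda>q. 1 - rad q" 0] by simp
qed

lemma ex_less_rad: "x < 1 \<Longrightarrow> \<exists>q. x < rad q"
  using order_tendstoD(1)[OF rad_tendsto_1, of x] by (auto simp: eventually_sequentially)

text \<open>For \<open>l < 2 ^ q\<close> these are exactly the roots of
  \<open>z ^ 2 ^ q = a\<close>, so a single factor in \<open>z ^ 2 ^ q\<close> can vanish on the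
  whole level.\<close>

definition pt :: "nat \<Rightarrow> nat \<Rightarrow> complex" where
  "pt q l = of_real (rad q) * cis (2 * pi * l / 2 ^ q)"

lemma norm_pt [simp]: "norm (pt q l) = rad q"
  by (simp add: pt_def norm_mult)

lemma pt_nonzero [simp]: "pt q l \<noteq> 0"
  by (simp add: pt_def)

lemma pt_in_disk [simp]: "pt q l \<in> ball 0 1"
  by simp

lemma pt_power: "q \<le> i \<Longrightarrow> pt q l ^ 2 ^ i = of_real (a ^ 2 ^ (i - q))"
proof -
  assume q: "q \<le> i"
  have "cis (2 * pi * l / 2 ^ q) ^ 2 ^ i = (cis (2 * pi * l / 2 ^ q) ^ 2 ^ q) ^ 2 ^ (i - q)"
    using q by (simp add: power_mult[symmetric] power_add[symmetric])
  also have "cis (2 * pi * l / 2 ^ q) ^ 2 ^ q = cis (real (2 ^ q) * (2 * pi * l / 2 ^ q))"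
    by (rule Complex.DeMoivre)
  also have "real (2 ^ q) * (2 * pi * l / 2 ^ q) = 2 * pi * l" by simp
  also have "cis (2 * pi * l) = 1" by (simp add: cis_multiple_2pi)
  finally show ?thesis using q by (simp add: pt_def power_mult_distrib rad_power' flip: of_real_power)
qed

text \<open>The Blaschke factor with zero \<open>a\<close>, divided by its value at 0. Normalised in
  this way, its values at high powers of \<open>z\<close> tend to 1, so adding high levels hardly
  changes a product.\<close>

definition fac :: "complex \<Rightarrow> complex" where
  "fac w = (1 - w / of_real a) / (1 - of_real a * w)"

lemma fac_denom_ge:
  fixes w :: complex
  assumes "norm w \<le> 1"
  shows "1 - a * norm w \<le> norm (1 - of_real a * w)" "1 - a \<le> norm (1 - of_real a * w)"
proof -
  have "norm (of_real a * w :: complex) = a * norm w" using a_pos by (simp add: norm_mult)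
  then show "1 - a * norm w \<le> norm (1 - of_real a * w)"
    using norm_triangle_ineq2[of 1 "of_real a * w"] by simp
  moreover have "a * norm w \<le> a * 1" using assms a_pos by (intro mult_left_mono) auto
  ultimately show "1 - a \<le> norm (1 - of_real a * w)" by simp
qed

lemma fac_denom_nonzero: "norm (w :: complex) \<le> 1 \<Longrightarrow> 1 - of_real a * w \<noteq> 0"
  using fac_denom_ge(2)[of w] a_lt_1 by auto

lemma fac_holomorphic: "fac holomorphic_on ball 0 1"
  unfolding fac_def using a_pos fac_denom_nonzero by (intro holomorphic_intros) auto

lemma fac_0 [simp]: "fac 0 = 1"
  by (simp add: fac_def)

lemma fac_a [simp]: "fac (of_real a) = 0"
  using a_pos by (simp add: fac_def)

lemma fac_eq_0_iff: "norm w \<le> 1 \<Longrightarrow> fac w = 0 \<longleftrightarrow> w = of_real a"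
  using a_pos fac_denom_nonzero[of w] by (auto simp: fac_def)

text \<open>The identity behind the pseudohyperbolic distance. The upper bound \<open>1 / a\<close>
  and the lower bound on circles are both read off from it.\<close>

lemma fac_norm_square:
  assumes "norm w \<le> 1"
  shows "(norm (fac w))\<^sup>2 = (1 / a\<^sup>2) * (1 - (1 - a\<^sup>2) * (1 - (norm w)\<^sup>2) / (norm (1 - of_real a * w))\<^sup>2)"
proof -
  have "fac w = (1 / of_real a) * ((of_real a - w) / (1 - of_real a * w))"
    using a_pos by (simp add: fac_def field_simps)
  then have "(norm (fac w))\<^sup>2 = (1 / a\<^sup>2) * ((norm (of_real a - w))\<^sup>2 / (norm (1 - of_real a * w))\<^sup>2)"
    using a_pos by (simp add: norm_mult norm_divide power_mult_distrib power_divide)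
  also have "(norm (of_real a - w))\<^sup>2 = (norm (1 - of_real a * w))\<^sup>2 - (1 - a\<^sup>2) * (1 - (norm w)\<^sup>2)"
    unfolding cmod_power2 by (simp add: algebra_simps power2_eq_square)
  also have "\<dots> / (norm (1 - of_real a * w))\<^sup>2 = 1 - (1 - a\<^sup>2) * (1 - (norm w)\<^sup>2) / (norm (1 - of_real a * w))\<^sup>2"
    using fac_denom_nonzero[OF assms] by (simp add: diff_divide_distrib)
  finally show ?thesis .
qed

lemma norm_fac_le:
  assumes "norm w \<le> 1" shows "norm (fac w) \<le> 1 / a"
proof -
  have "0 \<le> (1 - a\<^sup>2) * (1 - (norm w)\<^sup>2) / (norm (1 - of_real a * w))\<^sup>2"
    using assms a_pos a_lt_1 by (intro divide_nonneg_nonneg mult_nonneg_nonneg) (auto simp: power_le_one)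
  then have "(norm (fac w))\<^sup>2 \<le> (1 / a\<^sup>2) * 1"
    unfolding fac_norm_square[OF assms] by (intro mult_left_mono) auto
  then have "(norm (fac w))\<^sup>2 \<le> (1 / a)\<^sup>2" by (simp add: power_divide)
  then show ?thesis by (rule power2_le_imp_le) (use a_pos in simp)
qed

text \<open>The bound \<open>1 / a\<close> is useless for long products. Here the deviation from
  \<open>fac 0 = 1\<close> is estimated linearly, so that factors with summable arguments have a
  bounded product.\<close>

lemma norm_fac_le':
  assumes "norm w \<le> 1" shows "norm (fac w) \<le> 1 + (1 + a) / a * norm w"
proof -
  have "fac w = 1 - of_real (1 / a - a) * w / (1 - of_real a * w)"
    using a_pos fac_denom_nonzero[OF assms] by (simp add: fac_def field_simps)
  then have "norm (fac w) \<le> 1 + norm (of_real (1 / a - a) * w / (1 - of_real a * w))"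
    by (metis norm_one norm_triangle_ineq4)
  also have "norm (of_real (1 / a - a) * w / (1 - of_real a * w)) = (1 / a - a) * norm w / norm (1 - of_real a * w)"
  proof -
    have "a * a \<le> 1" using a_pos a_lt_1 by (metis mult_le_one less_imp_le)
    then have "\<bar>1 / a - a\<bar> = 1 / a - a" using a_pos by (simp add: field_simps)
    then show ?thesis by (simp only: norm_mult norm_divide norm_of_real)
  qed
  also have "\<dots> \<le> (1 / a - a) * norm w / (1 - a)"
  proof (rule divide_left_mono)
    have "a * a \<le> 1" using a_pos a_lt_1 by (metis mult_le_one less_imp_le)
    then have "0 \<le> 1 / a - a" using a_pos by (simp add: field_simps)
    then show "0 \<le> (1 / a - a) * norm w" by simp
  next
    show "0 < norm (1 - of_real a * w) * (1 - a)"
      using a_lt_1 fac_denom_ge(2)[OF assms] by (intro mult_pos_pos) linarith+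
  qed (rule fac_denom_ge(2)[OF assms])
  also have "(1 / a - a) * norm w / (1 - a) = (1 + a) / a * norm w"
    using a_pos a_lt_1 by (simp add: field_simps power2_eq_square)
  finally show ?thesis by simp
qed

text \<open>Among the points of modulus \<open>norm w\<close>, the positive one is nearest to the
  zero \<open>a\<close>, and the bound is the modulus of \<open>fac\<close> there. In the identity
  this amounts to replacing \<open>norm (1 - of_real a * w)\<close> by its least value
  \<open>1 - a * norm w\<close>.\<close>

lemma norm_fac_ge:
  assumes "a \<le> norm w" "norm w \<le> 1" shows "(1 / a) * ((norm w - a) / (1 - a * norm w)) \<le> norm (fac w)"
proof -
  define \<tau> where "\<tau> = norm w"
  have "a * \<tau> \<le> a * 1" using assms a_pos by (intro mult_left_mono) (auto simp: \<tau>_def)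
  then have pos: "0 < 1 - a * \<tau>" using a_lt_1 by linarith
  have "(1 - a\<^sup>2) * (1 - \<tau>\<^sup>2) / (norm (1 - of_real a * w))\<^sup>2 \<le> (1 - a\<^sup>2) * (1 - \<tau>\<^sup>2) / (1 - a * \<tau>)\<^sup>2"
    using pos fac_denom_ge(1)[OF assms(2)] fac_denom_nonzero[OF assms(2)] a_pos a_lt_1 assms
    by (intro divide_left_mono mult_nonneg_nonneg power_mono) (auto simp: \<tau>_def power_le_one)
  then have "(1 / a\<^sup>2) * (1 - (1 - a\<^sup>2) * (1 - \<tau>\<^sup>2) / (1 - a * \<tau>)\<^sup>2) \<le> (norm (fac w))\<^sup>2"
    unfolding fac_norm_square[OF assms(2)] \<tau>_def[symmetric] by (intro mult_left_mono) auto
  also have "1 - (1 - a\<^sup>2) * (1 - \<tau>\<^sup>2) / (1 - a * \<tau>)\<^sup>2 = ((\<tau> - a) / (1 - a * \<tau>))\<^sup>2"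
  proof -
    have "(1 - a\<^sup>2) * (1 - \<tau>\<^sup>2) = (1 - a * \<tau>)\<^sup>2 - (\<tau> - a)\<^sup>2"
      by (simp add: algebra_simps power2_eq_square)
    then show ?thesis using pos unfolding power_divide by (simp only: diff_divide_distrib) simp
  qed
  finally have "((1 / a) * ((\<tau> - a) / (1 - a * \<tau>)))\<^sup>2 \<le> (norm (fac w))\<^sup>2"
    by (simp only: power_mult_distrib power_one_over)
  then have "(1 / a) * ((\<tau> - a) / (1 - a * \<tau>)) \<le> norm (fac w)"
    by (rule power2_le_imp_le) simp
  then show ?thesis by (simp only: \<tau>_def)
qed

text \<open>Indexed by arbitrary sets of levels: initial segments, blocks of consecutive levels and
  segments with one level left out all occur.\<close>

definition level_prod :: "nat set \<Rightarrow> complex \<Rightarrow> complex" where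
  "level_prod I z = (\<Prod>i\<in>I. fac (z ^ 2 ^ i))"

section \<open>Bounds for products over levels\<close>

lemma power_in_disk: "norm (z :: complex) < 1 \<Longrightarrow> norm (z ^ 2 ^ i) < 1"
  by (simp add: norm_power power_less_one_iff)

lemma fac_power_holomorphic: "(\<lambda>z. fac (z ^ 2 ^ i)) holomorphic_on ball 0 1"
  using holomorphic_on_compose_gen[OF _ fac_holomorphic, of "\<lambda>z. z ^ 2 ^ i" "ball 0 1"] power_in_disk
  by (force simp: o_def intro!: holomorphic_intros)

lemma level_prod_holomorphic: "level_prod I holomorphic_on ball 0 1"
  unfolding level_prod_def by (intro holomorphic_on_prod fac_power_holomorphic)

lemma level_prod_0 [simp]: "level_prod I 0 = 1"
  by (simp add: level_prod_def power_0_left)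

lemma level_prod_pt_eq_0: "finite I \<Longrightarrow> q \<in> I \<Longrightarrow> level_prod I (pt q l) = 0"
  unfolding level_prod_def by (rule prod_zero) (auto simp: pt_power intro!: bexI[of _ q])

lemma level_prod_Un: "finite I \<Longrightarrow> finite J \<Longrightarrow> I \<inter> J = {} \<Longrightarrow> level_prod (I \<union> J) z = level_prod I z * level_prod J z"
  unfolding level_prod_def by (rule prod.union_disjoint)

lemma norm_level_prod_le:
  assumes "norm z < 1"
  shows "norm (level_prod I z) \<le> (1 / a) ^ card I"
proof -
  have "norm (level_prod I z) = (\<Prod>i\<in>I. norm (fac (z ^ 2 ^ i)))"
    by (simp add: level_prod_def prod_norm)
  also have "\<dots> \<le> (\<Prod>i\<in>I. 1 / a)"
    by (intro prod_mono conjI norm_fac_le less_imp_le[OF power_in_disk] assms norm_ge_zero)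
  finally show ?thesis by simp
qed

definition tail_const :: real where
  "tail_const = exp ((1 + a) / a / (1 - a))"

lemma tail_const_ge_1: "1 \<le> tail_const"
  using a_pos a_lt_1 by (simp add: tail_const_def)

text \<open>For \<open>i \<ge> q\<close> the argument of the factor of level \<open>i\<close> has
  modulus at most \<open>a ^ (i - q)\<close>; the linear estimate of \<open>fac\<close> and
  \<open>1 + x \<le> exp x\<close> turn the product into the exponential of a geometric series,
  whatever the number of levels.\<close>

lemma norm_level_prod_tail_le:
  assumes z: "norm z \<le> rad q" and I: "finite I" "I \<subseteq> {q..}"
  shows "norm (level_prod I z) \<le> tail_const"
proof -
  let ?\<kappa> = "(1 + a) / a"
  have \<kappa>: "0 \<le> ?\<kappa>" using a_pos by simp
  have "norm (level_prod I z) = (\<Prod>i\<in>I. norm (fac (z ^ 2 ^ i)))"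
    by (simp add: level_prod_def prod_norm)
  also have "\<dots> \<le> (\<Prod>i\<in>I. exp (?\<kappa> * a ^ (i - q)))"
  proof (intro prod_mono conjI)
    fix i assume "i \<in> I"
    then have qi: "q \<le> i" using I by auto
    have "norm z \<le> 1" using z rad_lt_1[of q] by linarith
    then have 1: "norm (z ^ 2 ^ i) \<le> 1" by (simp add: norm_power power_le_one)
    have "norm (z ^ 2 ^ i) \<le> rad q ^ 2 ^ i" using z by (simp add: norm_power power_mono)
    also have "\<dots> = a ^ 2 ^ (i - q)" using qi by (rule rad_power')
    also have "\<dots> \<le> a ^ (i - q)"
      using a_pos a_lt_1 by (intro power_decreasing) (auto intro: less_imp_le less_exp)
    finally have "1 + ?\<kappa> * norm (z ^ 2 ^ i) \<le> 1 + ?\<kappa> * a ^ (i - q)"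
      using \<kappa> by (intro add_left_mono mult_left_mono)
    also have "\<dots> \<le> exp (?\<kappa> * a ^ (i - q))" by (rule exp_ge_add_one_self)
    finally show "norm (fac (z ^ 2 ^ i)) \<le> exp (?\<kappa> * a ^ (i - q))"
      using norm_fac_le'[OF 1] by linarith
  qed auto
  also have "\<dots> = exp (?\<kappa> * (\<Sum>i\<in>I. a ^ (i - q)))"
    using I by (simp add: exp_sum sum_distrib_left)
  also have "\<dots> \<le> tail_const"
  proof -
    have "inj_on (\<lambda>i. i - q) I"
      using I by (intro inj_onI) (metis atLeast_iff eq_diff_iff subsetD)
    then have "(\<Sum>i\<in>I. a ^ (i - q)) = (\<Sum>d\<in>(\<lambda>i. i - q) ` I. a ^ d)"
      by (simp add: sum.reindex)
    also have "\<dots> \<le> (\<Sum>d. a ^ d)"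
      using I a_pos a_lt_1 by (intro sum_le_suminf summable_geometric) auto
    finally have "(\<Sum>i\<in>I. a ^ (i - q)) \<le> 1 / (1 - a)" using a_pos a_lt_1 by (simp add: suminf_geometric)
    from mult_left_mono[OF this \<kappa>] show ?thesis by (simp add: tail_const_def)
  qed
  finally show ?thesis .
qed

text \<open>On the circle of level \<open>k + j\<close> the factor \<open>l + 1\<close> levels below
  has an argument of modulus \<open>rad (Suc l)\<close>, independently of \<open>k\<close> and
  \<open>j\<close>. It falls short of the full size \<open>1 / a\<close> at worst by a ratio
  \<open>b l\<close> with \<open>1 - b l\<close> of order \<open>1 / 2 ^ l\<close>, and products of
  these ratios stay away from 0.\<close>

lemma level_prod_lower:
  obtains c where "0 < c" "\<And>z k j. norm z = rad (k + j) \<Longrightarrow> c * (1 / a) ^ j \<le> norm (level_prod {k..<k + j} z)"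
proof -
  define b where "b = (\<lambda>l. (rad (Suc l) - a) / (1 - a * rad (Suc l)))"
  have den: "1 - a \<le> 1 - a * rad l" for l
    using mult_left_mono[of "rad l" 1 a] a_pos by (simp add: less_imp_le)
  have den0: "0 < 1 - a * rad l" for l using den[of l] a_lt_1 by linarith
  have b1: "1 - b l = (1 - rad (Suc l)) * (1 + a) / (1 - a * rad (Suc l))" for l
    using den0[of "Suc l"] by (simp add: b_def field_simps)
  have b1': "0 \<le> 1 - b l" for l
    unfolding b1 using den0[of "Suc l"] a_pos rad_lt_1[of "Suc l"]
    by (intro divide_nonneg_pos mult_nonneg_nonneg) (auto simp del: rad_lt_1)
  have "1 - b l \<le> (1 - a) / a * (1 + a) / (1 - a) * (1 / 2) ^ Suc l" for l
  proof -
    have "1 - b l \<le> (1 - rad (Suc l)) * (1 + a) / (1 - a)"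
      unfolding b1 using den[of "Suc l"] a_pos a_lt_1 rad_lt_1[of "Suc l"]
      by (intro divide_left_mono mult_nonneg_nonneg mult_pos_pos den0) (auto simp del: rad_lt_1)
    also have "\<dots> \<le> ((1 - a) / (a * 2 ^ Suc l)) * (1 + a) / (1 - a)"
      using a_pos a_lt_1 by (intro divide_right_mono mult_right_mono one_minus_rad_le) auto
    finally show ?thesis by (simp add: field_simps)
  qed
  then have "summable (\<lambda>l. 1 - b l)"
    using b1' by (intro summable_comparison_test[OF _ summable_mult[OF summable_ignore_initial_segment[OF
       summable_geometric[of "1/2::real"], of 1]]]) auto
  moreover have "0 < b l" for l using a_less_rad[of "Suc l"] den0[of "Suc l"] by (simp add: b_def)
  moreover have "b l \<le> 1" for l using b1'[of l] by simp
  ultimately obtain c where c: "0 < c" "\<And>I. finite I \<Longrightarrow> c \<le> prod b I"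
    using prod_lower_bound[of b] by blast
  show ?thesis
  proof (rule that[OF c(1)])
    fix z :: complex and k j assume z: "norm z = rad (k + j)"
    have "c * (1 / a) ^ j \<le> prod b {..<j} * (1 / a) ^ j"
      using c a_pos by (intro mult_right_mono) auto
    also have "\<dots> = (\<Prod>l<j. 1 / a * b l)"
      by (simp add: prod_dividef power_one_over)
    also have "\<dots> \<le> (\<Prod>l<j. norm (fac (z ^ 2 ^ (k + j - Suc l))))"
    proof (intro prod_mono conjI)
      fix l assume l: "l \<in> {..<j}"
      then have n: "norm (z ^ 2 ^ (k + j - Suc l)) = rad (Suc l)"
        by (simp add: norm_power z rad_power)
      show "1 / a * b l \<le> norm (fac (z ^ 2 ^ (k + j - Suc l)))"
        using norm_fac_ge[of "z ^ 2 ^ (k + j - Suc l)"] unfolding n b_def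
        by (simp add: a_le_rad less_imp_le)
      show "0 \<le> 1 / a * b l" using \<open>0 < b l\<close> a_pos by simp
    qed
    also have "\<dots> = (\<Prod>i\<in>{k..<k + j}. norm (fac (z ^ 2 ^ i)))"
      by (rule prod.reindex_bij_witness[of _ "\<lambda>i. k + j - Suc i" "\<lambda>l. k + j - Suc l"]) auto
    finally show "c * (1 / a) ^ j \<le> norm (level_prod {k..<k + j} z)"
      by (simp add: level_prod_def prod_norm)
  qed
qed

text \<open>At a point of level \<open>q\<close> the argument of the factor of level
  \<open>i > q\<close> is the positive number \<open>a ^ 2 ^ (i - q)\<close>, below the zero
  \<open>a\<close>. The factors are thus explicit and approach 1 fast enough for a positive bound
  independent of the set of levels.\<close>

lemma level_prod_pt_lower:
  obtains c where "0 < c" "\<And>q l I. finite I \<Longrightarrow> I \<subseteq> {q<..} \<Longrightarrow> c \<le> norm (level_prod I (pt q l))"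
proof -
  \<comment> \<open>The shift by \<open>Suc\<close> leaves out level \<open>q\<close> itself, whose
    factor vanishes at the point.\<close>
  define x where "x = (\<lambda>d. a ^ (2 ^ Suc d))"
  define b where "b = (\<lambda>d. (1 - x d / a) / (1 - a * x d))"
  have x: "0 < x d" "x d \<le> a ^ Suc d" "x d < a" for d
  proof -
    show "0 < x d" using a_pos by (simp add: x_def)
    have "Suc d \<le> 2 ^ Suc d" using less_exp[of "Suc d"] by linarith
    then show "x d \<le> a ^ Suc d" unfolding x_def
      using a_pos a_lt_1 by (intro power_decreasing) auto
    have "a ^ 2 ^ Suc d < a ^ 1"
      using a_pos a_lt_1 one_less_power[of "2::nat" "Suc d"] by (intro power_strict_decreasing) auto
    then show "x d < a" by (simp add: x_def)
  qed
  have den: "1 - a \<le> 1 - a * x d" for d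
    using mult_left_mono[of "x d" 1 a] x[of d] a_pos a_lt_1 by simp
  have den0: "0 < 1 - a * x d" for d using den[of d] a_lt_1 by linarith
  have b0: "0 < b d" for d using x[of d] den0[of d] a_pos by (simp add: b_def)
  have aa: "a * a \<le> 1" using a_pos a_lt_1 by (metis mult_le_one less_imp_le)
  have b1: "1 - b d = x d * (1 / a - a) / (1 - a * x d)" for d
    using den0[of d] a_pos by (simp add: b_def field_simps)
  have b1': "0 \<le> 1 - b d" for d
    unfolding b1 using den0[of d] x[of d] a_pos aa by (intro divide_nonneg_pos mult_nonneg_nonneg) (auto simp: field_simps)
  have "1 - b d \<le> (1 / a - a) / (1 - a) * a ^ Suc d" for d
  proof -
    have "1 - b d \<le> a ^ Suc d * (1 / a - a) / (1 - a)"
      unfolding b1 using den[of d] a_pos a_lt_1 aa x[of d] by (intro frac_le mult_right_mono mult_nonneg_nonneg) (auto simp: field_simps)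
    then show ?thesis by (simp add: field_simps)
  qed
  then have le: "norm (1 - b d) \<le> (1 / a - a) / (1 - a) * a ^ Suc d" for d
    using b1'[of d] by (simp only: real_norm_def abs_of_nonneg)
  have s: "summable (\<lambda>d. (1 / a - a) / (1 - a) * a ^ Suc d)"
    using a_pos a_lt_1 by (simp add: summable_geometric summable_mult)
  have "summable (\<lambda>l. 1 - b l)"
    by (rule summable_comparison_test'[OF s, of 0]) (rule le)
  moreover have "b l \<le> 1" for l using b1'[of l] by simp
  ultimately obtain c where c: "0 < c" "\<And>I. finite I \<Longrightarrow> c \<le> prod b I"
    using b0 prod_lower_bound[of b] by blast
  show ?thesis
  proof (rule that[OF c(1)])
    fix q l and I :: "nat set" assume I: "finite I" "I \<subseteq> {q<..}"
    have "norm (fac (pt q l ^ 2 ^ i)) = b (i - Suc q)" if "i \<in> I" for i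
    proof -
      have i: "q < i" using that I by auto
      then have "i - q = Suc (i - Suc q)" by simp
      then have "pt q l ^ 2 ^ i = of_real (x (i - Suc q))" using i by (simp add: pt_power x_def)
      then have "fac (pt q l ^ 2 ^ i) = of_real (b (i - Suc q))" by (simp add: fac_def b_def)
      then show ?thesis using b0[of "i - Suc q"] by simp
    qed
    then have "norm (level_prod I (pt q l)) = (\<Prod>i\<in>I. b (i - Suc q))"
      by (simp add: level_prod_def prod_norm[symmetric])
    also have "inj_on (\<lambda>i. i - Suc q) I"
      using I by (intro inj_onI) (metis Suc_leI eq_diff_iff greaterThan_iff subsetD)
    then have "(\<Prod>i\<in>I. b (i - Suc q)) = prod b ((\<lambda>i. i - Suc q) ` I)"
      by (simp add: prod.reindex)
    finally show "c \<le> norm (level_prod I (pt q l))" using c(2)[of "(\<lambda>i. i - Suc q) ` I"] I by simp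
  qed
qed

end

section \<open>Localising kernels\<close>

text \<open>Divided by their sum the \<open>y i\<close> lie between 0 and 1, where
  \<open>t \<le> t powr p\<close>.\<close>

lemma powr_sum_le_sum_powr:
  fixes y :: "'i \<Rightarrow> real"
  assumes y: "\<And>i. i \<in> I \<Longrightarrow> 0 \<le> y i" and p: "0 < p" "p \<le> 1"
  shows "(\<Sum>i\<in>I. y i) powr p \<le> (\<Sum>i\<in>I. y i powr p)"
proof (cases "sum y I > 0")
  case False
  then have "sum y I = 0" using sum_nonneg[of I y] y by force
  then show ?thesis by (simp add: sum_nonneg)
next
  case True
  define Y where "Y = sum y I"
  have Y: "0 < Y" using True by (simp add: Y_def)
  have fin: "finite I" using True by (cases "finite I") auto
  have "y i / Y \<le> (y i / Y) powr p" if "i \<in> I" for i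
  proof (cases "y i = 0")
    case False
    have "y i \<le> Y" unfolding Y_def using that y fin by (intro member_le_sum) auto
    then have "(y i / Y) powr 1 \<le> (y i / Y) powr p"
      using p Y y[OF that] False by (intro powr_mono') auto
    then show ?thesis using y[OF that] Y by simp
  qed auto
  then have "(\<Sum>i\<in>I. y i / Y) \<le> (\<Sum>i\<in>I. (y i / Y) powr p)" by (rule sum_mono)
  also have "(\<Sum>i\<in>I. y i / Y) = 1" using Y by (simp add: Y_def sum_divide_distrib[symmetric])
  also have "(\<Sum>i\<in>I. (y i / Y) powr p) = (\<Sum>i\<in>I. y i powr p) / Y powr p"
    using Y y by (simp add: powr_divide sum_divide_distrib)
  finally show ?thesis using Y by (simp add: Y_def field_simps)
qed

lemma powr_sum_le_weighted:
  fixes x v :: "'i \<Rightarrow> real"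
  assumes fin: "finite I" and x: "\<And>i. i \<in> I \<Longrightarrow> 0 \<le> x i" and v: "\<And>i. i \<in> I \<Longrightarrow> 0 \<le> v i"
    and V: "sum v I \<le> V" "1 \<le> V" and p: "1 \<le> p"
  shows "(\<Sum>i\<in>I. x i * v i) powr p \<le> V powr p * (\<Sum>i\<in>I. x i powr p * v i)"
proof -
  \<comment> \<open>Indices with \<open>x i = 0\<close> or \<open>v i = 0\<close> contribute to
    neither sum; without them Jensen's inequality applies to positive numbers with weights
    \<open>v i / S\<close>.\<close>
  define J where "J = {i\<in>I. 0 < x i \<and> 0 < v i}"
  have J: "finite J" "J \<subseteq> I" using fin by (auto simp: J_def)
  have zero: "x i * v i = 0" "x i powr p * v i = 0" if "i \<in> I - J" for i
    using that x[of i] v[of i] by (auto simp: J_def)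
  have e1: "(\<Sum>i\<in>I. x i * v i) = (\<Sum>i\<in>J. x i * v i)"
    and e2: "(\<Sum>i\<in>I. x i powr p * v i) = (\<Sum>i\<in>J. x i powr p * v i)"
    using zero J fin by (auto intro!: sum.mono_neutral_right)
  show ?thesis
  proof (cases "J = {}")
    case True
    then show ?thesis using e1 e2 by simp
  next
    case False
    define S where "S = sum v J"
    have S: "0 < S" unfolding S_def using J False by (intro sum_pos) (auto simp: J_def)
    have "S \<le> sum v I" unfolding S_def using J fin v by (intro sum_mono2) auto
    then have SV: "S \<le> V" using V by simp
    have "(\<Sum>i\<in>J. (v i / S) *\<^sub>R x i) powr p \<le> (\<Sum>i\<in>J. v i / S * x i powr p)"
      using J False S
      by (intro convex_on_sum[OF _ _ powr_convex[OF p]])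
         (auto simp: J_def S_def[unfolded J_def] sum_divide_distrib[symmetric])
    then have "((\<Sum>i\<in>J. x i * v i) / S) powr p \<le> (\<Sum>i\<in>J. x i powr p * v i) / S"
      by (simp add: sum_divide_distrib mult.commute)
    then have "(\<Sum>i\<in>J. x i * v i) powr p \<le> S powr p * ((\<Sum>i\<in>J. x i powr p * v i) / S)"
      using S by (simp add: powr_divide sum_nonneg J_def field_simps)
    also have "\<dots> = S powr (p - 1) * (\<Sum>i\<in>J. x i powr p * v i)"
      using S by (simp add: powr_diff)
    also have "\<dots> \<le> V powr p * (\<Sum>i\<in>J. x i powr p * v i)"
    proof (intro mult_right_mono sum_nonneg)
      have "S powr (p - 1) \<le> V powr (p - 1)" using S SV p by (intro powr_mono2) auto
      also have "\<dots> \<le> V powr p" using V by (intro powr_mono) auto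
      finally show "S powr (p - 1) \<le> V powr p" .
    qed (auto simp: J_def)
    finally show ?thesis by (simp only: e1 e2)
  qed
qed

text \<open>Covers all exponents at once: convexity for \<open>p \<ge> 1\<close>, and subadditivity of \<open>p\<close>-th powers for
  \<open>p \<le> 1\<close>, where the power \<open>m\<close> of the weights pays for the missing convexity.\<close>

lemma powr_sum_le:
  fixes x v :: "'i \<Rightarrow> real"
  assumes fin: "finite I" and x: "\<And>i. i \<in> I \<Longrightarrow> 0 \<le> x i"
    and v: "\<And>i. i \<in> I \<Longrightarrow> 0 \<le> v i" "\<And>i. i \<in> I \<Longrightarrow> v i \<le> 1"
    and V: "sum v I \<le> V" "1 \<le> V" and p: "0 < p" and m: "1 \<le> m" "1 \<le> real m * p"
  shows "(\<Sum>i\<in>I. x i * v i ^ m) powr p \<le> V powr p * (\<Sum>i\<in>I. x i powr p * v i)"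
proof (cases "1 \<le> p")
  case True
  have "(\<Sum>i\<in>I. x i * v i ^ m) \<le> (\<Sum>i\<in>I. x i * v i)"
  proof (intro sum_mono mult_left_mono x)
    fix i assume "i \<in> I"
    then show "v i ^ m \<le> v i"
      using power_decreasing[of 1 m "v i"] v m by simp
  qed
  then have "(\<Sum>i\<in>I. x i * v i ^ m) powr p \<le> (\<Sum>i\<in>I. x i * v i) powr p"
    using p x v by (intro powr_mono2 sum_nonneg) auto
  also have "\<dots> \<le> V powr p * (\<Sum>i\<in>I. x i powr p * v i)"
    by (rule powr_sum_le_weighted[OF fin x v(1) V True])
  finally show ?thesis .
next
  case False
  have "(\<Sum>i\<in>I. x i * v i ^ m) powr p \<le> (\<Sum>i\<in>I. (x i * v i ^ m) powr p)"
    using x v p False by (intro powr_sum_le_sum_powr) auto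
  also have "\<dots> \<le> (\<Sum>i\<in>I. x i powr p * v i)"
  proof (rule sum_mono)
    fix i assume i: "i \<in> I"
    have "(v i ^ m) powr p \<le> v i"
    proof (cases "v i = 0")
      case True
      then show ?thesis using m by simp
    next
      case False
      then have vi: "0 < v i" using v(1)[OF i] by simp
      then have "(v i ^ m) powr p = v i powr (real m * p)"
        by (simp add: powr_realpow[symmetric] powr_powr)
      also have "\<dots> \<le> v i powr 1" using vi v(2)[OF i] m by (intro powr_mono') auto
      finally show ?thesis using vi by simp
    qed
    then show "(x i * v i ^ m) powr p \<le> x i powr p * v i"
      using x[OF i] v[OF i] by (simp add: powr_mult mult_left_mono)
  qed
  also have "\<dots> \<le> V powr p * (\<Sum>i\<in>I. x i powr p * v i)"
    using V p v mult_right_mono[OF ge_one_powr_ge_zero[of V p], of "\<Sum>i\<in>I. x i powr p * v i"]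
    by (simp add: sum_nonneg)
  finally show ?thesis .
qed

lemma powr_add_le:
  assumes "0 \<le> x" "0 \<le> y" "0 < p"
  shows "(x + y :: real) powr p \<le> 2 powr p * (x powr p + y powr p)"
proof -
  have "(x + y) powr p \<le> (2 * max x y) powr p"
    using assms by (intro powr_mono2) auto
  also have "\<dots> = 2 powr p * max x y powr p" using assms by (simp add: powr_mult)
  also have "max x y powr p \<le> x powr p + y powr p" by (auto simp: max_def)
  finally show ?thesis by simp
qed

section \<open>Kernels for roots of unity\<close>

definition kern :: "nat \<Rightarrow> complex \<Rightarrow> complex" where
  "kern N u = (\<Sum>n<N. u ^ n) / of_nat N"

lemma kern_1 [simp]: "0 < N \<Longrightarrow> kern N 1 = 1"
  by (simp add: kern_def)

text \<open>Together with the value 1 at 1 this makes \<open>kern N\<close> the Lagrange polynomial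
  of 1 among the \<open>N\<close>-th roots of unity; it is a one-sided Dirichlet kernel divided by
  \<open>N\<close>.\<close>

lemma kern_root_of_unity: "u ^ N = 1 \<Longrightarrow> u \<noteq> 1 \<Longrightarrow> kern N u = 0"
  by (simp add: kern_def sum_gp_strict)

lemma cis_nat_inj:
  assumes "n < N" "m < N" "cis (2 * pi * real n / real N) = cis (2 * pi * real m / real N)"
  shows "n = m"
proof -
  have "inj_on (\<lambda>k. cis (2 * pi * real k / real N)) {..<N}"
    using Complex.bij_betw_roots_unity[of N] assms by (auto simp: bij_betw_def)
  then show ?thesis using assms by (auto dest: inj_onD)
qed

lemma cis_div_power: "0 < N \<Longrightarrow> cis (2 * pi * real n / real N) ^ N = 1"
proof -
  assume "0 < N"
  have "cis (2 * pi * real n / real N) ^ N = cis (real N * (2 * pi * real n / real N))"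
    by (rule Complex.DeMoivre)
  also have "real N * (2 * pi * real n / real N) = 2 * pi * real n" using \<open>0 < N\<close> by simp
  finally show ?thesis by simp
qed

text \<open>Orthogonality of the characters of the cyclic group of order \<open>N\<close>: the
  summands are the powers of an \<open>N\<close>-th root of unity \<open>\<eta>\<close>, which is 1
  only if \<open>n = m\<close>.\<close>

lemma sum_characters:
  assumes "n < N" "m < N"
  shows "(\<Sum>l<N. cis (2 * pi * real l / real N) ^ n * cnj (cis (2 * pi * real l / real N) ^ m)) =
    (if n = m then of_nat N else 0)"
proof -
  define \<eta> where "\<eta> = cis (2 * pi * real n / real N) / cis (2 * pi * real m / real N)"
  have swap: "cis (2 * pi * real l / real N) ^ n = cis (2 * pi * real n / real N) ^ l" for l n
    unfolding Complex.DeMoivre by (simp add: field_simps)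
  have "cis (2 * pi * real l / real N) ^ n * cnj (cis (2 * pi * real l / real N) ^ m) = \<eta> ^ l" for l :: nat
  proof -
    have "cnj (cis x ^ l) = inverse (cis x ^ l)" for x
      by (simp add: cis_cnj power_inverse[symmetric])
    then show ?thesis unfolding swap[of l n] swap[of l m] \<eta>_def power_divide
      by (simp only: divide_inverse)
  qed
  then have "(\<Sum>l<N. cis (2 * pi * real l / real N) ^ n * cnj (cis (2 * pi * real l / real N) ^ m)) = (\<Sum>l<N. \<eta> ^ l)"
    by simp
  also have "\<dots> = (if n = m then of_nat N else 0)"
  proof (cases "n = m")
    case True
    then show ?thesis by (simp add: \<eta>_def)
  next
    case False
    have "\<eta> ^ N = 1" using assms by (simp add: \<eta>_def power_divide cis_div_power)
    moreover have "\<eta> \<noteq> 1" using False cis_nat_inj[OF assms] by (auto simp: \<eta>_def)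
    ultimately show ?thesis using False by (simp add: sum_gp_strict)
  qed
  finally show ?thesis .
qed

text \<open>Parseval's identity for the discrete Fourier transform: after expanding the squares only
  diagonal terms survive, and the result is an average of \<open>N\<close> numbers, each at most
  \<open>B\<^sup>2\<close>.\<close>

lemma kern_parseval:
  assumes N: "0 < N" and u: "\<And>n. n < N \<Longrightarrow> norm (u ^ n) \<le> B"
  shows "(\<Sum>l<N. (norm (kern N (u * cis (2 * pi * real l / real N))))\<^sup>2) \<le> B\<^sup>2"
proof -
  let ?e = "\<lambda>l. cis (2 * pi * real l / real N)"
  have "of_real (\<Sum>l<N. (norm (\<Sum>n<N. (u * ?e l) ^ n))\<^sup>2) =
      (\<Sum>l<N. (\<Sum>n<N. (u * ?e l) ^ n) * cnj (\<Sum>m<N. (u * ?e l) ^ m))"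
    by (simp only: of_real_sum complex_norm_square)
  also have "\<dots> = (\<Sum>l<N. \<Sum>n<N. \<Sum>m<N. u ^ n * cnj (u ^ m) * (?e l ^ n * cnj (?e l ^ m)))"
    unfolding cnj_sum sum_product by (simp add: power_mult_distrib mult_ac)
  also have "\<dots> = (\<Sum>n<N. \<Sum>l<N. \<Sum>m<N. u ^ n * cnj (u ^ m) * (?e l ^ n * cnj (?e l ^ m)))"
    by (rule sum.swap)
  also have "\<dots> = (\<Sum>n<N. \<Sum>m<N. \<Sum>l<N. u ^ n * cnj (u ^ m) * (?e l ^ n * cnj (?e l ^ m)))"
    by (intro sum.cong refl sum.swap)
  also have "\<dots> = (\<Sum>n<N. \<Sum>m<N. u ^ n * cnj (u ^ m) * (if n = m then of_nat N else 0))"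
    unfolding sum_distrib_left[symmetric]
    by (intro sum.cong refl arg_cong2[where f="(*)"] sum_characters) (simp_all only: lessThan_iff)
  also have "\<dots> = (\<Sum>n<N. u ^ n * cnj (u ^ n) * of_nat N)"
    by (simp add: if_distrib[of "\<lambda>x. _ * x"] sum.delta cong: if_cong)
  also have "\<dots> = of_real (\<Sum>n<N. (norm (u ^ n))\<^sup>2 * real N)"
    by (simp only: of_real_sum of_real_mult complex_norm_square of_real_of_nat_eq)
  finally have "(\<Sum>l<N. (norm (\<Sum>n<N. (u * ?e l) ^ n))\<^sup>2) = (\<Sum>n<N. (norm (u ^ n))\<^sup>2 * real N)"
    by (simp only: of_real_eq_iff)
  also have "\<dots> \<le> (\<Sum>n<N. B\<^sup>2 * real N)"
    using u by (intro sum_mono mult_right_mono power_mono) auto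
  finally have "(\<Sum>l<N. (norm (\<Sum>n<N. (u * ?e l) ^ n))\<^sup>2) / (real N)\<^sup>2 \<le> B\<^sup>2"
    using N by (simp add: field_simps power2_eq_square)
  moreover have "(norm (kern N x))\<^sup>2 = (norm (\<Sum>n<N. x ^ n))\<^sup>2 / (real N)\<^sup>2" for x
    by (simp add: kern_def norm_divide power_divide)
  ultimately show ?thesis by (simp only: sum_divide_distrib)
qed

context dyadic_circles
begin

text \<open>The factor \<open>a\<^sup>2\<close> offsets the bound \<open>1 / a\<close> for the
  powers of \<open>z / of_real (rad k)\<close> up to \<open>2 ^ k\<close> on the closed unit disk;
  with it each weight is at most 1, and so is their sum over a level.\<close>

definition weight :: "nat \<Rightarrow> nat \<Rightarrow> complex \<Rightarrow> real" where
  "weight k l z = a\<^sup>2 * (norm (kern (2 ^ k) (z / pt k l)))\<^sup>2"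

lemma weight_nonneg [simp]: "0 \<le> weight k l z"
  by (simp add: weight_def)

lemma norm_div_rad_power_le:
  fixes z :: complex
  assumes "norm z \<le> 1" "n \<le> 2 ^ k"
  shows "norm ((z / of_real (rad k)) ^ n) \<le> 1 / a"
proof -
  have "norm ((z / of_real (rad k)) ^ n) \<le> (1 / rad k) ^ n"
    using assms(1) unfolding norm_power norm_divide by (intro power_mono) (auto simp: divide_right_mono)
  also have "\<dots> \<le> (1 / rad k) ^ 2 ^ k"
    using assms(2) by (intro power_increasing) (auto intro: less_imp_le)
  finally show ?thesis by (simp add: power_one_over rad_power)
qed

lemma div_pt: "z / pt k l = z / of_real (rad k) * cnj (cis (2 * pi * l / 2 ^ k))"
  by (simp add: pt_def divide_inverse cis_inverse cis_cnj)

lemma weight_le_1: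
  assumes "norm z \<le> 1"
  shows "weight k l z \<le> 1"
proof -
  have "norm (\<Sum>n<2 ^ k. (z / pt k l) ^ n) \<le> (\<Sum>n<(2::nat) ^ k. 1 / a)"
    using norm_div_rad_power_le[OF assms, of _ k]
    by (intro sum_norm_le) (simp add: norm_power norm_divide)
  then have "norm (kern (2 ^ k) (z / pt k l)) \<le> 1 / a"
    using a_pos by (simp add: kern_def norm_divide norm_power[of 2 k] field_simps)
  then have "(norm (kern (2 ^ k) (z / pt k l)))\<^sup>2 \<le> (1 / a)\<^sup>2"
    by (rule power_mono) simp
  then show ?thesis using a_pos by (simp add: weight_def field_simps)
qed

lemma sum_weight_le_1:
  assumes "norm z \<le> 1"
  shows "(\<Sum>l<2 ^ k. weight k l z) \<le> 1"
proof -
  \<comment> \<open>Dividing by \<open>pt k l\<close> rotates by a conjugate character; conjugation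
    under the modulus puts the kernel into the form required by
    \<open>kern_parseval\<close>.\<close>
  have "norm (kern (2 ^ k) (z / pt k l)) =
      norm (kern (2 ^ k) (cnj z / of_real (rad k) * cis (2 * pi * real l / real (2 ^ k))))" for l
  proof -
    have "kern (2 ^ k) (cnj u) = cnj (kern (2 ^ k) u)" for u by (simp add: kern_def)
    from this[of "z / pt k l"] show ?thesis unfolding div_pt by (metis (no_types, lifting)
      complex_cnj_cnj complex_cnj_complex_of_real complex_cnj_divide complex_cnj_mult complex_mod_cnj of_nat_numeral of_nat_power)
  qed
  then have "(\<Sum>l<2 ^ k. (norm (kern (2 ^ k) (z / pt k l)))\<^sup>2) \<le> (1 / a)\<^sup>2"
  proof (simp only:, intro kern_parseval)
    show "norm ((cnj z / of_real (rad k)) ^ n) \<le> 1 / a" if "n < 2 ^ k" for n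
      using that assms by (intro norm_div_rad_power_le) auto
  qed simp
  then show ?thesis using a_pos by (simp add: weight_def sum_distrib_left[symmetric] field_simps)
qed

lemma continuous_on_weight: "continuous_on A (weight k l)"
  unfolding weight_def kern_def by (intro continuous_intros) auto

lemma weight_circle_integrable: "(\<lambda>t. weight k l (z * cis (2 * pi * t))) integrable_on {0..1}"
  by (intro integrable_continuous_interval continuous_on_circle continuous_on_weight)

text \<open>By rotation invariance all \<open>2 ^ k\<close> weights of a level have the same mean.\<close>

lemma integral_weight_le:
  assumes "norm z \<le> 1"
  shows "integral {0..1} (\<lambda>t. weight k l (z * cis (2 * pi * t))) \<le> 1 / 2 ^ k"
proof -
  have cont: "continuous_on A (kern (2 ^ k))" for A
    unfolding kern_def by (intro continuous_intros) auto
  have eq: "integral {0..1} (\<lambda>t. weight k l (z * cis (2 * pi * t))) = a\<^sup>2 * circle_mean 2 (kern (2 ^ k)) (z / pt k l)" for l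
    by (simp add: weight_def circle_mean_def)
  have same: "integral {0..1} (\<lambda>t. weight k l (z * cis (2 * pi * t))) =
      integral {0..1} (\<lambda>t. weight k l' (z * cis (2 * pi * t)))" for l'
    unfolding eq by (intro arg_cong[where f="\<lambda>x. a\<^sup>2 * x"] circle_mean_norm_cong cont) (auto simp: norm_divide)
  have "2 ^ k * integral {0..1} (\<lambda>t. weight k l (z * cis (2 * pi * t))) =
      (\<Sum>l'<(2::nat) ^ k. integral {0..1} (\<lambda>t. weight k l (z * cis (2 * pi * t))))"
    by simp
  also have "\<dots> = (\<Sum>l'<2 ^ k. integral {0..1} (\<lambda>t. weight k l' (z * cis (2 * pi * t))))"
    by (intro sum.cong refl same)
  also have "\<dots> = integral {0..1} (\<lambda>t. \<Sum>l'<2 ^ k. weight k l' (z * cis (2 * pi * t)))"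
    by (intro integral_sum[symmetric] weight_circle_integrable) auto
  also have "\<dots> \<le> integral {0..1} (\<lambda>t::real. 1::real)"
  proof (rule integral_le)
    show "(\<lambda>t. \<Sum>l'<2 ^ k. weight k l' (z * cis (2 * pi * t))) integrable_on {0..1}"
      by (intro integrable_sum weight_circle_integrable) auto
    show "(\<Sum>l'<2 ^ k. weight k l' (z * cis (2 * pi * t))) \<le> 1" for t
      using assms by (intro sum_weight_le_1) auto
  qed auto
  finally show ?thesis by (simp add: field_simps)
qed

section \<open>Interpolation on finitely many levels\<close>


text \<open>Three factors for three tasks: the product kills the other levels below
  \<open>K\<close>; the kernel kills the other points of level \<open>k\<close> and localises near
  \<open>pt k l\<close>; the monomial, equal to 1 at the points of level \<open>k\<close>, makes the
  function tiny on inner circles. The exponent is even because \<open>weight\<close> contains the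
  squared modulus of the kernel.\<close>

definition interp :: "nat \<Rightarrow> nat \<Rightarrow> nat \<Rightarrow> nat \<Rightarrow> complex \<Rightarrow> complex" where
  "interp m K k l z = level_prod ({..<K} - {k}) z / level_prod ({..<K} - {k}) (pt k l) *
     (z / pt k l) ^ 2 ^ k * kern (2 ^ k) (z / pt k l) ^ (2 * m)"

lemma interp_holomorphic: "interp m K k l holomorphic_on ball 0 1"
  unfolding interp_def kern_def divide_inverse[of "level_prod _ _"]
  by (intro holomorphic_intros level_prod_holomorphic) auto

lemma level_split: "k < K \<Longrightarrow> {..<K} - {k} = {..<k} \<union> {Suc k..<K}"
  by auto

lemma level_prod_split: "k < K \<Longrightarrow> level_prod ({..<K} - {k}) z = level_prod {..<k} z * level_prod {Suc k..<K} z"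
  by (subst level_split) (auto intro!: level_prod_Un)

lemma level_prod_pt_nonzero:
  assumes "k < K" shows "level_prod ({..<K} - {k}) (pt k l) \<noteq> 0"
proof -
  obtain c where c: "0 < c" "\<And>z k j. norm z = rad (k + j) \<Longrightarrow> c * (1 / a) ^ j \<le> norm (level_prod {k..<k + j} z)"
    using level_prod_lower by blast
  obtain c' where c': "0 < c'" "\<And>q l I. finite I \<Longrightarrow> I \<subseteq> {q<..} \<Longrightarrow> c' \<le> norm (level_prod I (pt q l))"
    using level_prod_pt_lower by blast
  have "0 < c * (1 / a) ^ k" using c(1) a_pos by simp
  also have "\<dots> \<le> norm (level_prod {..<k} (pt k l))"
    using c(2)[of "pt k l" 0 k] by (simp add: atLeast0LessThan)
  finally have "level_prod {..<k} (pt k l) \<noteq> 0" by auto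
  moreover have "level_prod {Suc k..<K} (pt k l) \<noteq> 0"
  proof -
    have "{Suc k..<K} \<subseteq> {k<..}" by auto
    then show ?thesis using c'(1) c'(2)[of "{Suc k..<K}" k l] by auto
  qed
  ultimately show ?thesis using assms by (simp add: level_prod_split)
qed

lemma pt_div_pt_power: "(pt k l / pt k l') ^ 2 ^ k = 1"
  using a_pos by (simp add: power_divide pt_power)

lemma pt_inj: "l < 2 ^ k \<Longrightarrow> l' < 2 ^ k \<Longrightarrow> pt k l = pt k l' \<Longrightarrow> l = l'"
  using cis_nat_inj[of l "2 ^ k" l'] by (simp add: pt_def)

lemma interp_self: "k < K \<Longrightarrow> interp m K k l (pt k l) = 1"
  by (simp add: interp_def level_prod_pt_nonzero)

lemma interp_other_level: "i < K \<Longrightarrow> i \<noteq> k \<Longrightarrow> interp m K k l (pt i l') = 0"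
  by (simp add: interp_def level_prod_pt_eq_0)

lemma interp_same_level:
  assumes "l < 2 ^ k" "l' < 2 ^ k" "l \<noteq> l'" "1 \<le> m"
  shows "interp m K k l (pt k l') = 0"
proof -
  have "pt k l' / pt k l \<noteq> 1" using pt_inj[OF assms(1,2)] assms(3) by auto
  then have "kern (2 ^ k) (pt k l' / pt k l) = 0"
    by (intro kern_root_of_unity pt_div_pt_power)
  then show ?thesis using assms(4) by (simp add: interp_def)
qed

text \<open>Up to a constant, a bound on circle \<open>q\<close> for an interpolating function of
  level \<open>k\<close>: a factor \<open>1 / a\<close> per level outwards, and the doubly
  exponential smallness of the monomial inwards.\<close>

definition growth :: "nat \<Rightarrow> nat \<Rightarrow> real" where
  "growth q k = (if k \<le> q then (1 / a) ^ (q - k) else a ^ 2 ^ (k - q))"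

lemma growth_pos [simp]: "0 < growth q k"
  using a_pos by (simp add: growth_def)

text \<open>Levels below \<open>q\<close> cost at most \<open>1 / a\<close> each, those from
  \<open>q\<close> on only a constant together.\<close>

lemma norm_level_prod_le_split:
  assumes z: "norm z \<le> rad q" and "k \<le> q" "finite I" "I \<subseteq> {k..}"
  shows "norm (level_prod I z) \<le> (1 / a) ^ (q - k) * tail_const"
proof -
  have z1: "norm z < 1" using z rad_lt_1[of q] by linarith
  have "(I \<inter> {..<q}) \<union> (I \<inter> {q..}) = I" by auto
  moreover have "(I \<inter> {..<q}) \<inter> (I \<inter> {q..}) = {}" by auto
  ultimately have "level_prod I z = level_prod (I \<inter> {..<q}) z * level_prod (I \<inter> {q..}) z"
    using level_prod_Un[of "I \<inter> {..<q}" "I \<inter> {q..}" z] assms by simp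
  then have "norm (level_prod I z) = norm (level_prod (I \<inter> {..<q}) z) * norm (level_prod (I \<inter> {q..}) z)"
    by (simp add: norm_mult)
  also have "\<dots> \<le> (1 / a) ^ (q - k) * tail_const"
  proof (intro mult_mono)
    have "card (I \<inter> {..<q}) \<le> card {k..<q}" using assms by (intro card_mono) auto
    then have "(1 / a) ^ card (I \<inter> {..<q}) \<le> (1 / a) ^ (q - k)"
      using a_pos a_lt_1 by (intro power_increasing) auto
    then show "norm (level_prod (I \<inter> {..<q}) z) \<le> (1 / a) ^ (q - k)"
      using norm_level_prod_le[OF z1] order_trans by blast
    show "norm (level_prod (I \<inter> {q..}) z) \<le> tail_const"
      using assms by (intro norm_level_prod_tail_le) auto
  qed (use a_pos in auto)
  finally show ?thesis .
qed

text \<open>The levels below \<open>k\<close> may contribute \<open>(1 / a) ^ k\<close> at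
  \<open>z\<close>, but the denominator at \<open>pt k l\<close> is equally large up to a constant;
  only the levels between \<open>k\<close> and the circle of \<open>z\<close> produce growth. The
  constant does not depend on \<open>K\<close>, as the later limit in \<open>K\<close>
  requires.\<close>

lemma norm_interp_le:
  obtains C where "0 < C" "\<And>K k l q z. k < K \<Longrightarrow> norm z \<le> rad q \<Longrightarrow>
    norm (interp m K k l z) \<le> C * growth q k * weight k l z ^ m"
proof -
  obtain c where c: "0 < c" "\<And>z k j. norm z = rad (k + j) \<Longrightarrow> c * (1 / a) ^ j \<le> norm (level_prod {k..<k + j} z)"
    using level_prod_lower by blast
  obtain c' where c': "0 < c'" "\<And>q l I. finite I \<Longrightarrow> I \<subseteq> {q<..} \<Longrightarrow> c' \<le> norm (level_prod I (pt q l))"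
    using level_prod_pt_lower by blast
  define C where "C = 1 / c * (tail_const / c') * (1 / a) * (1 / a\<^sup>2) ^ m"
  have T: "0 < tail_const" using tail_const_ge_1 by linarith
  show ?thesis
  proof (rule that[of C])
    show "0 < C" using c(1) c'(1) T a_pos by (simp add: C_def)
    fix K k l q :: nat and z :: complex assume k: "k < K" and z: "norm z \<le> rad q"
    have z1: "norm z < 1" using z rad_lt_1[of q] by linarith
    \<comment> \<open>Up to constants, \<open>g\<close> bounds the product over the higher levels
      and \<open>h\<close> the monomial; for each \<open>q\<close> at least one of them is
      1.\<close>
    define g where "g = (if k \<le> q then (1 / a) ^ (q - k) else 1)"
    define h where "h = (if k \<le> q then 1 else a ^ 2 ^ (k - q))"
    have g: "0 \<le> g" "0 \<le> h" "g * h = growth q k" using a_pos by (auto simp: g_def h_def growth_def)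
    have 1: "norm (level_prod {..<k} z / level_prod {..<k} (pt k l)) \<le> 1 / c"
    proof -
      have "norm (level_prod {..<k} z / level_prod {..<k} (pt k l)) \<le> (1 / a) ^ k / (c * (1 / a) ^ k)"
        unfolding norm_divide using norm_level_prod_le[OF z1, of "{..<k}"] c(1) c(2)[of "pt k l" 0 k] a_pos
        by (intro frac_le) (auto simp: atLeast0LessThan)
      then show ?thesis using a_pos by simp
    qed
    have 2: "norm (level_prod {Suc k..<K} z / level_prod {Suc k..<K} (pt k l)) \<le> g * (tail_const / c')"
    proof -
      have "norm (level_prod {Suc k..<K} z) \<le> g * tail_const"
      proof (cases "k \<le> q")
        case True
        then show ?thesis unfolding g_def
          using norm_level_prod_le_split[OF z True, of "{Suc k..<K}"] by (simp add: subset_iff)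
      next
        case False
        then show ?thesis unfolding g_def
          using norm_level_prod_tail_le[OF z, of "{Suc k..<K}"] by (simp add: subset_iff)
      qed
      then have "norm (level_prod {Suc k..<K} z / level_prod {Suc k..<K} (pt k l)) \<le> g * tail_const / c'"
        unfolding norm_divide using c'(1) c'(2)[of "{Suc k..<K}" k l] T g
        by (intro frac_le) (auto simp: subset_iff)
      then show ?thesis by simp
    qed
    have 3: "norm ((z / pt k l) ^ 2 ^ k) \<le> h * (1 / a)"
    proof -
      have "norm ((z / pt k l) ^ 2 ^ k) = norm z ^ 2 ^ k / a"
        by (simp add: norm_power norm_divide power_divide rad_power)
      also have "norm z ^ 2 ^ k \<le> h"
      proof (cases "k \<le> q")
        case True
        then show ?thesis unfolding h_def using z1 by (simp add: power_le_one)
      next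
        case False
        have "norm z ^ 2 ^ k \<le> rad q ^ 2 ^ k" using z by (intro power_mono) auto
        then show ?thesis using False by (simp add: h_def rad_power')
      qed
      finally show ?thesis using a_pos by (simp add: divide_right_mono)
    qed
    have 4: "norm (kern (2 ^ k) (z / pt k l) ^ (2 * m)) = (1 / a\<^sup>2) ^ m * weight k l z ^ m"
    proof -
      have "(norm (kern (2 ^ k) (z / pt k l)))\<^sup>2 = (1 / a\<^sup>2) * weight k l z"
        using a_pos by (simp add: weight_def)
      then show ?thesis by (simp only: norm_power power_mult power_mult_distrib)
    qed
    have "norm (interp m K k l z) = norm (level_prod {..<k} z / level_prod {..<k} (pt k l)) *
        norm (level_prod {Suc k..<K} z / level_prod {Suc k..<K} (pt k l)) * norm ((z / pt k l) ^ 2 ^ k) *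
        norm (kern (2 ^ k) (z / pt k l) ^ (2 * m))"
      by (simp add: interp_def level_prod_split[OF k] norm_mult norm_divide)
    also have "\<dots> \<le> 1 / c * (g * (tail_const / c')) * (h * (1 / a)) * ((1 / a\<^sup>2) ^ m * weight k l z ^ m)"
      unfolding 4 using 1 2 3 c(1) c'(1) T g a_pos by (intro mult_mono) auto
    also have "\<dots> = C * (g * h) * weight k l z ^ m" by (simp add: C_def)
    finally show "norm (interp m K k l z) \<le> C * growth q k * weight k l z ^ m" by (simp only: g)
  qed
qed

definition level_interp :: "nat \<Rightarrow> nat \<Rightarrow> nat \<Rightarrow> (nat \<Rightarrow> complex) \<Rightarrow> complex \<Rightarrow> complex" where
  "level_interp m K k c z = (\<Sum>l<2 ^ k. c l * interp m K k l z)"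

lemma level_interp_holomorphic: "level_interp m K k c holomorphic_on ball 0 1"
  unfolding level_interp_def by (intro holomorphic_intros interp_holomorphic)

lemma level_interp_pt:
  assumes "k < K" "i < K" "l < 2 ^ i" "1 \<le> m"
  shows "level_interp m K k c (pt i l) = (if i = k then c l else 0)"
proof (cases "i = k")
  case True
  have "level_interp m K k c (pt i l) = (\<Sum>l'<2 ^ k. if l' = l then c l else 0)"
    unfolding level_interp_def True
    using assms True by (intro sum.cong refl) (auto simp: interp_self interp_same_level)
  then show ?thesis using True assms by simp
next
  case False
  then show ?thesis using assms by (simp add: level_interp_def interp_other_level)
qed

text \<open>\<open>powr_sum_le\<close> with \<open>V = 1\<close> distributes the power over the
  points, the exponent \<open>m\<close> being large enough to cover \<open>p < 1\<close>; what
  remains is linear in the weights, whose means are at most \<open>1 / 2 ^ k\<close>.\<close>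

lemma circle_mean_level_interp_le:
  assumes p: "0 < p" and m: "1 \<le> m" "1 \<le> real m * p"
  obtains C where "0 < C" "\<And>K k c q z. k < K \<Longrightarrow> norm z \<le> rad q \<Longrightarrow>
    circle_mean p (level_interp m K k c) z \<le> C * growth q k powr p * (\<Sum>l<2 ^ k. norm (c l) powr p) / 2 ^ k"
proof -
  obtain C where C: "0 < C" "\<And>K k l q z. k < K \<Longrightarrow> norm z \<le> rad q \<Longrightarrow>
    norm (interp m K k l z) \<le> C * growth q k * weight k l z ^ m"
    using norm_interp_le by blast
  show ?thesis
  proof (rule that[of "C powr p"])
    show "0 < C powr p" using C by simp
    fix K k q :: nat and c :: "nat \<Rightarrow> complex" and z :: complex assume k: "k < K" and z: "norm z \<le> rad q"
    let ?G = "C * growth q k"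
    have G: "0 < ?G" using C by simp
    have z1: "norm z < 1" using z rad_lt_1[of q] by linarith
    have pw: "norm (level_interp m K k c u) powr p \<le> ?G powr p * (\<Sum>l<2 ^ k. norm (c l) powr p * weight k l u)"
      if u: "norm u = norm z" for u
    proof -
      have "norm (level_interp m K k c u) \<le> (\<Sum>l<2 ^ k. norm (c l * interp m K k l u))"
        unfolding level_interp_def by (rule norm_sum)
      also have "\<dots> \<le> (\<Sum>l<2 ^ k. norm (c l) * (?G * weight k l u ^ m))"
        unfolding norm_mult using u z by (intro sum_mono mult_left_mono C(2) k) auto
      also have "\<dots> = ?G * (\<Sum>l<2 ^ k. norm (c l) * weight k l u ^ m)"
        by (simp add: sum_distrib_left mult_ac)
      finally have "norm (level_interp m K k c u) powr p \<le> (?G * (\<Sum>l<2 ^ k. norm (c l) * weight k l u ^ m)) powr p"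
        using p by (intro powr_mono2) auto
      also have "\<dots> = ?G powr p * (\<Sum>l<2 ^ k. norm (c l) * weight k l u ^ m) powr p"
        by (rule powr_mult)
      also have "(\<Sum>l<2 ^ k. norm (c l) * weight k l u ^ m) powr p \<le> 1 powr p * (\<Sum>l<2 ^ k. norm (c l) powr p * weight k l u)"
        using u z1 by (intro powr_sum_le p m weight_le_1 sum_weight_le_1) auto
      finally show ?thesis using G by (simp add: mult_left_mono)
    qed
    have "circle_mean p (level_interp m K k c) z \<le>
        integral {0..1} (\<lambda>t. ?G powr p * (\<Sum>l<2 ^ k. norm (c l) powr p * weight k l (z * cis (2 * pi * t))))"
      unfolding circle_mean_def
    proof (rule integral_le)
      show "(\<lambda>t. norm (level_interp m K k c (z * cis (2 * pi * t))) powr p) integrable_on {0..1}"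
        by (intro integrable_circle_mean p holomorphic_continuous_on_sphere[OF level_interp_holomorphic z1])
      show "(\<lambda>t. ?G powr p * (\<Sum>l<2 ^ k. norm (c l) powr p * weight k l (z * cis (2 * pi * t)))) integrable_on {0..1}"
        by (intro integrable_on_mult_right integrable_sum weight_circle_integrable) auto
    qed (use pw in auto)
    also have "\<dots> = ?G powr p * (\<Sum>l<2 ^ k. norm (c l) powr p * integral {0..1} (\<lambda>t. weight k l (z * cis (2 * pi * t))))"
      by (subst integral_mult_right, subst integral_sum)
         (auto intro!: integrable_on_mult_right weight_circle_integrable)
    also have "\<dots> \<le> ?G powr p * (\<Sum>l<2 ^ k. norm (c l) powr p * (1 / 2 ^ k))"
      using z1 by (intro mult_left_mono sum_mono integral_weight_le) auto
    also have "\<dots> = C powr p * growth q k powr p * (\<Sum>l<2 ^ k. norm (c l) powr p) / 2 ^ k"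
      unfolding sum_distrib_right[symmetric] by (simp add: powr_mult)
    finally show "circle_mean p (level_interp m K k c) z \<le>
      C powr p * growth q k powr p * (\<Sum>l<2 ^ k. norm (c l) powr p) / 2 ^ k" .
  qed
qed

end

section \<open>The Bergman norm and circle means\<close>

lemma nn_integral_disk_area:
  assumes "f \<in> borel_measurable (restrict_space borel (ball 0 1))"
  shows "(\<integral>\<^sup>+z. f z \<partial>disk_area) = (\<integral>\<^sup>+z. f z * indicator (ball 0 1) z \<partial>lborel) / ennreal pi"
proof -
  have m: "(\<lambda>z. f z * indicator (ball 0 1) z) \<in> borel_measurable lborel"
    using assms by (subst (asm) borel_measurable_restrict_space_iff_ennreal) auto
  have "(\<integral>\<^sup>+z. f z \<partial>disk_area) = (\<integral>\<^sup>+z. f z * indicator (ball 0 1) z \<partial>uniform_measure lborel (ball 0 1))"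
    unfolding disk_area_def by (rule nn_integral_restrict_space) simp
  also have "\<dots> = (\<integral>\<^sup>+z. f z * indicator (ball 0 1) z * indicator (ball 0 1) z \<partial>lborel) / emeasure lborel (ball (0::complex) 1)"
    by (rule nn_integral_uniform_measure[OF m]) simp
  also have "emeasure lborel (ball (0::complex) 1) = ennreal pi"
    by (simp add: emeasure_ball eval_unit_ball_vol)
  also have "(\<lambda>z. f z * indicator (ball 0 1) z * indicator (ball 0 1) z) = (\<lambda>z. f z * indicator (ball 0 1) z)"
    by (auto simp: indicator_def)
  finally show ?thesis .
qed

lemma sets_disk_area: "sets disk_area = sets (restrict_space borel (ball 0 1))"
  unfolding disk_area_def by (rule sets_restrict_space_cong) simp

lemma holomorphic_measurable_disk:
  "f holomorphic_on ball 0 1 \<Longrightarrow> f \<in> borel_measurable (restrict_space borel (ball 0 1))"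
  by (intro borel_measurable_continuous_on_restrict holomorphic_on_imp_continuous_on)

lemma Lp_fun_disk_area_iff:
  assumes f: "f holomorphic_on ball 0 1" and p: "0 < p"
  shows "f \<in> Lp_fun p disk_area \<longleftrightarrow>
    (\<integral>\<^sup>+z. ennreal (circle_mean p f z) * indicator (ball 0 1) z \<partial>lborel) < \<infinity>"
proof -
  note m = holomorphic_measurable_disk[OF f]
  have m1: "f \<in> borel_measurable disk_area"
    using m by (simp cong: measurable_cong_sets add: sets_disk_area)
  have m2: "(\<lambda>z. ennreal (norm (f z) powr p)) \<in> borel_measurable (restrict_space borel (ball 0 1))"
    using m by measurable
  have "f \<in> Lp_fun p disk_area \<longleftrightarrow> (\<integral>\<^sup>+z. ennreal (norm (f z) powr p) \<partial>disk_area) < \<infinity>"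
    unfolding Lp_fun_def using m1 by (simp add: integrable_iff_bounded)
  also have "\<dots> \<longleftrightarrow> (\<integral>\<^sup>+z. ennreal (norm (f z) powr p) * indicator (ball 0 1) z \<partial>lborel) < \<infinity>"
    unfolding nn_integral_disk_area[OF m2]
    by (auto simp: less_top[symmetric] ennreal_divide_eq_top_iff)
  finally show ?thesis by (simp only: nn_integral_disk_circle_mean[OF f p])
qed

lemma circle_mean_tendsto:
  assumes F: "\<And>n. continuous_on (sphere 0 (norm z)) (F n)" and p: "0 < p"
    and lim: "\<And>u. norm u = norm z \<Longrightarrow> (\<lambda>n. F n u) \<longlonglongrightarrow> f u"
    and B: "\<And>n u. norm u = norm z \<Longrightarrow> norm (F n u) \<le> B"
  shows "(\<lambda>n. circle_mean p (F n) z) \<longlonglongrightarrow> circle_mean p f z"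
  unfolding circle_mean_def
proof (rule dominated_convergence(2))
  show "(\<lambda>t. norm (F n (z * cis (2 * pi * t))) powr p) integrable_on {0..1}" for n
    by (intro integrable_circle_mean F p)
  show "(\<lambda>t::real. B powr p) integrable_on {0..1}"
    by (intro integrable_continuous_interval continuous_intros)
  show "norm (norm (F n (z * cis (2 * pi * t))) powr p) \<le> B powr p" for n t
    using p B by (simp add: powr_mono2)
  show "(\<lambda>n. norm (F n (z * cis (2 * pi * t))) powr p) \<longlonglongrightarrow> norm (f (z * cis (2 * pi * t))) powr p" for t
    using p by (intro tendsto_powr' tendsto_norm lim tendsto_const) auto
qed

lemma circle_mean_add_le:
  assumes "continuous_on (sphere 0 (norm z)) f" "continuous_on (sphere 0 (norm z)) g" "0 < p"
  shows "circle_mean p (\<lambda>u. f u + g u) z \<le> 2 powr p * (circle_mean p f z + circle_mean p g z)"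
proof -
  note [simp] = integrable_circle_mean[OF assms(1,3)] integrable_circle_mean[OF assms(2,3)]
  have "circle_mean p (\<lambda>u. f u + g u) z \<le> integral {0..1} (\<lambda>t. 2 powr p *
      (norm (f (z * cis (2 * pi * t))) powr p + norm (g (z * cis (2 * pi * t))) powr p))"
    unfolding circle_mean_def
  proof (rule integral_le)
    show "(\<lambda>t. norm (f (z * cis (2 * pi * t)) + g (z * cis (2 * pi * t))) powr p) integrable_on {0..1}"
      using integrable_circle_mean[of z "\<lambda>u. f u + g u" p] assms by (simp add: continuous_on_add)
    show "(\<lambda>t. 2 powr p * (norm (f (z * cis (2 * pi * t))) powr p + norm (g (z * cis (2 * pi * t))) powr p)) integrable_on {0..1}"
      by (intro integrable_on_mult_right integrable_add) simp_all
    fix t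
    have "norm (f (z * cis (2 * pi * t)) + g (z * cis (2 * pi * t))) powr p \<le>
        (norm (f (z * cis (2 * pi * t))) + norm (g (z * cis (2 * pi * t)))) powr p"
      using assms by (intro powr_mono2 norm_triangle_ineq) auto
    also have "\<dots> \<le> 2 powr p * (norm (f (z * cis (2 * pi * t))) powr p + norm (g (z * cis (2 * pi * t))) powr p)"
      using assms by (intro powr_add_le) auto
    finally show "norm (f (z * cis (2 * pi * t)) + g (z * cis (2 * pi * t))) powr p \<le> \<dots>" .
  qed
  also have "\<dots> = 2 powr p * (circle_mean p f z + circle_mean p g z)"
    by (simp add: circle_mean_def integral_add)
  finally show ?thesis .
qed

lemma circle_mean_minus: "circle_mean p (\<lambda>u. - f u) z = circle_mean p f z"
  by (simp add: circle_mean_def)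

lemma ex_exponent: "0 < p \<Longrightarrow> \<exists>m::nat. 1 \<le> m \<and> 1 \<le> real m * p"
proof -
  assume p: "0 < p"
  obtain n :: nat where "1 / p < real n" using reals_Archimedean2 by blast
  then have "1 \<le> real (Suc n) * p" using p by (simp add: field_simps)
  then show ?thesis by (intro exI[of _ "Suc n"]) auto
qed

context dyadic_circles
begin

definition mean :: "real \<Rightarrow> (complex \<Rightarrow> complex) \<Rightarrow> nat \<Rightarrow> real" where
  "mean p f q = circle_mean p f (of_real (rad q))"

lemma mean_nonneg [simp]: "0 \<le> mean p f q"
  by (simp add: mean_def circle_mean_nonneg)

lemma mean_mono: "f holomorphic_on ball 0 1 \<Longrightarrow> 0 < p \<Longrightarrow> q \<le> q' \<Longrightarrow> mean p f q \<le> mean p f q'"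
  unfolding mean_def by (intro circle_mean_norm_mono) (auto simp: rad_mono)

definition annulus :: "nat \<Rightarrow> complex set" where
  "annulus q = ball 0 (rad (Suc q)) - ball 0 (rad q)"

text \<open>Since \<open>rad (Suc q) ^ 2 = rad q\<close>, the area is exactly pi times
  \<open>rad q - rad q ^ 2\<close>, which is of order \<open>1 / 2 ^ q\<close>.\<close>

lemma emeasure_annulus: "emeasure lborel (annulus q) = ennreal (pi * (rad q * (1 - rad q)))"
proof -
  have e: "emeasure lborel (ball (0::complex) (rad q)) = ennreal (pi * (rad q)\<^sup>2)" for q
    by (simp add: emeasure_ball eval_unit_ball_vol)
  have "emeasure lborel (annulus q) = ennreal (pi * (rad (Suc q))\<^sup>2) - ennreal (pi * (rad q)\<^sup>2)"
    unfolding annulus_def e[symmetric]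
    by (intro emeasure_Diff) (auto simp: e intro: less_trans[OF _ rad_less_Suc])
  also have "\<dots> = ennreal (pi * (rad (Suc q))\<^sup>2 - pi * (rad q)\<^sup>2)" by (rule ennreal_minus) simp
  also have "pi * (rad (Suc q))\<^sup>2 - pi * (rad q)\<^sup>2 = pi * (rad q * (1 - rad q))"
    unfolding rad_Suc_square by (simp add: algebra_simps power2_eq_square)
  finally show ?thesis .
qed

lemma annulus_sets [measurable]: "annulus q \<in> sets borel"
  by (simp add: annulus_def)

lemma disjoint_annulus: "disjoint_family annulus"
proof -
  have "annulus q \<inter> annulus q' = {}" if "q < q'" for q q'
    using rad_mono[of "Suc q" q'] that by (auto simp: annulus_def)
  then show ?thesis by (auto simp: disjoint_family_on_def neq_iff)
qed

text \<open>Means increase with the radius, so on each annulus the mean over its inner circle is a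
  lower bound.\<close>

lemma mean_sum_le_nn_integral:
  assumes f: "f holomorphic_on ball 0 1" and p: "0 < p"
  shows "ennreal (\<Sum>q<Q. mean p f q * (pi * (rad q * (1 - rad q)))) \<le>
    (\<integral>\<^sup>+z. ennreal (circle_mean p f z) * indicator (ball 0 1) z \<partial>lborel)"
proof -
  have "ennreal (\<Sum>q<Q. mean p f q * (pi * (rad q * (1 - rad q)))) =
      (\<Sum>q<Q. ennreal (mean p f q) * emeasure lborel (annulus q))"
    by (subst sum_ennreal[symmetric]) (auto simp: emeasure_annulus ennreal_mult less_imp_le)
  also have "\<dots> = (\<integral>\<^sup>+z. (\<Sum>q<Q. ennreal (mean p f q) * indicator (annulus q) z) \<partial>lborel)"
    by (subst nn_integral_sum) (auto simp: nn_integral_cmult_indicator)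
  also have "\<dots> \<le> (\<integral>\<^sup>+z. ennreal (circle_mean p f z) * indicator (ball 0 1) z \<partial>lborel)"
  proof (rule nn_integral_mono)
    fix z :: complex
    have "(\<Sum>q<Q. ennreal (mean p f q) * indicator (annulus q) z) \<le>
        (\<Sum>q<Q. ennreal (circle_mean p f z) * indicator (annulus q) z)"
    proof (intro sum_mono)
      fix q
      show "ennreal (mean p f q) * indicator (annulus q) z \<le> ennreal (circle_mean p f z) * indicator (annulus q) z"
      proof (cases "z \<in> annulus q")
        case True
        then have "rad q \<le> norm z" "norm z < 1" using rad_lt_1[of "Suc q"] by (auto simp: annulus_def simp del: rad_lt_1)
        then have "mean p f q \<le> circle_mean p f z"
          unfolding mean_def by (intro circle_mean_norm_mono f p) auto
        then show ?thesis by (simp add: True ennreal_leI)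
      qed auto
    qed
    also have "\<dots> = ennreal (circle_mean p f z) * indicator (\<Union>q<Q. annulus q) z"
      using disjoint_annulus
      by (subst indicator_UN_disjoint) (auto simp: sum_distrib_left intro: disjoint_family_on_mono)
    also have "\<dots> \<le> ennreal (circle_mean p f z) * indicator (ball 0 1) z"
    proof -
      have "annulus q \<subseteq> ball 0 1" for q using subset_ball[of "rad (Suc q)" 1 0] by (auto simp: annulus_def less_imp_le)
      then have "(\<Union>q<Q. annulus q) \<subseteq> ball 0 1" by blast
      then show ?thesis by (intro mult_left_mono) (auto simp: indicator_def)
    qed
    finally show "(\<Sum>q<Q. ennreal (mean p f q) * indicator (annulus q) z) \<le>
      ennreal (circle_mean p f z) * indicator (ball 0 1) z" .
  qed
  finally show ?thesis .
qed

text \<open>Here the outer circle of each annulus gives the bound. The disk of radius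
  \<open>a\<close>, which no annulus covers, is charged to the term with \<open>mean p f 0\<close>,
  crudely taken over the whole unit disk.\<close>

lemma nn_integral_le_mean_sum:
  assumes f: "f holomorphic_on ball 0 1" and p: "0 < p"
  shows "(\<integral>\<^sup>+z. ennreal (circle_mean p f z) * indicator (ball 0 1) z \<partial>lborel) \<le>
    ennreal (mean p f 0) * ennreal pi + (\<Sum>q. ennreal (mean p f (Suc q) * (pi * (rad q * (1 - rad q)))))"
proof -
  have "(\<integral>\<^sup>+z. ennreal (circle_mean p f z) * indicator (ball 0 1) z \<partial>lborel) \<le>
    (\<integral>\<^sup>+z. ennreal (mean p f 0) * indicator (ball 0 1) z + (\<Sum>q. ennreal (mean p f (Suc q)) * indicator (annulus q) z) \<partial>lborel)"
  proof (rule nn_integral_mono)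
    fix z :: complex
    show "ennreal (circle_mean p f z) * indicator (ball 0 1) z \<le>
      ennreal (mean p f 0) * indicator (ball 0 1) z + (\<Sum>q. ennreal (mean p f (Suc q)) * indicator (annulus q) z)"
    proof (cases "norm z < 1")
      case True
      show ?thesis
      proof (cases "norm z < rad 0")
        case small: True
        then have "circle_mean p f z \<le> mean p f 0"
          unfolding mean_def using a_lt_1 a_pos by (intro circle_mean_norm_mono f p) auto
        then have "ennreal (circle_mean p f z) * indicator (ball 0 1) z \<le> ennreal (mean p f 0) * indicator (ball 0 1) z"
          by (intro mult_right_mono ennreal_leI) auto
        then show ?thesis by (rule order_trans) simp
      next
        case False
        define q' where "q' = (LEAST q. norm z < rad q)"
        have q': "norm z < rad q'" unfolding q'_def using ex_less_rad[OF True] by (rule LeastI_ex)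
        then have "q' \<noteq> 0" using False by (cases q') auto
        then obtain q where q: "q' = Suc q" by (cases q') auto
        then have "\<not> norm z < rad q" using not_less_Least[of q "\<lambda>q. norm z < rad q"] by (simp add: q'_def)
        then have z: "z \<in> annulus q" using q' q by (auto simp: annulus_def)
        have "circle_mean p f z \<le> mean p f (Suc q)"
          unfolding mean_def using q' q by (intro circle_mean_norm_mono f p) auto
        then have "ennreal (circle_mean p f z) * indicator (ball 0 1) z \<le> ennreal (mean p f (Suc q)) * indicator (annulus q) z"
          using z True by (simp add: ennreal_leI)
        also have "\<dots> \<le> (\<Sum>q. ennreal (mean p f (Suc q)) * indicator (annulus q) z)"
        proof -
          have "F q \<le> (\<Sum>q. F q)" for F :: "nat \<Rightarrow> ennreal"
            using sum_le_suminf[of F "{q}"] by simp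
          then show ?thesis .
        qed
        finally show ?thesis by (rule order_trans) simp
      qed
    qed auto
  qed
  also have "(\<lambda>z. ennreal c * indicator (ball 0 1) z) \<in> borel_measurable (lborel :: complex measure)" for c
    by (intro borel_measurable_times_ennreal borel_measurable_const borel_measurable_indicator) simp
  then have "(\<integral>\<^sup>+z. ennreal (mean p f 0) * indicator (ball 0 1) z + (\<Sum>q. ennreal (mean p f (Suc q)) * indicator (annulus q) z) \<partial>lborel)
     = ennreal (mean p f 0) * ennreal pi + (\<Sum>q. ennreal (mean p f (Suc q)) * emeasure lborel (annulus q))"
    by (subst nn_integral_add)
       (auto simp: nn_integral_cmult_indicator nn_integral_suminf emeasure_ball eval_unit_ball_vol)
  finally show ?thesis by (simp add: emeasure_annulus ennreal_mult less_imp_le)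
qed

text \<open>The lower and the upper bound use the same means with indices shifted by one, which
  changes the weights \<open>1 / 2 ^ q\<close> only by a factor 2. From here on integrability over
  the disk is tested in this discrete form.\<close>

lemma bergman_space_iff:
  assumes p: "0 < p"
  shows "f \<in> bergman_space p \<longleftrightarrow> f holomorphic_on ball 0 1 \<and> summable (\<lambda>q. mean p f q / 2 ^ q)"
proof -
  have "f \<in> Lp_fun p disk_area \<longleftrightarrow> summable (\<lambda>q. mean p f q / 2 ^ q)" if f: "f holomorphic_on ball 0 1"
  proof
    assume "f \<in> Lp_fun p disk_area"
    define A where "A = (\<integral>\<^sup>+z. ennreal (circle_mean p f z) * indicator (ball 0 1) z \<partial>lborel)"
    have A: "A < \<infinity>" using \<open>f \<in> Lp_fun p disk_area\<close> by (simp only: Lp_fun_disk_area_iff[OF f p] A_def)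
    define \<kappa> where "\<kappa> = pi * (a * (1 - a))"
    have \<kappa>: "0 < \<kappa>" using a_pos a_lt_1 by (simp add: \<kappa>_def)
    have "(\<Sum>q<Q. mean p f q / 2 ^ q) \<le> enn2real A / \<kappa>" for Q
    proof -
      have "\<kappa> * (\<Sum>q<Q. mean p f q / 2 ^ q) = (\<Sum>q<Q. mean p f q * (pi * (a * ((1 - a) / 2 ^ q))))"
        by (simp add: \<kappa>_def sum_distrib_left field_simps)
      also have "\<dots> \<le> (\<Sum>q<Q. mean p f q * (pi * (rad q * (1 - rad q))))"
        using a_pos a_lt_1 by (intro sum_mono mult_left_mono mult_mono a_le_rad one_minus_rad_ge) auto
      finally have "ennreal (\<kappa> * (\<Sum>q<Q. mean p f q / 2 ^ q)) \<le> A"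
        unfolding A_def by (intro order_trans[OF ennreal_leI mean_sum_le_nn_integral[OF f p]])
      then have "\<kappa> * (\<Sum>q<Q. mean p f q / 2 ^ q) \<le> enn2real A"
        using enn2real_mono[of "ennreal (\<kappa> * (\<Sum>q<Q. mean p f q / 2 ^ q))" A] A \<kappa>
        by (simp add: sum_nonneg)
      then show ?thesis using \<kappa> by (simp add: field_simps)
    qed
    then show "summable (\<lambda>q. mean p f q / 2 ^ q)"
      by (intro summableI_nonneg_bounded) auto
  next
    assume s: "summable (\<lambda>q. mean p f q / 2 ^ q)"
    have "summable (\<lambda>q. mean p f (Suc q) * (pi * (rad q * (1 - rad q))))"
    proof (rule summable_comparison_test'[of "\<lambda>q. 2 * pi * (1 - a) / a * (mean p f (Suc q) / 2 ^ Suc q)" 0])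
      show "summable (\<lambda>q. 2 * pi * (1 - a) / a * (mean p f (Suc q) / 2 ^ Suc q))"
        using s by (intro summable_mult) (subst summable_Suc_iff)
      fix q
      have "mean p f (Suc q) * (pi * (rad q * (1 - rad q))) \<le> mean p f (Suc q) * (pi * (1 * ((1 - a) / (a * 2 ^ q))))"
        by (intro mult_left_mono mult_mono one_minus_rad_le) (auto intro: less_imp_le)
      also have "\<dots> = 2 * pi * (1 - a) / a * (mean p f (Suc q) / 2 ^ Suc q)"
        using a_pos by (simp add: field_simps)
      finally show "norm (mean p f (Suc q) * (pi * (rad q * (1 - rad q)))) \<le> \<dots>"
        by (simp add: abs_mult less_imp_le)
    qed
    then have "(\<Sum>q. ennreal (mean p f (Suc q) * (pi * (rad q * (1 - rad q))))) < \<infinity>"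
      by (subst suminf_ennreal2) (auto simp: less_imp_le)
    then have "ennreal (mean p f 0) * ennreal pi + (\<Sum>q. ennreal (mean p f (Suc q) * (pi * (rad q * (1 - rad q))))) < \<infinity>"
      by (simp add: ennreal_mult_less_top)
    then show "f \<in> Lp_fun p disk_area"
      unfolding Lp_fun_disk_area_iff[OF f p] by (rule le_less_trans[OF nn_integral_le_mean_sum[OF f p]])
  qed
  then show ?thesis by (auto simp: bergman_space_def)
qed

end

section \<open>Point evaluations, normal families and division\<close>

lemma circle_mean_le_scale:
  assumes "continuous_on (sphere 0 (norm z)) f" "continuous_on (sphere 0 (norm z)) g" "0 < p" "0 \<le> B"
    and "\<And>u. norm u = norm z \<Longrightarrow> norm (f u) \<le> B * norm (g u)"
  shows "circle_mean p f z \<le> B powr p * circle_mean p g z"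
proof -
  have "circle_mean p f z \<le> circle_mean p (\<lambda>u. of_real B * g u) z"
    using assms by (intro circle_mean_mono continuous_on_mult continuous_on_const) (auto simp: norm_mult)
  also have "\<dots> = B powr p * circle_mean p g z"
    unfolding circle_mean_def using assms by (simp add: norm_mult powr_mult)
  finally show ?thesis .
qed

lemma circle_mean_0 [simp]: "circle_mean p f 0 = norm (f 0) powr p"
  by (simp add: circle_mean_def)

lemma sum_powr_le_card:
  fixes x :: "'i \<Rightarrow> real"
  assumes "finite I" "\<And>i. i \<in> I \<Longrightarrow> 0 \<le> x i" "0 < p"
  shows "(\<Sum>i\<in>I. x i) powr p \<le> real (card I) powr p * (\<Sum>i\<in>I. x i powr p)"
proof (cases "I = {}")
  case False
  define M where "M = Max (x ` I)"
  have M: "M \<in> x ` I" unfolding M_def using assms False by (intro Max_in) auto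
  then obtain i where i: "i \<in> I" "M = x i" by auto
  have "(\<Sum>i\<in>I. x i) \<le> real (card I) * M"
    using assms(1) by (intro sum_bounded_above) (auto simp: M_def)
  then have "(\<Sum>i\<in>I. x i) powr p \<le> (real (card I) * M) powr p"
    using assms by (intro powr_mono2) (auto intro: sum_nonneg)
  also have "\<dots> = real (card I) powr p * M powr p" by (simp add: powr_mult)
  also have "M powr p \<le> (\<Sum>i\<in>I. x i powr p)"
    unfolding i(2) using assms i by (intro member_le_sum) auto
  finally show ?thesis by (simp add: mult_left_mono)
qed auto

lemma circle_mean_sum_le:
  assumes "finite I" "\<And>i. i \<in> I \<Longrightarrow> continuous_on (sphere 0 (norm z)) (F i)" "0 < p"
  shows "circle_mean p (\<lambda>u. \<Sum>i\<in>I. F i u) z \<le> real (card I) powr p * (\<Sum>i\<in>I. circle_mean p (F i) z)"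
proof -
  have int: "(\<lambda>t. norm (F i (z * cis (2 * pi * t))) powr p) integrable_on {0..1}" if "i \<in> I" for i
    using assms that by (intro integrable_circle_mean) auto
  have "circle_mean p (\<lambda>u. \<Sum>i\<in>I. F i u) z \<le>
      integral {0..1} (\<lambda>t. real (card I) powr p * (\<Sum>i\<in>I. norm (F i (z * cis (2 * pi * t))) powr p))"
    unfolding circle_mean_def
  proof (rule integral_le)
    show "(\<lambda>t. norm (\<Sum>i\<in>I. F i (z * cis (2 * pi * t))) powr p) integrable_on {0..1}"
      using assms integrable_circle_mean[of z "\<lambda>u. \<Sum>i\<in>I. F i u" p] by (simp add: continuous_on_sum)
    show "(\<lambda>t. real (card I) powr p * (\<Sum>i\<in>I. norm (F i (z * cis (2 * pi * t))) powr p)) integrable_on {0..1}"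
      using assms(1) int by (intro integrable_on_mult_right integrable_sum)
    fix t
    have "norm (\<Sum>i\<in>I. F i (z * cis (2 * pi * t))) powr p \<le> (\<Sum>i\<in>I. norm (F i (z * cis (2 * pi * t)))) powr p"
      using assms by (intro powr_mono2 norm_sum) auto
    also have "\<dots> \<le> real (card I) powr p * (\<Sum>i\<in>I. norm (F i (z * cis (2 * pi * t))) powr p)"
      using assms by (intro sum_powr_le_card) auto
    finally show "norm (\<Sum>i\<in>I. F i (z * cis (2 * pi * t))) powr p \<le> \<dots>" .
  qed
  also have "\<dots> = real (card I) powr p * (\<Sum>i\<in>I. circle_mean p (F i) z)"
    using assms(1) int by (simp add: circle_mean_def integral_sum)
  finally show ?thesis .
qed

context dyadic_circles
begin

lemma norm_powr_le_mean:
  assumes f: "f holomorphic_on ball 0 1" and p: "0 < p" and z: "norm z \<le> rad q"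
  shows "norm (f z) powr p \<le> rad (Suc q) / (rad (Suc q) - rad q) * mean p f (Suc q)"
proof -
  have lt: "norm z < rad (Suc q)" using z rad_less_Suc[of q] by linarith
  have "norm (f z) powr p \<le> rad (Suc q) / (rad (Suc q) - norm z) * mean p f (Suc q)"
    using norm_powr_le_circle_mean[OF f _ _ p, of z "of_real (rad (Suc q))"] lt by (simp add: mean_def)
  also have "\<dots> \<le> rad (Suc q) / (rad (Suc q) - rad q) * mean p f (Suc q)"
    using z lt rad_less_Suc[of q] by (intro mult_right_mono divide_left_mono mult_pos_pos) auto
  finally show ?thesis .
qed

text \<open>The point evaluation estimate is applied to \<open>f\<close> times a power of the kernel that is \<open>1\<close>
  at \<open>pt k l\<close>; the sum over \<open>l\<close> of the kernels stays bounded.\<close>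

lemma sum_level_le_mean:
  assumes p: "0 < p"
  obtains C where "0 < C" "\<And>f k. f holomorphic_on ball 0 1 \<Longrightarrow>
    (\<Sum>l<2 ^ k. norm (f (pt k l)) powr p) \<le> C * 2 ^ k * mean p f (Suc k)"
proof -
  obtain m :: nat where m: "1 \<le> m" "1 \<le> real m * p" using ex_exponent[OF p] by blast
  define D where "D = (1 / a\<^sup>2) powr (real m * p)"
  show ?thesis
  proof (rule that[of "2 / (1 - a) * D"])
    show "0 < 2 / (1 - a) * D" using a_pos a_lt_1 by (simp add: D_def)
    fix f k assume f: "f holomorphic_on ball 0 1"
    let ?r = "complex_of_real (rad (Suc k))"
    define g where "g = (\<lambda>l z. f z * kern (2 ^ k) (z / pt k l) ^ (2 * m))"
    have g: "g l holomorphic_on ball 0 1" for l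
      unfolding g_def kern_def by (intro holomorphic_intros f) auto
    \<comment> \<open>The gap \<open>rad (Suc k) - rad k\<close> equals
      \<open>rad (Suc k) * (1 - rad (Suc k))\<close>, of order \<open>1 / 2 ^ k\<close>; this is the
      origin of the factor \<open>2 ^ k\<close> in the claim.\<close>
    have fac: "rad (Suc k) / (rad (Suc k) - rad k) \<le> 2 / (1 - a) * 2 ^ k"
    proof -
      have "rad (Suc k) - rad k = rad (Suc k) * (1 - rad (Suc k))"
        using rad_Suc_square[of k] by (simp add: power2_eq_square algebra_simps)
      then have "rad (Suc k) / (rad (Suc k) - rad k) = 1 / (1 - rad (Suc k))" by simp
      also have "\<dots> \<le> 1 / ((1 - a) / 2 ^ Suc k)"
        using one_minus_rad_ge[of "Suc k"] a_lt_1 by (intro divide_left_mono) auto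
      finally show ?thesis by simp
    qed
    have kern_le: "norm (kern (2 ^ k) (u / pt k l) ^ (2 * m)) powr p \<le> D * weight k l u" if u: "norm u \<le> 1" for u l
    proof -
      have w: "0 \<le> weight k l u" "weight k l u \<le> 1" using weight_le_1[OF u] by auto
      have "norm (kern (2 ^ k) (u / pt k l) ^ (2 * m)) = ((1 / a\<^sup>2) * weight k l u) ^ m"
        using a_pos by (simp add: weight_def norm_power power_mult)
      also have "\<dots> powr p \<le> D * weight k l u"
      proof (cases "weight k l u = 0")
        case True
        then show ?thesis using m by simp
      next
        case False
        then have "0 < weight k l u" using w by linarith
        then have pos: "0 < (1 / a\<^sup>2) * weight k l u" using a_pos by simp
        have "(((1 / a\<^sup>2) * weight k l u) ^ m) powr p = ((1 / a\<^sup>2) * weight k l u) powr (real m * p)"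
          using pos by (simp add: powr_realpow[symmetric] powr_powr)
        also have "\<dots> = D * weight k l u powr (real m * p)" by (simp only: powr_mult D_def)
        also have "weight k l u powr (real m * p) \<le> weight k l u powr 1"
          using w m False by (intro powr_mono') auto
        finally show ?thesis using w False by (simp add: D_def mult_left_mono)
      qed
      finally show ?thesis .
    qed
    have "norm (f (pt k l)) powr p \<le> 2 / (1 - a) * 2 ^ k * circle_mean p (g l) ?r" for l
    proof -
      have "norm (f (pt k l)) powr p = norm (g l (pt k l)) powr p" by (simp add: g_def)
      also have "\<dots> \<le> rad (Suc k) / (rad (Suc k) - rad k) * mean p (g l) (Suc k)"
        by (rule norm_powr_le_mean[OF g p]) simp
      also have "\<dots> \<le> 2 / (1 - a) * 2 ^ k * circle_mean p (g l) ?r"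
        unfolding mean_def using fac by (intro mult_right_mono) (auto simp: circle_mean_nonneg)
      finally show ?thesis .
    qed
    then have "(\<Sum>l<2 ^ k. norm (f (pt k l)) powr p) \<le> (\<Sum>l<2 ^ k. 2 / (1 - a) * 2 ^ k * circle_mean p (g l) ?r)"
      by (rule sum_mono)
    also have "\<dots> = 2 / (1 - a) * 2 ^ k * (\<Sum>l<2 ^ k. circle_mean p (g l) ?r)"
      by (rule sum_distrib_left[symmetric])
    also have "\<dots> \<le> 2 / (1 - a) * 2 ^ k * (D * circle_mean p f ?r)"
    proof (rule mult_left_mono)
      have int: "(\<lambda>t. norm (g l (?r * cis (2 * pi * t))) powr p) integrable_on {0..1}" for l
        by (intro integrable_circle_mean holomorphic_continuous_on_sphere[OF g] p) simp
      have intf: "(\<lambda>t. norm (f (?r * cis (2 * pi * t))) powr p) integrable_on {0..1}"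
        by (intro integrable_circle_mean holomorphic_continuous_on_sphere[OF f] p) simp
      have "(\<Sum>l<2 ^ k. circle_mean p (g l) ?r) =
          integral {0..1} (\<lambda>t. \<Sum>l<2 ^ k. norm (g l (?r * cis (2 * pi * t))) powr p)"
        unfolding circle_mean_def by (intro integral_sum[symmetric] int) auto
      also have "\<dots> \<le> integral {0..1} (\<lambda>t. D * norm (f (?r * cis (2 * pi * t))) powr p)"
      proof (rule integral_le)
        show "(\<lambda>t. \<Sum>l<2 ^ k. norm (g l (?r * cis (2 * pi * t))) powr p) integrable_on {0..1}"
          by (intro integrable_sum int) auto
        show "(\<lambda>t. D * norm (f (?r * cis (2 * pi * t))) powr p) integrable_on {0..1}"
          by (intro integrable_on_mult_right intf)
        fix t
        define u where "u = ?r * cis (2 * pi * t)"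
        have u: "norm u \<le> 1" using rad_lt_1[of "Suc k"] by (simp add: u_def less_imp_le del: rad_lt_1)
        have "(\<Sum>l<2 ^ k. norm (g l u) powr p) \<le> (\<Sum>l<2 ^ k. norm (f u) powr p * (D * weight k l u))"
          unfolding g_def norm_mult powr_mult using kern_le[OF u] by (intro sum_mono mult_left_mono) auto
        also have "\<dots> = norm (f u) powr p * D * (\<Sum>l<2 ^ k. weight k l u)"
          by (simp add: sum_distrib_left mult_ac)
        also have "\<dots> \<le> norm (f u) powr p * D * 1"
          using sum_weight_le_1[OF u] by (intro mult_left_mono) (auto simp: D_def)
        finally show "(\<Sum>l<2 ^ k. norm (g l (?r * cis (2 * pi * t))) powr p) \<le>
            D * norm (f (?r * cis (2 * pi * t))) powr p" by (simp add: u_def mult.commute)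
      qed
      also have "\<dots> = D * circle_mean p f ?r"
        unfolding circle_mean_def by (rule integral_mult_right)
      finally show "(\<Sum>l<2 ^ k. circle_mean p (g l) ?r) \<le> D * circle_mean p f ?r" .
    qed (use a_lt_1 in simp)
    finally show "(\<Sum>l<2 ^ k. norm (f (pt k l)) powr p) \<le> 2 / (1 - a) * D * 2 ^ k * mean p f (Suc k)"
      by (simp add: mean_def mult_ac)
  qed
qed

text \<open>Point evaluations turn the bound on the means into local boundedness, and Montel's
  theorem gives a limit. Each partial sum involves finitely many circles, so the bound
  \<open>X\<close> survives the limit and puts \<open>f\<close> into the Bergman space. Pointwise
  convergence is all that the evaluation at the points of the measure calls for.\<close>

lemma bergman_subsequence:
  assumes p: "0 < p" and F: "\<And>n. F n holomorphic_on ball 0 1"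
    and X: "\<And>n Q. (\<Sum>q<Q. mean p (F n) q / 2 ^ q) \<le> X"
  obtains f r where "f \<in> bergman_space p" "strict_mono (r :: nat \<Rightarrow> nat)"
    "\<And>z. z \<in> ball 0 1 \<Longrightarrow> (\<lambda>n. F (r n) z) \<longlonglongrightarrow> f z"
proof -
  have mean_le: "mean p (F n) q \<le> X * 2 ^ q" for n q
  proof -
    have "mean p (F n) q / 2 ^ q \<le> (\<Sum>q<Suc q. mean p (F n) q / 2 ^ q)"
      by (intro member_le_sum) auto
    also have "\<dots> \<le> X" by (rule X)
    finally show ?thesis by (simp add: field_simps)
  qed
  define Y where "Y = (\<lambda>q. (rad (Suc q) / (rad (Suc q) - rad q) * (X * 2 ^ Suc q)) powr (1 / p))"
  have bound: "norm (F n z) \<le> Y q" if "norm z \<le> rad q" for n z q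
  proof -
    have "norm (F n z) powr p \<le> rad (Suc q) / (rad (Suc q) - rad q) * mean p (F n) (Suc q)"
      by (rule norm_powr_le_mean[OF F p that])
    also have "\<dots> \<le> rad (Suc q) / (rad (Suc q) - rad q) * (X * 2 ^ Suc q)"
      using rad_less_Suc[of q] by (intro mult_left_mono mean_le divide_nonneg_nonneg) auto
    finally have "(norm (F n z) powr p) powr (1 / p) \<le> Y q"
      unfolding Y_def using p by (intro powr_mono2) auto
    then show ?thesis using p by (simp add: powr_powr)
  qed
  have compact: "\<exists>B. \<forall>h\<in>range F. \<forall>z\<in>K. norm (h z) \<le> B" if K: "compact K" "K \<subseteq> ball 0 1" for K
  proof -
    have "\<exists>q. \<forall>z\<in>K. norm z \<le> rad q"
    proof (cases "K = {}")
      case False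
      obtain z where z: "z \<in> K" "\<And>w. w \<in> K \<Longrightarrow> norm w \<le> norm z"
        using continuous_attains_sup[OF K(1) False, of norm] by (auto intro: continuous_intros)
      then have "norm z < 1" using K by auto
      then obtain q where "norm z < rad q" using ex_less_rad by blast
      then show ?thesis using z(2) by (intro exI[of _ q]) (auto intro: order_trans less_imp_le)
    qed auto
    then show ?thesis using bound by blast
  qed
  obtain f r where f: "f holomorphic_on ball 0 1" and r: "strict_mono (r :: nat \<Rightarrow> nat)"
    and lim: "\<And>x. x \<in> ball 0 1 \<Longrightarrow> (\<lambda>n. F (r n) x) \<longlonglongrightarrow> f x"
    by (rule Montel[of "ball 0 1" "range F" F]) (use F compact in auto)
  have cs: "continuous_on (sphere 0 (norm (complex_of_real (rad q)))) (F n)" for n q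
    by (intro holomorphic_continuous_on_sphere[OF F]) simp
  have "(\<lambda>n. mean p (F (r n)) q) \<longlonglongrightarrow> mean p f q" for q
    unfolding mean_def
    by (rule circle_mean_tendsto[where B="Y q"]) (use p lim bound cs in auto)
  then have "(\<lambda>n. \<Sum>q<Q. mean p (F (r n)) q / 2 ^ q) \<longlonglongrightarrow> (\<Sum>q<Q. mean p f q / 2 ^ q)" for Q
    by (intro tendsto_sum tendsto_divide tendsto_const) auto
  then have "(\<Sum>q<Q. mean p f q / 2 ^ q) \<le> X" for Q
    by (rule LIMSEQ_le_const2) (use X in auto)
  then have "summable (\<lambda>q. mean p f q / 2 ^ q)"
    by (intro summableI_nonneg_bounded) auto
  then have "f \<in> bergman_space p" using f by (simp add: bergman_space_iff[OF p])
  then show ?thesis using that r lim by blast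
qed

lemma pt_complete:
  assumes "z ^ 2 ^ k = of_real a" obtains l where "l < 2 ^ k" "z = pt k l"
proof -
  have "(z / of_real (rad k)) ^ 2 ^ k = 1"
    using assms a_pos by (simp add: power_divide rad_power flip: of_real_power)
  then obtain l where "l < 2 ^ k" "z / of_real (rad k) = cis (2 * pi * real l / real (2 ^ k))"
    using Complex.bij_betw_roots_unity[of "2 ^ k"] unfolding bij_betw_def by (auto simp: image_iff set_eq_iff)
  then show ?thesis using that[of l] by (simp add: pt_def field_simps)
qed

text \<open>Instead of \<open>fac\<close>, the polynomial \<open>P\<close> is divided out: its zeros
  are the points of the level, all simple because none of them is 0, so l'Hopital's rule supplies
  the missing values of the quotient. The two differ by the zero-free denominator of
  \<open>fac\<close>.\<close>

lemma divide_level: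
  assumes f: "f holomorphic_on ball 0 1" and 0: "\<And>l. l < 2 ^ k \<Longrightarrow> f (pt k l) = 0"
  obtains h where "h holomorphic_on ball 0 1" "\<And>z. z \<in> ball 0 1 \<Longrightarrow> f z = fac (z ^ 2 ^ k) * h z"
proof -
  define P where "P = (\<lambda>z::complex. 1 - z ^ 2 ^ k / of_real a)"
  define P' where "P' = (\<lambda>z::complex. - (of_nat (2 ^ k) * z ^ (2 ^ k - 1)) / of_real a)"
  define h where "h = (\<lambda>z. if P z = 0 then deriv f z / P' z else f z / P z)"
  define Z where "Z = pt k ` {..<2 ^ k}"
  have PZ: "P z = 0 \<longleftrightarrow> z \<in> Z" for z
  proof
    assume "P z = 0"
    then have "z ^ 2 ^ k = of_real a" using a_pos by (simp add: P_def field_simps)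
    then show "z \<in> Z" by (rule pt_complete) (auto simp: Z_def)
  next
    assume "z \<in> Z"
    then show "P z = 0" using a_pos by (auto simp: Z_def P_def pt_power)
  qed
  have dP: "(P has_field_derivative P' z) (at z)" for z
    unfolding P_def P'_def using a_pos by (auto intro!: derivative_eq_intros)
  have hol: "h holomorphic_on ball 0 1"
  proof (rule no_isolated_singularity')
    show "h holomorphic_on ball 0 1 - Z"
    proof (rule holomorphic_transform)
      show "(\<lambda>z. f z / P z) holomorphic_on ball 0 1 - Z"
      proof (intro holomorphic_on_divide)
        show "f holomorphic_on ball 0 1 - Z" by (rule holomorphic_on_subset[OF f]) auto
        show "P holomorphic_on ball 0 1 - Z" unfolding P_def using a_pos by (intro holomorphic_intros) auto
      qed (use PZ in auto)
    qed (use PZ in \<open>auto simp: h_def\<close>)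
    show "finite Z" by (simp add: Z_def)
    fix z assume z: "z \<in> Z"
    then have zb: "z \<in> ball 0 1" and z0: "z \<noteq> 0" and fz: "f z = 0" using 0 by (auto simp: Z_def)
    have "((\<lambda>w. f w / P w) \<longlongrightarrow> h z) (at z)"
    proof (rule lhopital_complex_simple[of f "deriv f z"])
      show "(f has_field_derivative deriv f z) (at z)"
        using f zb by (intro holomorphic_derivI[of _ "ball 0 1"]) auto
      show "(P has_field_derivative P' z) (at z)" by (rule dP)
      show "P' z \<noteq> 0" using z0 a_pos by (simp add: P'_def)
      show "deriv f z / P' z = h z" using z PZ by (simp add: h_def)
    qed (use fz z PZ in auto)
    moreover have "eventually (\<lambda>w. w \<in> - (Z - {z})) (nhds z)"
      by (intro eventually_nhds_in_open open_Compl finite_imp_closed) (auto simp: Z_def)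
    then have "eventually (\<lambda>w. f w / P w = h w) (at z)"
      unfolding eventually_at_filter by eventually_elim (use PZ in \<open>auto simp: h_def\<close>)
    ultimately have "(h \<longlongrightarrow> h z) (at z)" by (rule Lim_transform_eventually)
    then show "(h \<longlongrightarrow> h z) (at z within ball 0 1)" by (rule tendsto_within_subset) auto
  qed auto
  show ?thesis
  proof (rule that[of "\<lambda>z. (1 - of_real a * z ^ 2 ^ k) * h z"])
    show "(\<lambda>z. (1 - of_real a * z ^ 2 ^ k) * h z) holomorphic_on ball 0 1"
      by (intro holomorphic_intros hol)
    fix z :: complex assume z: "z \<in> ball 0 1"
    have "f z = P z * h z" using 0 PZ[of z] by (auto simp: h_def Z_def)
    moreover have "fac (z ^ 2 ^ k) * (1 - of_real a * z ^ 2 ^ k) = P z"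
      using fac_denom_nonzero[of "z ^ 2 ^ k"] z power_in_disk[of z k] by (simp add: fac_def P_def)
    ultimately show "f z = fac (z ^ 2 ^ k) * ((1 - of_real a * z ^ 2 ^ k) * h z)" by (simp add: mult.assoc[symmetric])
  qed
qed

lemma fac_pt_power_nonzero:
  assumes "i < q" shows "fac (pt q l ^ 2 ^ i) \<noteq> 0"
proof
  assume "fac (pt q l ^ 2 ^ i) = 0"
  moreover have n: "norm (pt q l ^ 2 ^ i) = rad (q - i)" using assms by (simp add: norm_power rad_power)
  moreover have "rad (q - i) \<le> 1" by (simp add: less_imp_le)
  ultimately have "pt q l ^ 2 ^ i = of_real a" using fac_eq_0_iff by metis
  then have "rad (q - i) = a" using n a_pos by simp
  then show False using a_less_rad[of "q - i"] assms by simp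
qed

lemma divide_levels:
  assumes f: "f holomorphic_on ball 0 1" and 0: "\<And>i l. k \<le> i \<Longrightarrow> i < k + j \<Longrightarrow> l < 2 ^ i \<Longrightarrow> f (pt i l) = 0"
  obtains h where "h holomorphic_on ball 0 1" "\<And>z. z \<in> ball 0 1 \<Longrightarrow> f z = level_prod {k..<k + j} z * h z"
proof -
  have "\<exists>h. h holomorphic_on ball 0 1 \<and> (\<forall>z\<in>ball 0 1. f z = level_prod {k..<k + j} z * h z)"
    using 0
  proof (induction j)
    case 0
    then show ?case using f by (intro exI[of _ f]) (simp add: level_prod_def)
  next
    case (Suc j)
    then obtain h where h: "h holomorphic_on ball 0 1" "\<And>z. z \<in> ball 0 1 \<Longrightarrow> f z = level_prod {k..<k + j} z * h z"
      by force
    \<comment> \<open>Dividing by the earlier levels does not destroy the zeros on level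
      \<open>k + j\<close>, because the earlier factors vanish on other circles only.\<close>
    have "h (pt (k + j) l) = 0" if "l < 2 ^ (k + j)" for l
    proof -
      have "level_prod {k..<k + j} (pt (k + j) l) \<noteq> 0"
        unfolding level_prod_def using fac_pt_power_nonzero by simp
      moreover have "f (pt (k + j) l) = 0" using that by (intro Suc.prems) auto
      ultimately show ?thesis using h(2)[OF pt_in_disk, of "k + j" l] by simp
    qed
    then obtain h' where h': "h' holomorphic_on ball 0 1" "\<And>z. z \<in> ball 0 1 \<Longrightarrow> h z = fac (z ^ 2 ^ (k + j)) * h' z"
      using divide_level[OF h(1)] by blast
    have "level_prod {k..<k + Suc j} z = level_prod {k..<k + j} z * fac (z ^ 2 ^ (k + j))" for z
      by (simp add: level_prod_def)
    then show ?case using h h' by (intro exI[of _ h']) (simp add: mult.assoc)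
  qed
  then show ?thesis using that by blast
qed

text \<open>The product over the \<open>j\<close> levels is at most a constant on circle
  \<open>k\<close> and at least of order \<open>(1 / a) ^ j\<close> on circle \<open>k + j\<close>.
  As the means of the quotient increase between the two circles, \<open>f\<close> must grow as much
  as the product does, up to a constant.\<close>

lemma mean_decay:
  assumes p: "0 < p"
  obtains C where "0 < C" "\<And>f k j. f holomorphic_on ball 0 1 \<Longrightarrow>
    (\<And>i l. k \<le> i \<Longrightarrow> i < k + j \<Longrightarrow> l < 2 ^ i \<Longrightarrow> f (pt i l) = 0) \<Longrightarrow>
    mean p f k \<le> C * (a powr p) ^ j * mean p f (k + j)"
proof -
  obtain c where c: "0 < c" "\<And>z k j. norm z = rad (k + j) \<Longrightarrow> c * (1 / a) ^ j \<le> norm (level_prod {k..<k + j} z)"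
    using level_prod_lower by blast
  have T: "0 < tail_const" using tail_const_ge_1 by linarith
  show ?thesis
  proof (rule that[of "tail_const powr p * (1 / c) powr p"])
    show "0 < tail_const powr p * (1 / c) powr p" using c T by simp
    fix f k j assume f: "f holomorphic_on ball 0 1"
      and 0: "\<And>i l. k \<le> i \<Longrightarrow> i < k + j \<Longrightarrow> l < 2 ^ i \<Longrightarrow> f (pt i l) = 0"
    obtain h where h: "h holomorphic_on ball 0 1" "\<And>z. z \<in> ball 0 1 \<Longrightarrow> f z = level_prod {k..<k + j} z * h z"
      using divide_levels[of f k j] f 0 by blast
    have cs: "continuous_on (sphere 0 (norm (complex_of_real (rad q)))) g" if "g holomorphic_on ball 0 1" for g q
      using that by (intro holomorphic_continuous_on_sphere) auto
    have "mean p f k \<le> tail_const powr p * mean p h k"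
      unfolding mean_def
    proof (rule circle_mean_le_scale[OF cs[OF f] cs[OF h(1)] p])
      fix u :: complex assume u: "norm u = norm (complex_of_real (rad k))"
      then have "norm (level_prod {k..<k + j} u) \<le> tail_const"
        by (intro norm_level_prod_tail_le[of u k]) auto
      then show "norm (f u) \<le> tail_const * norm (h u)"
        using h(2)[of u] u by (simp add: norm_mult mult_right_mono)
    qed (use T in simp)
    also have "mean p h k \<le> mean p h (k + j)" by (rule mean_mono[OF h(1) p]) simp
    also have "\<dots> \<le> (1 / c * a ^ j) powr p * mean p f (k + j)"
      unfolding mean_def
    proof (rule circle_mean_le_scale[OF cs[OF h(1)] cs[OF f] p])
      fix u :: complex assume u: "norm u = norm (complex_of_real (rad (k + j)))"
      then have "c * (1 / a) ^ j * norm (h u) \<le> norm (level_prod {k..<k + j} u) * norm (h u)"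
        using c(2)[of u k j] by (intro mult_right_mono) auto
      also have "\<dots> = norm (f u)" using h(2)[of u] u by (simp add: norm_mult)
      finally show "norm (h u) \<le> 1 / c * a ^ j * norm (f u)"
        using c(1) a_pos by (simp add: field_simps)
    qed (use c a_pos in simp)
    also have "(1 / c * a ^ j) powr p = (1 / c) powr p * (a powr p) ^ j"
      using a_pos by (simp only: powr_mult powr_power) (simp add: powr_realpow[symmetric] powr_powr mult.commute)
    finally show "mean p f k \<le> tail_const powr p * (1 / c) powr p * (a powr p) ^ j * mean p f (k + j)"
      using T by (simp add: mult_ac mult_left_mono)
  qed
qed

end

section \<open>Sampling and interpolation\<close>

text \<open>At least one of the two truncated differences is 0, so this is the absolute difference
  of the levels.\<close>

definition level_dist :: "nat \<Rightarrow> nat \<Rightarrow> nat" where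
  "level_dist q k = (q - k) + (k - q)"

lemma sum_power_level_dist_le:
  fixes x :: real
  assumes x: "0 < x" "x < 1" and fin: "finite I"
  shows "(\<Sum>k\<in>I. x ^ level_dist q k) \<le> 2 / (1 - x)"
proof -
  have geo: "(\<Sum>k\<in>J. x ^ g k) \<le> 1 / (1 - x)" if "finite J" "inj_on g J" for J :: "nat set" and g
  proof -
    have "(\<Sum>k\<in>J. x ^ g k) = (\<Sum>d\<in>g ` J. x ^ d)" using that by (simp add: sum.reindex)
    also have "\<dots> \<le> (\<Sum>d. x ^ d)" using x that by (intro sum_le_suminf summable_geometric) auto
    finally show ?thesis using x by (simp add: suminf_geometric)
  qed
  have "(\<Sum>k\<in>I. x ^ level_dist q k) = (\<Sum>k\<in>I \<inter> {..q}. x ^ level_dist q k) + (\<Sum>k\<in>I \<inter> {q<..}. x ^ level_dist q k)"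
  proof -
    have "I = (I \<inter> {..q}) \<union> (I \<inter> {q<..})" by auto
    then show ?thesis using fin sum.union_disjoint[of "I \<inter> {..q}" "I \<inter> {q<..}" "\<lambda>k. x ^ level_dist q k"]
      by (simp add: disjoint_iff)
  qed
  also have "\<dots> \<le> 1 / (1 - x) + 1 / (1 - x)"
    using fin by (intro add_mono geo) (auto simp: inj_on_def level_dist_def)
  finally show ?thesis by simp
qed

text \<open>A substitute for Hoelder's inequality, valid for all \<open>p > 0\<close>: the sum is
  weighted by a geometric \<open>v k\<close>, and \<open>\<eta>\<close> is chosen with
  \<open>(\<eta> ^ m) powr p = 1 / b\<close>, so undoing the weights costs exactly
  \<open>b ^ level_dist q k\<close>. As \<open>b\<close> may be taken arbitrarily close to 1, any
  geometric decay in the distance of levels absorbs the loss.\<close>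

lemma powr_sum_le_level_dist:
  fixes p b :: real
  assumes p: "0 < p" and b: "1 < b"
  obtains V where "0 < V" "\<And>q (I :: nat set) x. finite I \<Longrightarrow> (\<And>k. k \<in> I \<Longrightarrow> 0 \<le> x k) \<Longrightarrow>
    (\<Sum>k\<in>I. x k) powr p \<le> V * (\<Sum>k\<in>I. b ^ level_dist q k * x k powr p)"
proof -
  obtain m :: nat where m: "1 \<le> m" "1 \<le> real m * p" using ex_exponent[OF p] by blast
  define \<eta> where "\<eta> = b powr (- 1 / (real m * p))"
  have \<eta>: "0 < \<eta>" "\<eta> < 1"
    using b m by (auto simp: \<eta>_def powr_less_one)
  have \<eta>b: "(\<eta> ^ m) powr p = 1 / b"
  proof -
    have "(\<eta> ^ m) powr p = b powr (- 1 / (real m * p) * real m * p)"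
      using b by (simp add: \<eta>_def powr_powr powr_realpow[symmetric])
    also have "- 1 / (real m * p) * real m * p = - 1" using m p by (simp add: field_simps)
    finally show ?thesis using b by (simp add: powr_minus_divide)
  qed
  define V where "V = max 1 (2 / (1 - \<eta>))"
  show ?thesis
  proof (rule that[of "V powr p"])
    show "0 < V powr p" by (simp add: V_def)
    fix q :: nat and I :: "nat set" and x :: "nat \<Rightarrow> real"
    assume I: "finite I" and x: "\<And>k. k \<in> I \<Longrightarrow> 0 \<le> x k"
    define v where "v = (\<lambda>k. \<eta> ^ level_dist q k)"
    have v: "0 < v k" "v k \<le> 1" for k using \<eta> by (auto simp: v_def power_le_one)
    have "(\<Sum>k\<in>I. x k / v k ^ m * v k ^ m) powr p \<le> V powr p * (\<Sum>k\<in>I. (x k / v k ^ m) powr p * v k)"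
    proof (rule powr_sum_le[OF I _ _ _ _ _ p m])
      show "sum v I \<le> V"
        using sum_power_level_dist_le[OF \<eta> I, of q] by (simp add: v_def V_def)
    qed (use v x in \<open>auto simp: V_def less_imp_le\<close>)
    also have "(\<Sum>k\<in>I. (x k / v k ^ m) powr p * v k) \<le> (\<Sum>k\<in>I. b ^ level_dist q k * x k powr p)"
    proof (rule sum_mono)
      fix k assume "k \<in> I"
      have "(v k ^ m) powr p = (1 / b) ^ level_dist q k"
      proof -
        have "v k ^ m = (\<eta> ^ m) ^ level_dist q k" by (simp add: v_def power_mult[symmetric] mult.commute)
        also have "\<dots> powr p = ((\<eta> ^ m) powr p) ^ level_dist q k"
          using \<eta> by (simp add: powr_realpow[symmetric] powr_powr mult_ac)
        finally show ?thesis by (simp only: \<eta>b)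
      qed
      then have "(x k / v k ^ m) powr p = b ^ level_dist q k * x k powr p"
        using b by (simp add: powr_divide power_one_over)
      then show "(x k / v k ^ m) powr p * v k \<le> b ^ level_dist q k * x k powr p"
        using v[of k] b by (simp add: mult_left_le)
    qed
    finally show "(\<Sum>k\<in>I. x k) powr p \<le> V powr p * (\<Sum>k\<in>I. b ^ level_dist q k * x k powr p)"
      using v(1) by (simp add: less_imp_neq[THEN not_sym] V_def)
  qed
qed

lemma summable_double_exponential:
  fixes b c :: real
  assumes "0 < b" "b < 1" "0 \<le> c"
  shows "summable (\<lambda>d. c ^ d * b ^ 2 ^ d)"
proof -
  have "(\<lambda>d. c * b ^ d) \<longlonglongrightarrow> 0"
    using assms by (intro tendsto_mult_right_zero LIMSEQ_power_zero) simp
  then have "eventually (\<lambda>d. c * b ^ d < 1 / 2) sequentially"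
    by (rule order_tendstoD) simp
  then obtain N where N: "\<And>d. N \<le> d \<Longrightarrow> c * b ^ d < 1 / 2" by (auto simp: eventually_sequentially)
  show ?thesis
  proof (rule summable_ratio_test[of "1 / 2" N])
    fix d assume d: "N \<le> d"
    have "b ^ 2 ^ d \<le> b ^ d" using assms by (intro power_decreasing) (auto intro: less_imp_le less_exp)
    then have "c * b ^ 2 ^ d \<le> 1 / 2" using N[OF d] mult_left_mono[of "b ^ 2 ^ d" "b ^ d" c] assms by linarith
    then have "(c ^ d * b ^ 2 ^ d) * (c * b ^ 2 ^ d) \<le> (c ^ d * b ^ 2 ^ d) * (1 / 2)"
      using assms by (intro mult_left_mono) auto
    moreover have "b ^ 2 ^ Suc d = b ^ 2 ^ d * b ^ 2 ^ d"
      by (simp add: power_add[symmetric] mult_2[symmetric])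
    then have "norm (c ^ Suc d * b ^ 2 ^ Suc d) = (c ^ d * b ^ 2 ^ d) * (c * b ^ 2 ^ d)"
      using assms by (simp add: abs_mult)
    moreover have "norm (c ^ d * b ^ 2 ^ d) = c ^ d * b ^ 2 ^ d" using assms by (simp add: abs_mult)
    ultimately show "norm (c ^ Suc d * b ^ 2 ^ Suc d) \<le> 1 / 2 * norm (c ^ d * b ^ 2 ^ d)"
      by linarith
  qed simp
qed

context dyadic_circles
begin

definition level_sum :: "real \<Rightarrow> (complex \<Rightarrow> complex) \<Rightarrow> nat \<Rightarrow> real" where
  "level_sum p f k = (\<Sum>l<2 ^ k. norm (f (pt k l)) powr p) / 4 ^ k"

lemma level_sum_nonneg [simp]: "0 \<le> level_sum p f k"
  by (simp add: level_sum_def sum_nonneg)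

lemma real_of_4_power: "(4 :: real) ^ k = 2 ^ k * 2 ^ k"
  by (simp add: power_mult_distrib[symmetric])

text \<open>The Carleson property: \<open>2 ^ k\<close> points of mass \<open>1 / 4 ^ k\<close> turn
  the mean over circle \<open>Suc k\<close> into a term with the weight \<open>1 / 2 ^ k\<close> of
  an annulus.\<close>

lemma summable_level_sum:
  assumes p: "0 < p" and f: "f \<in> bergman_space p"
  shows "summable (level_sum p f)"
proof -
  have hol: "f holomorphic_on ball 0 1" and s: "summable (\<lambda>q. mean p f q / 2 ^ q)"
    using f by (auto simp: bergman_space_iff[OF p])
  obtain C where C: "0 < C" "\<And>f k. f holomorphic_on ball 0 1 \<Longrightarrow>
    (\<Sum>l<2 ^ k. norm (f (pt k l)) powr p) \<le> C * 2 ^ k * mean p f (Suc k)"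
    using sum_level_le_mean[OF p] by blast
  show ?thesis
  proof (rule summable_comparison_test'[of "\<lambda>k. 2 * C * (mean p f (Suc k) / 2 ^ Suc k)" 0])
    show "summable (\<lambda>k. 2 * C * (mean p f (Suc k) / 2 ^ Suc k))"
      using s by (intro summable_mult) (subst summable_Suc_iff)
    fix k
    have "level_sum p f k \<le> C * 2 ^ k * mean p f (Suc k) / 4 ^ k"
      unfolding level_sum_def by (intro divide_right_mono C(2) hol) simp
    then show "norm (level_sum p f k) \<le> 2 * C * (mean p f (Suc k) / 2 ^ Suc k)"
      by (simp add: real_of_4_power)
  qed
qed

text \<open>Above the critical exponent the restriction to the points bounds the Bergman norm: \<open>f\<close> minus
  its interpolant on \<open>j\<close> consecutive levels decays by the factor \<open>(a powr p) ^ j\<close>, which beats the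
  factor \<open>2 ^ j\<close> between the weights of the circles, so the remainder can be absorbed.\<close>

lemma sampling:
  assumes p: "0 < p" and ap: "a powr p < 1 / 2"
  obtains C where "0 < C" "\<And>f Q. f \<in> bergman_space p \<Longrightarrow>
    (\<Sum>q<Q. mean p f q / 2 ^ q) \<le> C * (\<Sum>k. level_sum p f k)"
proof -
  obtain m :: nat where m: "1 \<le> m" "1 \<le> real m * p" using ex_exponent[OF p] by blast
  obtain C1 where C1: "0 < C1" "\<And>f k j. f holomorphic_on ball 0 1 \<Longrightarrow>
    (\<And>i l. k \<le> i \<Longrightarrow> i < k + j \<Longrightarrow> l < 2 ^ i \<Longrightarrow> f (pt i l) = 0) \<Longrightarrow>
    mean p f k \<le> C1 * (a powr p) ^ j * mean p f (k + j)"
    using mean_decay[OF p] by blast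
  obtain C2 where C2: "0 < C2" "\<And>K k c q z. k < K \<Longrightarrow> norm z \<le> rad q \<Longrightarrow>
    circle_mean p (level_interp m K k c) z \<le> C2 * growth q k powr p * (\<Sum>l<2 ^ k. norm (c l) powr p) / 2 ^ k"
    using circle_mean_level_interp_le[OF p m] by blast
  define T where "T = (2::real) powr p"
  have T: "1 \<le> T" unfolding T_def using p by (intro ge_one_powr_ge_zero) auto
  \<comment> \<open>\<open>T\<close> is the constant of the quasi-triangle inequality. It enters
    twice, for \<open>f = G + S\<close> and for \<open>G = f - S\<close>; since
    \<open>2 * a powr p < 1\<close>, a large \<open>j\<close> beats all constants.\<close>
  have "(\<lambda>j. T * T * C1 * (2 * a powr p) ^ j) \<longlonglongrightarrow> 0"
    using ap by (intro tendsto_mult_right_zero LIMSEQ_power_zero) simp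
  then have "eventually (\<lambda>j. T * T * C1 * (2 * a powr p) ^ j < 1 / 2) sequentially"
    by (rule order_tendstoD) simp
  then obtain j where j: "T * T * C1 * (2 * a powr p) ^ j < 1 / 2"
    by (auto simp: eventually_sequentially)
  define \<theta> where "\<theta> = C1 * (a powr p) ^ j"
  have \<theta>: "0 \<le> \<theta>" using C1 by (simp add: \<theta>_def)
  define D where "D = real j powr p * (C2 * ((1 / a) ^ j) powr p)"
  have D: "0 \<le> D" using C2 by (simp add: D_def)
  define D' where "D' = (T + T * T * \<theta>) * D * 2 ^ j"
  have D': "0 \<le> D'" using D \<theta> T by (simp add: D'_def)
  have step: "mean p f k / 2 ^ k \<le> 1 / 2 * (mean p f (k + j) / 2 ^ (k + j)) + D' * (\<Sum>d<j. level_sum p f (k + d))"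
    if f: "f holomorphic_on ball 0 1" for f k
  proof -
    \<comment> \<open>Interpolating with \<open>K = k + j\<close> makes the functions for different
      levels of the block vanish on each other's points.\<close>
    define U where "U = (\<lambda>d. level_interp m (k + j) (k + d) (\<lambda>l. f (pt (k + d) l)))"
    define S where "S = (\<lambda>z. \<Sum>d<j. U d z)"
    define G where "G = (\<lambda>z. f z - S z)"
    have hU: "U d holomorphic_on ball 0 1" for d unfolding U_def by (rule level_interp_holomorphic)
    have hS: "S holomorphic_on ball 0 1" unfolding S_def by (intro holomorphic_intros hU)
    have hG: "G holomorphic_on ball 0 1" unfolding G_def by (intro holomorphic_intros f hS)
    have cs: "continuous_on (sphere 0 (norm (complex_of_real (rad q)))) g" if "g holomorphic_on ball 0 1" for g q
      using that by (intro holomorphic_continuous_on_sphere) auto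
    have G0: "G (pt i l) = 0" if i: "k \<le> i" "i < k + j" and l: "l < 2 ^ i" for i l
    proof -
      have "S (pt i l) = (\<Sum>d<j. if d = i - k then f (pt i l) else 0)"
        unfolding S_def U_def using i l m(1)
        by (intro sum.cong refl) (auto simp: level_interp_pt)
      also have "\<dots> = f (pt i l)" using i by simp
      finally show ?thesis by (simp add: G_def)
    qed
    have mS: "mean p S (k + j) \<le> D * (\<Sum>d<j. level_sum p f (k + d) * 2 ^ (k + d))"
    proof -
      have "mean p S (k + j) \<le> real (card {..<j}) powr p * (\<Sum>d<j. mean p (U d) (k + j))"
        unfolding mean_def S_def by (intro circle_mean_sum_le cs hU p) auto
      also have "\<dots> \<le> real j powr p * (\<Sum>d<j. C2 * ((1 / a) ^ j) powr p * (level_sum p f (k + d) * 2 ^ (k + d)))"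
        unfolding card_lessThan
      proof (intro mult_left_mono sum_mono)
        fix d assume d: "d \<in> {..<j}"
        have "mean p (U d) (k + j) \<le> C2 * growth (k + j) (k + d) powr p * (\<Sum>l<2 ^ (k + d). norm (f (pt (k + d) l)) powr p) / 2 ^ (k + d)"
          unfolding mean_def U_def using d by (intro C2(2)) auto
        also have "\<dots> = C2 * growth (k + j) (k + d) powr p * (level_sum p f (k + d) * 2 ^ (k + d))"
          by (simp add: level_sum_def real_of_4_power)
        also have "\<dots> \<le> C2 * ((1 / a) ^ j) powr p * (level_sum p f (k + d) * 2 ^ (k + d))"
        proof (intro mult_right_mono mult_left_mono powr_mono2)
          have "(1 / a) ^ (j - d) \<le> (1 / a) ^ j" using a_pos a_lt_1 by (intro power_increasing) auto
          then show "growth (k + j) (k + d) \<le> (1 / a) ^ j" using d by (simp add: growth_def)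
        qed (use p C2 in \<open>auto simp: less_imp_le\<close>)
        finally show "mean p (U d) (k + j) \<le> C2 * ((1 / a) ^ j) powr p * (level_sum p f (k + d) * 2 ^ (k + d))" .
      qed simp
      finally show ?thesis by (simp add: D_def sum_distrib_left mult_ac)
    qed
    have "mean p f k \<le> T * (mean p G k + mean p S k)"
      using circle_mean_add_le[OF cs[OF hG] cs[OF hS] p, of k] by (simp add: mean_def G_def T_def)
    also have "mean p S k \<le> mean p S (k + j)" by (rule mean_mono[OF hS p]) simp
    also have "mean p G k \<le> \<theta> * mean p G (k + j)"
      unfolding \<theta>_def using C1(2)[OF hG, of k j] G0 by blast
    also have "mean p G (k + j) \<le> T * (mean p f (k + j) + mean p S (k + j))"
      using circle_mean_add_le[OF cs[OF f] cs[OF holomorphic_on_minus[OF hS]] p, of "k + j"]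
      by (simp add: mean_def G_def T_def circle_mean_minus)
    finally have "mean p f k \<le> T * (\<theta> * (T * (mean p f (k + j) + mean p S (k + j))) + mean p S (k + j))"
      using T \<theta> by (simp add: mult_left_mono)
    also have "\<dots> = T * T * \<theta> * mean p f (k + j) + (T + T * T * \<theta>) * mean p S (k + j)"
      by (simp add: algebra_simps)
    also have "\<dots> \<le> T * T * \<theta> * mean p f (k + j) + (T + T * T * \<theta>) * (D * (\<Sum>d<j. level_sum p f (k + d) * 2 ^ (k + d)))"
      using T \<theta> by (intro add_left_mono mult_left_mono mS) auto
    finally have "mean p f k / 2 ^ k \<le> (T * T * \<theta> * mean p f (k + j) +
        (T + T * T * \<theta>) * (D * (\<Sum>d<j. level_sum p f (k + d) * 2 ^ (k + d)))) / 2 ^ k"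
      by (rule divide_right_mono) simp
    also have "\<dots> = T * T * C1 * (2 * a powr p) ^ j * (mean p f (k + j) / 2 ^ (k + j)) +
        (T + T * T * \<theta>) * D * (\<Sum>d<j. level_sum p f (k + d) * 2 ^ d)"
      by (simp add: \<theta>_def power_add power_mult_distrib add_divide_distrib sum_divide_distrib sum_distrib_left mult_ac)
    also have "\<dots> \<le> 1 / 2 * (mean p f (k + j) / 2 ^ (k + j)) + (T + T * T * \<theta>) * D * (\<Sum>d<j. level_sum p f (k + d) * 2 ^ j)"
      using j T \<theta> D by (intro add_mono mult_right_mono mult_left_mono sum_mono power_increasing) auto
    also have "(\<Sum>d<j. level_sum p f (k + d) * 2 ^ j) = 2 ^ j * (\<Sum>d<j. level_sum p f (k + d))"
      by (simp add: sum_distrib_left mult.commute)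
    finally show ?thesis by (simp add: D'_def mult_ac)
  qed
  show ?thesis
  proof (rule that[of "2 * D' * real j + 1"])
    show "0 < 2 * D' * real j + 1" using D' by (simp add: add_nonneg_pos)
    fix f Q assume fb: "f \<in> bergman_space p"
    then have f: "f holomorphic_on ball 0 1" and s: "summable (\<lambda>q. mean p f q / 2 ^ q)"
      by (auto simp: bergman_space_iff[OF p])
    have sl: "summable (level_sum p f)" by (rule summable_level_sum[OF p fb])
    define X where "X = (\<Sum>q. mean p f q / 2 ^ q)"
    define Y where "Y = (\<Sum>k. level_sum p f k)"
    have Y: "0 \<le> Y" unfolding Y_def by (intro suminf_nonneg sl) auto
    have shift: "(\<Sum>k<N. g (k + d)) \<le> suminf g" if "summable g" "\<And>k. 0 \<le> g k" for g :: "nat \<Rightarrow> real" and d N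
    proof -
      have "(\<Sum>k<N. g (k + d)) = sum g ((\<lambda>k. k + d) ` {..<N})" by (simp add: sum.reindex)
      also have "\<dots> \<le> suminf g" using that by (intro sum_le_suminf) auto
      finally show ?thesis .
    qed
    have "(\<Sum>q<N. mean p f q / 2 ^ q) \<le> 1 / 2 * X + D' * (real j * Y)" for N
    proof -
      have "(\<Sum>k<N. mean p f k / 2 ^ k) \<le> (\<Sum>k<N. 1 / 2 * (mean p f (k + j) / 2 ^ (k + j)) + D' * (\<Sum>d<j. level_sum p f (k + d)))"
        by (intro sum_mono step f)
      also have "\<dots> = 1 / 2 * (\<Sum>k<N. mean p f (k + j) / 2 ^ (k + j)) + D' * (\<Sum>k<N. \<Sum>d<j. level_sum p f (k + d))"
        by (simp only: sum.distrib sum_distrib_left)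
      also have "(\<Sum>k<N. \<Sum>d<j. level_sum p f (k + d)) = (\<Sum>d<j. \<Sum>k<N. level_sum p f (k + d))"
        by (rule sum.swap)
      also have "1 / 2 * (\<Sum>k<N. mean p f (k + j) / 2 ^ (k + j)) + D' * (\<Sum>d<j. \<Sum>k<N. level_sum p f (k + d))
          \<le> 1 / 2 * X + D' * (\<Sum>d<j. Y)"
        unfolding X_def Y_def using D' shift[OF s] shift[OF sl]
        by (intro add_mono mult_left_mono sum_mono) auto
      finally show ?thesis by simp
    qed
    \<comment> \<open>Absorbing \<open>1 / 2 * X\<close> is legitimate because \<open>X\<close> is
      finite, \<open>f\<close> being a Bergman function by assumption.\<close>
    then have "X \<le> 1 / 2 * X + D' * (real j * Y)"
      unfolding X_def by (rule suminf_le_const[OF s])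
    then have "X \<le> 2 * D' * real j * Y" by simp
    also have "\<dots> \<le> (2 * D' * real j + 1) * Y" using Y by (simp add: distrib_right)
    finally have "X \<le> (2 * D' * real j + 1) * Y" .
    moreover have "(\<Sum>q<Q. mean p f q / 2 ^ q) \<le> X" unfolding X_def by (intro sum_le_suminf s) auto
    ultimately show "(\<Sum>q<Q. mean p f q / 2 ^ q) \<le> (2 * D' * real j + 1) * (\<Sum>k. level_sum p f k)"
      by (simp add: Y_def)
  qed
qed

text \<open>The functions \<open>F K\<close> match the data on the levels below \<open>K\<close>. A
  Schur-type estimate bounds their means uniformly in \<open>K\<close>, and the pointwise limit of a
  subsequence matches all the data.\<close>

lemma interpolation:
  assumes p: "0 < p" and ap: "1 / 2 < a powr p" and c: "summable (level_sum p c)"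
  obtains f where "f \<in> bergman_space p" "\<And>k l. l < 2 ^ k \<Longrightarrow> f (pt k l) = c (pt k l)"
proof -
  obtain m :: nat where m: "1 \<le> m" "1 \<le> real m * p" using ex_exponent[OF p] by blast
  obtain C2 where C2: "0 < C2" "\<And>K k c q z. k < K \<Longrightarrow> norm z \<le> rad q \<Longrightarrow>
    circle_mean p (level_interp m K k c) z \<le> C2 * growth q k powr p * (\<Sum>l<2 ^ k. norm (c l) powr p) / 2 ^ k"
    using circle_mean_level_interp_le[OF p m] by blast
  \<comment> \<open>\<open>\<theta>\<close> compares the growth \<open>1 / a powr p\<close> per
    level with the factor 2 per level in the weights of the circles; below the critical exponent it
    is less than 1, which leaves room for the loss \<open>b\<close>.\<close>
  define \<theta> where "\<theta> = (1 / a powr p) / 2"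
  have \<theta>: "0 < \<theta>" "\<theta> < 1" using ap a_pos by (auto simp: \<theta>_def field_simps)
  obtain b where b: "1 < b" "b < 1 / \<theta>" using dense[of 1 "1 / \<theta>"] \<theta> by auto
  then have b\<theta>: "b * \<theta> < 1" using \<theta> by (simp add: field_simps)
  obtain V where V: "0 < V" "\<And>q (I :: nat set) x. finite I \<Longrightarrow> (\<And>k. k \<in> I \<Longrightarrow> 0 \<le> x k) \<Longrightarrow>
    (\<Sum>k\<in>I. x k) powr p \<le> V * (\<Sum>k\<in>I. b ^ level_dist q k * x k powr p)"
    using powr_sum_le_level_dist[OF p b(1)] by blast
  define A1 where "A1 = (\<Sum>d. (b * \<theta>) ^ d)"
  define A2 where "A2 = (\<Sum>d. (2 * b) ^ d * (a powr p) ^ 2 ^ d)"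
  have s1: "summable (\<lambda>d. (b * \<theta>) ^ d)" using b \<theta> b\<theta> by (intro summable_geometric) simp
  have "a powr p < 1" using a_pos a_lt_1 p by (simp add: powr01_less_one)
  then have s2: "summable (\<lambda>d. (2 * b) ^ d * (a powr p) ^ 2 ^ d)"
    using b a_pos by (intro summable_double_exponential) auto
  \<comment> \<open>\<open>w q k\<close> measures the share of level \<open>k\<close> in the term of
    circle \<open>q\<close>. Since p-th powers are summed, only its sums over \<open>q\<close> for
    fixed \<open>k\<close> matter; the series are geometric for \<open>k \<le> q\<close> and doubly
    exponential for \<open>q < k\<close>.\<close>
  define w where "w = (\<lambda>q k. b ^ level_dist q k * (2 ^ k / 2 ^ q) * growth q k powr p)"
  have w_nonneg: "0 \<le> w q k" for q k using b by (simp add: w_def)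
  have w1: "w q k = (b * \<theta>) ^ (q - k)" if "k \<le> q" for q k
  proof -
    have 1: "(2::real) ^ k / 2 ^ q = (1 / 2) ^ (q - k)" using that by (simp add: power_diff power_one_over)
    have 2: "growth q k powr p = (1 / a powr p) ^ (q - k)"
      using that a_pos by (simp add: growth_def powr_realpow[symmetric] powr_powr powr_divide mult.commute)
    have "w q k = b ^ (q - k) * (2 ^ k / 2 ^ q) * growth q k powr p"
      using that by (simp add: w_def level_dist_def)
    also have "\<dots> = (b * (1 / 2) * (1 / a powr p)) ^ (q - k)" by (simp only: 1 2 power_mult_distrib)
    also have "b * (1 / 2) * (1 / a powr p) = b * \<theta>" by (simp add: \<theta>_def)
    finally show ?thesis .
  qed
  have w2: "w q k = (2 * b) ^ (k - q) * (a powr p) ^ 2 ^ (k - q)" if "q < k" for q k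
  proof -
    have 1: "(2::real) ^ k / 2 ^ q = 2 ^ (k - q)" using that by (simp add: power_diff)
    have 2: "growth q k powr p = (a powr p) ^ 2 ^ (k - q)"
      using that a_pos by (simp add: growth_def powr_realpow[symmetric] powr_powr mult.commute)
    have "w q k = b ^ (k - q) * (2 ^ k / 2 ^ q) * growth q k powr p"
      using that by (simp add: w_def level_dist_def)
    then show ?thesis by (simp only: 1 2 power_mult_distrib mult.commute)
  qed
  have w_sum: "(\<Sum>q<Q. w q k) \<le> A1 + A2" for Q k
  proof -
    have "(\<Sum>q<Q. w q k) = (\<Sum>q\<in>{..<Q} \<inter> {k..}. w q k) + (\<Sum>q\<in>{..<Q} \<inter> {..<k}. w q k)"
    proof -
      have "{..<Q} = ({..<Q} \<inter> {k..}) \<union> ({..<Q} \<inter> {..<k})" by auto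
      then show ?thesis using sum.union_disjoint[of "{..<Q} \<inter> {k..}" "{..<Q} \<inter> {..<k}" "\<lambda>q. w q k"]
        by (simp add: disjoint_iff)
    qed
    also have "(\<Sum>q\<in>{..<Q} \<inter> {k..}. w q k) = (\<Sum>q\<in>{..<Q} \<inter> {k..}. (b * \<theta>) ^ (q - k))"
      by (intro sum.cong refl) (auto simp: w1)
    also have "\<dots> = (\<Sum>d\<in>(\<lambda>q. q - k) ` ({..<Q} \<inter> {k..}). (b * \<theta>) ^ d)"
      by (subst sum.reindex) (auto simp: inj_on_def)
    also have "\<dots> \<le> A1" unfolding A1_def using b \<theta> by (intro sum_le_suminf s1) auto
    also have "(\<Sum>q\<in>{..<Q} \<inter> {..<k}. w q k) = (\<Sum>q\<in>{..<Q} \<inter> {..<k}. (2 * b) ^ (k - q) * (a powr p) ^ 2 ^ (k - q))"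
      by (intro sum.cong refl) (auto simp: w2)
    also have "\<dots> = (\<Sum>d\<in>(\<lambda>q. k - q) ` ({..<Q} \<inter> {..<k}). (2 * b) ^ d * (a powr p) ^ 2 ^ d)"
      by (subst sum.reindex) (auto simp: inj_on_def)
    also have "\<dots> \<le> A2" unfolding A2_def using b by (intro sum_le_suminf s2) auto
    finally show ?thesis by simp
  qed
  define U where "U = (\<lambda>K k. level_interp m K k (\<lambda>l. c (pt k l)))"
  define F where "F = (\<lambda>K z. \<Sum>k<K. U K k z)"
  have hU: "U K k holomorphic_on ball 0 1" for K k unfolding U_def by (rule level_interp_holomorphic)
  have hF: "F K holomorphic_on ball 0 1" for K unfolding F_def by (intro holomorphic_intros hU)
  have F_pt: "F K (pt i l) = c (pt i l)" if "i < K" "l < 2 ^ i" for K i l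
  proof -
    have "F K (pt i l) = (\<Sum>k<K. if k = i then c (pt i l) else 0)"
      unfolding F_def U_def using that m(1) by (intro sum.cong refl) (auto simp: level_interp_pt)
    then show ?thesis using that by simp
  qed
  define X where "X = V * C2 * ((A1 + A2) * (\<Sum>k. level_sum p c k))"
  have mean_F: "mean p (F K) q / 2 ^ q \<le> V * C2 * (\<Sum>k<K. w q k * level_sum p c k)" for K q
  proof -
    let ?u = "\<lambda>t. complex_of_real (rad q) * cis (2 * pi * t)"
    have cs: "continuous_on (sphere 0 (norm (complex_of_real (rad q)))) g" if "g holomorphic_on ball 0 1" for g
      using that by (intro holomorphic_continuous_on_sphere) auto
    have int: "(\<lambda>t. norm (U K k (?u t)) powr p) integrable_on {0..1}" for k
      by (intro integrable_circle_mean cs hU p)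
    have "mean p (F K) q \<le> integral {0..1} (\<lambda>t. V * (\<Sum>k<K. b ^ level_dist q k * norm (U K k (?u t)) powr p))"
      unfolding mean_def circle_mean_def
    proof (rule integral_le)
      show "(\<lambda>t. norm (F K (?u t)) powr p) integrable_on {0..1}"
        by (intro integrable_circle_mean cs hF p)
      show "(\<lambda>t. V * (\<Sum>k<K. b ^ level_dist q k * norm (U K k (?u t)) powr p)) integrable_on {0..1}"
        by (intro integrable_on_mult_right integrable_sum int) auto
      fix t
      have "norm (F K (?u t)) powr p \<le> (\<Sum>k<K. norm (U K k (?u t))) powr p"
        unfolding F_def using p by (intro powr_mono2 norm_sum) auto
      also have "\<dots> \<le> V * (\<Sum>k<K. b ^ level_dist q k * norm (U K k (?u t)) powr p)"
        by (intro V(2)) auto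
      finally show "norm (F K (?u t)) powr p \<le> \<dots>" .
    qed
    also have "\<dots> = V * (\<Sum>k<K. b ^ level_dist q k * mean p (U K k) q)"
      unfolding mean_def circle_mean_def
      by (subst integral_mult_right, subst integral_sum) (auto intro!: integrable_on_mult_right int)
    also have "\<dots> \<le> V * (\<Sum>k<K. b ^ level_dist q k * (C2 * growth q k powr p * (level_sum p c k * 2 ^ k)))"
    proof (intro mult_left_mono sum_mono)
      fix k assume "k \<in> {..<K}"
      then have "mean p (U K k) q \<le> C2 * growth q k powr p * (\<Sum>l<2 ^ k. norm (c (pt k l)) powr p) / 2 ^ k"
        unfolding mean_def U_def by (intro C2(2)) auto
      then show "mean p (U K k) q \<le> C2 * growth q k powr p * (level_sum p c k * 2 ^ k)"
        by (simp add: level_sum_def real_of_4_power)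
    qed (use V b in auto)
    finally have "mean p (F K) q / 2 ^ q \<le> V * (\<Sum>k<K. b ^ level_dist q k * (C2 * growth q k powr p * (level_sum p c k * 2 ^ k))) / 2 ^ q"
      by (rule divide_right_mono) simp
    also have "\<dots> = V * C2 * (\<Sum>k<K. w q k * level_sum p c k)"
      by (simp add: w_def sum_distrib_left sum_divide_distrib mult_ac)
    finally show ?thesis .
  qed
  have bound: "(\<Sum>q<Q. mean p (F K) q / 2 ^ q) \<le> X" for K Q
  proof -
    have "(\<Sum>q<Q. mean p (F K) q / 2 ^ q) \<le> (\<Sum>q<Q. V * C2 * (\<Sum>k<K. w q k * level_sum p c k))"
      by (intro sum_mono mean_F)
    also have "\<dots> = V * C2 * (\<Sum>q<Q. \<Sum>k<K. w q k * level_sum p c k)" by (simp only: sum_distrib_left)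
    also have "(\<Sum>q<Q. \<Sum>k<K. w q k * level_sum p c k) = (\<Sum>k<K. \<Sum>q<Q. w q k * level_sum p c k)" by (rule sum.swap)
    also have "\<dots> = (\<Sum>k<K. (\<Sum>q<Q. w q k) * level_sum p c k)" by (simp only: sum_distrib_right)
    also have "\<dots> \<le> (\<Sum>k<K. (A1 + A2) * level_sum p c k)" by (intro sum_mono mult_right_mono w_sum) simp
    also have "\<dots> = (A1 + A2) * (\<Sum>k<K. level_sum p c k)" by (simp only: sum_distrib_left)
    also have "\<dots> \<le> (A1 + A2) * (\<Sum>k. level_sum p c k)"
      using w_sum[of 0 0] by (intro mult_left_mono sum_le_suminf c) auto
    finally show ?thesis using V C2 by (simp add: X_def mult_left_mono)
  qed
  obtain f r where f: "f \<in> bergman_space p" "strict_mono (r :: nat \<Rightarrow> nat)"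
    "\<And>z. z \<in> ball 0 1 \<Longrightarrow> (\<lambda>n. F (r n) z) \<longlonglongrightarrow> f z"
    using bergman_subsequence[of p F X, OF p hF bound] by blast
  have "f (pt k l) = c (pt k l)" if l: "l < 2 ^ k" for k l
  proof (rule LIMSEQ_unique[OF f(3)])
    have "eventually (\<lambda>n. F (r n) (pt k l) = c (pt k l)) sequentially"
      using eventually_gt_at_top[of k]
    proof eventually_elim
      case (elim n)
      then show ?case using seq_suble[OF f(2), of n] l by (intro F_pt) auto
    qed
    then show "(\<lambda>n. F (r n) (pt k l)) \<longlonglongrightarrow> c (pt k l)" by (rule tendsto_eventually)
  qed simp
  then show ?thesis using that f(1) by blast
qed

section \<open>The measure\<close>


text \<open>\<open>pt k l\<close> is periodic in \<open>l\<close>, so the pairs with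
  \<open>l \<ge> 2 ^ k\<close> get weight 0; otherwise each point would be counted infinitely
  often.\<close>

definition point_weight :: "nat \<times> nat \<Rightarrow> ennreal" where
  "point_weight = (\<lambda>(k, l). if l < 2 ^ k then ennreal (1 / 4 ^ k) else 0)"

definition point_measure :: "complex measure" where
  "point_measure = distr (density (count_space UNIV) point_weight) (restrict_space borel (ball 0 1)) (\<lambda>(k, l). pt k l)"

lemma sets_point_measure: "sets point_measure = sets (restrict_space borel (ball 0 1))"
  by (simp add: point_measure_def)

lemma measurable_pt: "(\<lambda>(k, l). pt k l) \<in> measurable (density (count_space UNIV) point_weight) (restrict_space borel (ball 0 1))"
proof -
  have "(\<lambda>(k, l). pt k l) \<in> measurable (count_space UNIV) (restrict_space borel (ball 0 1))"
    by (auto simp: measurable_count_space_eq1 space_restrict_space)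
  then show ?thesis by (simp cong: measurable_cong_sets)
qed

lemma nn_integral_point_measure:
  assumes "g \<in> borel_measurable (restrict_space borel (ball 0 1))"
  shows "(\<integral>\<^sup>+z. g z \<partial>point_measure) = (\<Sum>k. \<Sum>l<2 ^ k. ennreal (1 / 4 ^ k) * g (pt k l))"
proof -
  have "(\<integral>\<^sup>+z. g z \<partial>point_measure) = (\<integral>\<^sup>+x. g ((\<lambda>(k, l). pt k l) x) \<partial>density (count_space UNIV) point_weight)"
    unfolding point_measure_def using assms by (intro nn_integral_distr measurable_pt) auto
  also have "\<dots> = (\<integral>\<^sup>+x. point_weight x * g ((\<lambda>(k, l). pt k l) x) \<partial>count_space UNIV)"
    by (rule nn_integral_density) auto
  also have "\<dots> = (\<integral>\<^sup>+k. \<integral>\<^sup>+l. point_weight (k, l) * g (pt k l) \<partial>count_space UNIV \<partial>count_space UNIV)"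
    by (subst nn_integral_fst_count_space[symmetric]) simp
  also have "\<dots> = (\<Sum>k. \<integral>\<^sup>+l. point_weight (k, l) * g (pt k l) \<partial>count_space UNIV)"
    by (rule nn_integral_count_space_nat)
  also have "\<dots> = (\<Sum>k. \<Sum>l<2 ^ k. ennreal (1 / 4 ^ k) * g (pt k l))"
  proof (rule arg_cong[where f=suminf], rule ext)
    fix k
    have "(\<integral>\<^sup>+l. point_weight (k, l) * g (pt k l) \<partial>count_space UNIV) = (\<Sum>l. point_weight (k, l) * g (pt k l))"
      by (rule nn_integral_count_space_nat)
    also have "\<dots> = (\<Sum>l<2 ^ k. point_weight (k, l) * g (pt k l))"
      by (rule suminf_finite) (auto simp: point_weight_def)
    also have "\<dots> = (\<Sum>l<2 ^ k. ennreal (1 / 4 ^ k) * g (pt k l))"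
      by (intro sum.cong) (auto simp: point_weight_def)
    finally show "(\<integral>\<^sup>+l. point_weight (k, l) * g (pt k l) \<partial>count_space UNIV) = (\<Sum>l<2 ^ k. ennreal (1 / 4 ^ k) * g (pt k l))" .
  qed
  finally show ?thesis .
qed

lemma nn_integral_norm_powr:
  assumes "f \<in> borel_measurable (restrict_space borel (ball 0 1))"
  shows "(\<integral>\<^sup>+z. ennreal (norm (f z) powr p) \<partial>point_measure) = (\<Sum>k. ennreal (level_sum p f k))"
proof -
  have "(\<lambda>z. ennreal (norm (f z) powr p)) \<in> borel_measurable (restrict_space borel (ball 0 1))"
    using assms by measurable
  then have "(\<integral>\<^sup>+z. ennreal (norm (f z) powr p) \<partial>point_measure) =
      (\<Sum>k. \<Sum>l<2 ^ k. ennreal (1 / 4 ^ k) * ennreal (norm (f (pt k l)) powr p))"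
    by (rule nn_integral_point_measure)
  also have "(\<lambda>k. \<Sum>l<2 ^ k. ennreal (1 / 4 ^ k) * ennreal (norm (f (pt k l)) powr p)) = (\<lambda>k. ennreal (level_sum p f k))"
    by (simp add: level_sum_def sum_divide_distrib flip: ennreal_mult sum_ennreal)
  finally show ?thesis .
qed

lemma measurable_point_measure: "borel_measurable point_measure = borel_measurable (restrict_space borel (ball 0 1))"
  by (intro measurable_cong_sets sets_point_measure refl)

lemma suminf_ennreal_finite_iff:
  assumes "\<And>k. 0 \<le> g k"
  shows "(\<Sum>k. ennreal (g k)) < \<infinity> \<longleftrightarrow> summable g"
proof
  assume "(\<Sum>k. ennreal (g k)) < \<infinity>"
  then show "summable g" using assms by (intro summable_suminf_not_top) auto
next
  assume "summable g"
  then show "(\<Sum>k. ennreal (g k)) < \<infinity>" using assms by (subst suminf_ennreal2) auto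
qed

lemma Lp_fun_point_measure:
  "f \<in> Lp_fun p point_measure \<longleftrightarrow> f \<in> borel_measurable (restrict_space borel (ball 0 1)) \<and> summable (level_sum p f)"
proof -
  have "integrable point_measure (\<lambda>z. norm (f z) powr p) \<longleftrightarrow> summable (level_sum p f)"
    if "f \<in> borel_measurable (restrict_space borel (ball 0 1))"
  proof -
    have m: "(\<lambda>z. norm (f z) powr p) \<in> borel_measurable point_measure"
      using that unfolding measurable_point_measure by measurable
    have "integrable point_measure (\<lambda>z. norm (f z) powr p) \<longleftrightarrow> (\<Sum>k. ennreal (level_sum p f k)) < \<infinity>"
      using m nn_integral_norm_powr[OF that, of p] by (simp add: integrable_iff_bounded)
    then show ?thesis by (simp only: suminf_ennreal_finite_iff[OF level_sum_nonneg])
  qed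
  then show ?thesis by (auto simp: Lp_fun_def measurable_point_measure)
qed

lemma Lp_norm_point_measure:
  assumes "f \<in> Lp_fun p point_measure"
  shows "Lp_norm p point_measure f = (\<Sum>k. level_sum p f k) powr (1 / p)"
proof -
  have f: "f \<in> borel_measurable (restrict_space borel (ball 0 1))" "summable (level_sum p f)"
    using assms by (auto simp: Lp_fun_point_measure)
  have m: "(\<lambda>z. norm (f z) powr p) \<in> borel_measurable point_measure"
    using f(1) unfolding measurable_point_measure by measurable
  have "(\<integral>z. norm (f z) powr p \<partial>point_measure) = enn2real (\<integral>\<^sup>+z. ennreal (norm (f z) powr p) \<partial>point_measure)"
    using m by (intro integral_eq_nn_integral) auto
  also have "\<dots> = enn2real (ennreal (\<Sum>k. level_sum p f k))"
    using f by (simp add: nn_integral_norm_powr suminf_ennreal2)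
  also have "\<dots> = (\<Sum>k. level_sum p f k)" using f by (simp add: suminf_nonneg)
  finally show ?thesis by (simp add: Lp_norm_def)
qed

section \<open>Closed range in terms of values at the points\<close>

definition agree :: "(complex \<Rightarrow> complex) \<Rightarrow> (complex \<Rightarrow> complex) \<Rightarrow> bool" where
  "agree f g \<longleftrightarrow> (\<forall>k l. l < 2 ^ k \<longrightarrow> f (pt k l) = g (pt k l))"

lemma AE_point_measure:
  assumes "f \<in> borel_measurable (restrict_space borel (ball 0 1))" "g \<in> borel_measurable (restrict_space borel (ball 0 1))"
  shows "(AE z in point_measure. f z = g z) \<longleftrightarrow> agree f g"
proof -
  have set: "{z \<in> space (restrict_space borel (ball 0 1)). f z = g z} \<in> sets (restrict_space borel (ball 0 1))"
    using assms by measurable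
  have "(AE z in point_measure. f z = g z) \<longleftrightarrow>
      (AE x in density (count_space UNIV) point_weight. f ((\<lambda>(k, l). pt k l) x) = g ((\<lambda>(k, l). pt k l) x))"
    unfolding point_measure_def by (rule AE_distr_iff[OF measurable_pt set])
  also have "\<dots> \<longleftrightarrow> agree f g"
    by (subst AE_density) (auto simp: AE_count_space point_weight_def agree_def)
  finally show ?thesis .
qed

lemma ae_class_eq_iff:
  assumes "f \<in> borel_measurable (restrict_space borel (ball 0 1))" "g \<in> borel_measurable (restrict_space borel (ball 0 1))"
  shows "ae_class point_measure f = ae_class point_measure g \<longleftrightarrow> agree f g"
proof
  assume "ae_class point_measure f = ae_class point_measure g"
  moreover have "f \<in> ae_class point_measure f" using assms by (simp add: ae_class_def measurable_point_measure)
  ultimately have "f \<in> ae_class point_measure g" by simp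
  then show "agree f g" using assms by (simp add: ae_class_def AE_point_measure)
next
  assume "agree f g"
  then have "AE z in point_measure. f z = g z" using assms by (simp add: AE_point_measure)
  then have "(AE z in point_measure. h z = f z) \<longleftrightarrow> (AE z in point_measure. h z = g z)" for h
    by (auto elim: AE_mp)
  then show "ae_class point_measure f = ae_class point_measure g" by (simp add: ae_class_def)
qed

lemma level_sum_cong: "agree f g \<Longrightarrow> level_sum p f = level_sum p g"
  by (simp add: agree_def level_sum_def fun_eq_iff)

lemma level_sum_add_le:
  assumes "0 < p"
  shows "level_sum p (\<lambda>z. f z + g z) k \<le> 2 powr p * (level_sum p f k + level_sum p g k)"
proof -
  have "(\<Sum>l<2 ^ k. norm (f (pt k l) + g (pt k l)) powr p) \<le>
      (\<Sum>l<2 ^ k. 2 powr p * (norm (f (pt k l)) powr p + norm (g (pt k l)) powr p))"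
  proof (rule sum_mono)
    fix l
    have "norm (f (pt k l) + g (pt k l)) powr p \<le> (norm (f (pt k l)) + norm (g (pt k l))) powr p"
      using assms by (intro powr_mono2 norm_triangle_ineq) auto
    also have "\<dots> \<le> 2 powr p * (norm (f (pt k l)) powr p + norm (g (pt k l)) powr p)"
      using assms by (intro powr_add_le) auto
    finally show "norm (f (pt k l) + g (pt k l)) powr p \<le> \<dots>" .
  qed
  then have "level_sum p (\<lambda>z. f z + g z) k \<le>
      (\<Sum>l<2 ^ k. 2 powr p * (norm (f (pt k l)) powr p + norm (g (pt k l)) powr p)) / 4 ^ k"
    unfolding level_sum_def by (rule divide_right_mono) simp
  then show ?thesis
    by (simp add: level_sum_def sum_distrib_left[symmetric] sum.distrib add_divide_distrib distrib_left)
qed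

lemma level_sum_minus: "level_sum p (\<lambda>z. - f z) = level_sum p f"
  by (simp add: level_sum_def fun_eq_iff)

lemma Lp_fun_diff:
  assumes p: "0 < p" and f: "f \<in> Lp_fun p point_measure" and g: "g \<in> Lp_fun p point_measure"
  shows "(\<lambda>z. f z - g z) \<in> Lp_fun p point_measure"
proof -
  have "summable (level_sum p (\<lambda>z. f z - g z))"
  proof (rule summable_comparison_test'[of "\<lambda>k. 2 powr p * (level_sum p f k + level_sum p g k)" 0])
    show "summable (\<lambda>k. 2 powr p * (level_sum p f k + level_sum p g k))"
      using f g by (intro summable_mult summable_add) (auto simp: Lp_fun_point_measure)
    show "norm (level_sum p (\<lambda>z. f z - g z) k) \<le> 2 powr p * (level_sum p f k + level_sum p g k)" for k
      using level_sum_add_le[OF p, of f "\<lambda>z. - g z" k] by (simp add: level_sum_minus)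
  qed
  moreover have "(\<lambda>z. f z - g z) \<in> borel_measurable (restrict_space borel (ball 0 1))"
    using f g by (auto simp: Lp_fun_point_measure)
  ultimately show ?thesis by (simp add: Lp_fun_point_measure)
qed

lemma bergman_measurable: "f \<in> bergman_space p \<Longrightarrow> f \<in> borel_measurable (restrict_space borel (ball 0 1))"
  by (rule holomorphic_measurable_disk) (simp add: bergman_space_def)

lemma bergman_Lp_fun: "0 < p \<Longrightarrow> f \<in> bergman_space p \<Longrightarrow> f \<in> Lp_fun p point_measure"
  by (simp add: Lp_fun_point_measure bergman_measurable summable_level_sum)

lemma bergman_carleson_point_measure: "bergman_carleson point_measure"
  unfolding bergman_carleson_def using sets_point_measure bergman_Lp_fun by auto

text \<open>Balls of radius \<open>r\<close> correspond to the bound \<open>r powr p\<close> on sums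
  of p-th powers, and equality of classes to agreement at the points. This removes the quotient and
  the topology from the three cases that follow.\<close>

lemma closed_range_iff:
  assumes p: "0 < p"
  shows "p \<in> closed_range_exponents point_measure \<longleftrightarrow>
    (\<forall>f\<in>Lp_fun p point_measure.
      (\<forall>e>0. \<exists>g\<in>bergman_space p. (\<Sum>k. level_sum p (\<lambda>z. g z - f z) k) < e) \<longrightarrow> (\<exists>g\<in>bergman_space p. agree g f))"
    (is "_ \<longleftrightarrow> ?R")
proof -
  let ?M = point_measure
  let ?J = "bergman_embedding ?M ` bergman_space p"
  have sub: "?J \<subseteq> Lp_space p ?M"
    by (rule bergman_embedding_in_Lp_space[OF bergman_carleson_point_measure p])
  have mem: "ae_class ?M f \<in> ?J \<longleftrightarrow> (\<exists>g\<in>bergman_space p. agree g f)" if "f \<in> Lp_fun p ?M" for f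
  proof -
    have "ae_class ?M f = ae_class ?M g \<longleftrightarrow> agree g f" if "g \<in> bergman_space p" for g
      using ae_class_eq_iff[of g f] bergman_measurable[OF that] \<open>f \<in> Lp_fun p ?M\<close>
      by (auto simp: Lp_fun_point_measure)
    then show ?thesis by (auto simp: bergman_embedding_def image_iff)
  qed
  have "p \<in> closed_range_exponents ?M \<longleftrightarrow> Lp_open p ?M (Lp_space p ?M - ?J)"
    using p sub by (simp add: closed_range_exponents_def closedin_def topspace_Lp_topology openin_Lp_topology)
  also have "\<dots> \<longleftrightarrow> (\<forall>f\<in>Lp_fun p ?M. ae_class ?M f \<notin> ?J \<longrightarrow> (\<exists>r>0. Lp_ball p ?M f r \<inter> ?J = {}))"
  proof -
    have "Lp_ball p ?M f r \<subseteq> Lp_space p ?M" for f r unfolding Lp_ball_def Lp_space_def by auto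
    then have "Lp_ball p ?M f r \<subseteq> Lp_space p ?M - ?J \<longleftrightarrow> Lp_ball p ?M f r \<inter> ?J = {}" for f r by blast
    moreover have "ae_class ?M f \<in> Lp_space p ?M" if "f \<in> Lp_fun p ?M" for f using that by (simp add: Lp_space_def)
    ultimately show ?thesis by (simp add: Lp_open_def cong: ball_cong)
  qed
  also have "\<dots> \<longleftrightarrow> ?R"
  proof -
    have "(\<exists>r>0. Lp_ball p ?M f r \<inter> ?J = {}) \<longleftrightarrow>
        (\<exists>e>0. \<forall>g\<in>bergman_space p. e \<le> (\<Sum>k. level_sum p (\<lambda>z. g z - f z) k))" if f: "f \<in> Lp_fun p ?M" for f
    proof -
      have nonneg: "0 \<le> (\<Sum>k. level_sum p (\<lambda>z. g z - f z) k)" if "g \<in> Lp_fun p ?M" for g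
        using Lp_fun_diff[OF p that f] by (intro suminf_nonneg) (auto simp: Lp_fun_point_measure)
      have norm: "Lp_norm p ?M (\<lambda>z. g z - f z) < r \<longleftrightarrow> (\<Sum>k. level_sum p (\<lambda>z. g z - f z) k) < r powr p"
        if g: "g \<in> Lp_fun p ?M" and r: "0 < r" for g r
      proof -
        let ?s = "\<Sum>k. level_sum p (\<lambda>z. g z - f z) k"
        have "Lp_norm p ?M (\<lambda>z. g z - f z) = ?s powr (1 / p)"
          by (rule Lp_norm_point_measure[OF Lp_fun_diff[OF p g f]])
        moreover have "r = (r powr p) powr (1 / p)" using p r by (simp add: powr_powr)
        moreover have "?s powr (1 / p) < (r powr p) powr (1 / p) \<longleftrightarrow> ?s < r powr p"
          using p nonneg[OF g] powr_less_mono2[of "1 / p" ?s "r powr p"] powr_mono2[of "1 / p" "r powr p" ?s]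
          by (cases "?s < r powr p") auto
        ultimately show ?thesis by metis
      qed
      have disj: "Lp_ball p ?M f r \<inter> ?J = {} \<longleftrightarrow> (\<forall>g\<in>bergman_space p. r powr p \<le> (\<Sum>k. level_sum p (\<lambda>z. g z - f z) k))"
        if r: "0 < r" for r
      proof
        assume d: "Lp_ball p ?M f r \<inter> ?J = {}"
        show "\<forall>g\<in>bergman_space p. r powr p \<le> (\<Sum>k. level_sum p (\<lambda>z. g z - f z) k)"
        proof (rule ballI, rule ccontr)
          fix g assume g: "g \<in> bergman_space p" "\<not> r powr p \<le> (\<Sum>k. level_sum p (\<lambda>z. g z - f z) k)"
          then have "ae_class ?M g \<in> Lp_ball p ?M f r"
            using norm[OF bergman_Lp_fun[OF p g(1)] r] bergman_Lp_fun[OF p g(1)] by (auto simp: Lp_ball_def)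
          then show False using d g(1) by (auto simp: bergman_embedding_def)
        qed
      next
        assume le: "\<forall>g\<in>bergman_space p. r powr p \<le> (\<Sum>k. level_sum p (\<lambda>z. g z - f z) k)"
        have False if h: "h \<in> Lp_fun p ?M" "Lp_norm p ?M (\<lambda>z. h z - f z) < r" and J: "ae_class ?M h \<in> ?J" for h
        proof -
          obtain g where g: "g \<in> bergman_space p" "agree g h" using J mem[OF h(1)] by auto
          then have "level_sum p (\<lambda>z. g z - f z) = level_sum p (\<lambda>z. h z - f z)"
            by (intro level_sum_cong) (auto simp: agree_def)
          then show False using le g(1) norm[OF h(1) r] h(2) by (metis not_less)
        qed
        then show "Lp_ball p ?M f r \<inter> ?J = {}" by (auto simp: Lp_ball_def)
      qed
      show ?thesis
      proof
        assume "\<exists>r>0. Lp_ball p ?M f r \<inter> ?J = {}"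
        then obtain r where "0 < r" "Lp_ball p ?M f r \<inter> ?J = {}" by blast
        then show "\<exists>e>0. \<forall>g\<in>bergman_space p. e \<le> (\<Sum>k. level_sum p (\<lambda>z. g z - f z) k)"
          using disj by (intro exI[of _ "r powr p"]) auto
      next
        assume "\<exists>e>0. \<forall>g\<in>bergman_space p. e \<le> (\<Sum>k. level_sum p (\<lambda>z. g z - f z) k)"
        then obtain e where e: "0 < e" "\<forall>g\<in>bergman_space p. e \<le> (\<Sum>k. level_sum p (\<lambda>z. g z - f z) k)" by blast
        have "(e powr (1 / p)) powr p = e" using p e by (simp add: powr_powr)
        then show "\<exists>r>0. Lp_ball p ?M f r \<inter> ?J = {}"
          using disj[of "e powr (1 / p)"] e by (intro exI[of _ "e powr (1 / p)"]) auto
      qed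
    qed
    then have "(ae_class ?M f \<notin> ?J \<longrightarrow> (\<exists>r>0. Lp_ball p ?M f r \<inter> ?J = {})) \<longleftrightarrow>
        ((\<forall>e>0. \<exists>g\<in>bergman_space p. (\<Sum>k. level_sum p (\<lambda>z. g z - f z) k) < e) \<longrightarrow> (\<exists>g\<in>bergman_space p. agree g f))"
      if "f \<in> Lp_fun p ?M" for f
      using that unfolding mem[OF that] by (meson not_le)
    then show ?thesis by blast
  qed
  finally show ?thesis .
qed

text \<open>The sampling inequality makes approximants from the Bergman space bounded there,
  although their convergence is known only at the points; a normal-family limit then has the right
  values.\<close>

lemma closed_range_above:
  assumes p: "0 < p" and ap: "a powr p < 1 / 2"
  shows "p \<in> closed_range_exponents point_measure"
  unfolding closed_range_iff[OF p]
proof (intro ballI impI)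
  fix f assume f: "f \<in> Lp_fun p point_measure"
    and approx: "\<forall>e>0. \<exists>g\<in>bergman_space p. (\<Sum>k. level_sum p (\<lambda>z. g z - f z) k) < e"
  obtain C where C: "0 < C" "\<And>f Q. f \<in> bergman_space p \<Longrightarrow>
    (\<Sum>q<Q. mean p f q / 2 ^ q) \<le> C * (\<Sum>k. level_sum p f k)"
    using sampling[OF p ap] by blast
  have "\<exists>g\<in>bergman_space p. (\<Sum>k. level_sum p (\<lambda>z. g z - f z) k) < inverse (real (Suc n))" for n
    using approx by simp
  then obtain G where G: "\<And>n. G n \<in> bergman_space p"
    "\<And>n. (\<Sum>k. level_sum p (\<lambda>z. G n z - f z) k) < inverse (real (Suc n))" by metis
  have sd: "summable (level_sum p (\<lambda>z. G n z - f z))" for n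
    using Lp_fun_diff[OF p bergman_Lp_fun[OF p G(1)] f] by (simp add: Lp_fun_point_measure)
  have sf: "summable (level_sum p f)" using f by (simp add: Lp_fun_point_measure)
  have "(\<Sum>q<Q. mean p (G n) q / 2 ^ q) \<le> C * (2 powr p * (1 + (\<Sum>k. level_sum p f k)))" for n Q
  proof -
    have "(\<Sum>k. level_sum p (G n) k) \<le> (\<Sum>k. 2 powr p * (level_sum p (\<lambda>z. G n z - f z) k + level_sum p f k))"
      using level_sum_add_le[OF p, of "\<lambda>z. G n z - f z" f]
      by (intro suminf_le summable_level_sum[OF p G(1)] summable_mult summable_add sd sf) simp
    also have "\<dots> = 2 powr p * ((\<Sum>k. level_sum p (\<lambda>z. G n z - f z) k) + (\<Sum>k. level_sum p f k))"
      by (subst suminf_mult) (auto intro!: summable_add sd sf simp: suminf_add[OF sd sf])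
    also have "\<dots> \<le> 2 powr p * (1 + (\<Sum>k. level_sum p f k))"
    proof (intro mult_left_mono add_right_mono)
      have "inverse (real (Suc n)) \<le> 1" by (simp add: field_simps)
      then show "(\<Sum>k. level_sum p (\<lambda>z. G n z - f z) k) \<le> 1" using G(2)[of n] by linarith
    qed simp
    finally show ?thesis using C(2)[OF G(1)[of n], of Q] C(1) by (meson mult_left_mono order_trans less_imp_le)
  qed
  moreover have hG: "G n holomorphic_on ball 0 1" for n using G(1)[of n] by (simp add: bergman_space_def)
  ultimately obtain g r where g: "g \<in> bergman_space p" "strict_mono (r :: nat \<Rightarrow> nat)"
    "\<And>z. z \<in> ball 0 1 \<Longrightarrow> (\<lambda>n. G (r n) z) \<longlonglongrightarrow> g z"
    using bergman_subsequence[of p G "C * (2 powr p * (1 + (\<Sum>k. level_sum p f k)))"] p by blast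
  have "g (pt k l) = f (pt k l)" if l: "l < 2 ^ k" for k l
  proof (rule LIMSEQ_unique[OF g(3)])
    have "norm (G n (pt k l) - f (pt k l)) powr p \<le> 4 ^ k * inverse (real (Suc n))" for n
    proof -
      have "norm (G n (pt k l) - f (pt k l)) powr p \<le> (\<Sum>l<2 ^ k. norm (G n (pt k l) - f (pt k l)) powr p)"
        using l by (intro member_le_sum) auto
      also have "\<dots> = 4 ^ k * level_sum p (\<lambda>z. G n z - f z) k" by (simp add: level_sum_def)
      also have "level_sum p (\<lambda>z. G n z - f z) k = (\<Sum>k\<in>{k}. level_sum p (\<lambda>z. G n z - f z) k)" by simp
      also have "\<dots> \<le> (\<Sum>k. level_sum p (\<lambda>z. G n z - f z) k)" by (intro sum_le_suminf sd) auto
      also have "\<dots> \<le> inverse (real (Suc n))" using G(2)[of n] by simp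
      finally show ?thesis by simp
    qed
    then have le: "norm (norm (G n (pt k l) - f (pt k l)) powr p) \<le> 4 ^ k * inverse (real (Suc n))" for n
      by simp
    have "(\<lambda>n. 4 ^ k * inverse (real (Suc n))) \<longlonglongrightarrow> 0"
      by (intro tendsto_mult_right_zero LIMSEQ_inverse_real_of_nat)
    then have lim: "(\<lambda>n. norm (G n (pt k l) - f (pt k l)) powr p) \<longlonglongrightarrow> 0"
      by (rule Lim_null_comparison[OF always_eventually[OF allI[OF le]]])
    have "(\<lambda>n. (norm (G n (pt k l) - f (pt k l)) powr p) powr (1 / p)) \<longlonglongrightarrow> 0"
      by (rule tendsto_zero_powrI[OF lim tendsto_const]) (use p in auto)
    then have "(\<lambda>n. G n (pt k l) - f (pt k l)) \<longlonglongrightarrow> 0"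
      using p by (subst tendsto_norm_zero_iff[symmetric]) (simp add: powr_powr)
    then have "(\<lambda>n. G n (pt k l)) \<longlonglongrightarrow> f (pt k l)" by (simp add: LIM_zero_iff)
    then show "(\<lambda>n. G (r n) (pt k l)) \<longlonglongrightarrow> f (pt k l)"
      using LIMSEQ_subseq_LIMSEQ[OF _ g(2)] by (auto simp: o_def)
  qed simp
  then show "\<exists>g\<in>bergman_space p. agree g f" using g(1) by (auto simp: agree_def)
qed

lemma closed_range_below:
  assumes p: "0 < p" and ap: "1 / 2 < a powr p"
  shows "p \<in> closed_range_exponents point_measure"
  unfolding closed_range_iff[OF p]
proof (intro ballI impI)
  fix f assume "f \<in> Lp_fun p point_measure"
  then have "summable (level_sum p f)" by (simp add: Lp_fun_point_measure)
  then show "\<exists>g\<in>bergman_space p. agree g f"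
    using interpolation[OF p ap] unfolding agree_def by metis
qed

end

section \<open>The critical exponent\<close>

locale critical_exponent = dyadic_circles +
  fixes p :: real
  assumes p_pos: "0 < p" and crit: "a powr p = 1 / 2"
begin

text \<open>Chosen so that \<open>tail n powr p\<close> is \<open>1 / (n + 1)\<close>, a divergent
  series, while the p-th powers of the differences \<open>coef\<close> are summable.\<close>

definition tail :: "nat \<Rightarrow> real" where
  "tail n = (real n + 1) powr (- 1 / p)"

definition coef :: "nat \<Rightarrow> real" where
  "coef n = tail n - tail (Suc n)"

lemma tail_pos: "0 < tail n"
  by (simp add: tail_def)

lemma tail_powr: "tail n powr p = 1 / (real n + 1)"
proof -
  have "tail n powr p = (real n + 1) powr (- 1 / p * p)" by (simp only: tail_def powr_powr)
  also have "- 1 / p * p = - 1" using p_pos by simp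
  finally show ?thesis by (simp add: powr_minus_divide)
qed

lemma coef_nonneg: "0 \<le> coef n"
  unfolding coef_def tail_def using p_pos by (simp add: powr_mono2')

lemma tail_tendsto_0: "tail \<longlonglongrightarrow> 0"
  unfolding tail_def
  by (rule tendsto_neg_powr)
     (use p_pos in \<open>auto intro!: filterlim_tendsto_add_at_top[OF tendsto_const] filterlim_real_sequentially simp: add.commute\<close>)

lemma coef_sums: "(\<lambda>n. coef (n + k)) sums tail k"
proof -
  have "(\<lambda>n. tail (n + k) - tail (Suc n + k)) sums (tail (0 + k) - 0)"
    by (rule telescope_sums'[of "\<lambda>n. tail (n + k)"]) (rule LIMSEQ_ignore_initial_segment[OF tail_tendsto_0])
  then show ?thesis by (simp add: coef_def)
qed

text \<open>The tangent-line bound for the exponential shows that \<open>coef n\<close> is at most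
  \<open>(1 / p) * (n + 1) powr (- 1 / p - 1)\<close>, the size of a derivative; its p-th power has
  exponent \<open>- 1 - p\<close>.\<close>

lemma summable_coef_powr: "summable (\<lambda>n. coef n powr p)"
proof -
  have le: "coef n \<le> (1 / p) * (real n + 1) powr (- 1 / p - 1)" for n
  proof -
    define x where "x = real n + 1"
    have x: "0 < x" by (simp add: x_def)
    have "1 - (1 / p) * (1 / x) \<le> exp (- (1 / p) * (1 / x))"
      using exp_ge_add_one_self[of "- (1 / p) * (1 / x)"] by simp
    also have "\<dots> \<le> exp (- (1 / p) * ln (1 + 1 / x))"
      using p_pos x ln_add_one_self_le_self[of "1 / x"] by (simp add: field_simps)
    also have "\<dots> = (1 + 1 / x) powr (- 1 / p)"
    proof -
      have "0 < 1 + 1 / x" using x by (simp add: add_pos_pos)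
      then show ?thesis by (simp add: powr_def less_imp_neq[THEN not_sym])
    qed
    finally have "x powr (- 1 / p) * (1 - (1 / p) * (1 / x)) \<le> x powr (- 1 / p) * (1 + 1 / x) powr (- 1 / p)"
      by (intro mult_left_mono) auto
    also have "x powr (- 1 / p) * (1 + 1 / x) powr (- 1 / p) = (x * (1 + 1 / x)) powr (- 1 / p)"
      by (rule powr_mult[symmetric])
    also have "x * (1 + 1 / x) = x + 1" using x by (simp add: field_simps)
    finally have "x powr (- 1 / p) - (x + 1) powr (- 1 / p) \<le> (1 / p) * (x powr (- 1 / p) / x)"
      by (simp add: algebra_simps)
    also have "x powr (- 1 / p) / x = x powr (- 1 / p - 1)" using x by (simp add: powr_diff)
    finally show ?thesis by (simp add: coef_def tail_def x_def add_ac)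
  qed
  have le': "norm (coef n powr p) \<le> (1 / p) powr p * real (Suc n) powr (- 1 - p)" for n
  proof -
    have "coef n powr p \<le> ((1 / p) * (real n + 1) powr (- 1 / p - 1)) powr p"
      using p_pos le coef_nonneg by (intro powr_mono2) auto
    also have "\<dots> = (1 / p) powr p * (real n + 1) powr ((- 1 / p - 1) * p)"
      by (simp only: powr_mult powr_powr)
    also have "(- 1 / p - 1) * p = - 1 - p" using p_pos by (simp add: field_simps)
    finally show ?thesis by (simp add: add.commute)
  qed
  have "summable (\<lambda>n. (1 / p) powr p * real (Suc n) powr (- 1 - p))"
    using p_pos summable_real_powr_iff[of "- 1 - p"]
    by (intro summable_mult) (subst summable_Suc_iff, simp)
  then show ?thesis
    by (rule summable_comparison_test'[of _ 0]) (rule le')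
qed

text \<open>At the critical exponent \<open>((1 / a) ^ n) powr p\<close> is exactly
  \<open>2 ^ n\<close>, so against the weight \<open>1 / 2 ^ q\<close> a loss base \<open>b\<close>
  leaves the ratio \<open>b / 2\<close> per level.\<close>

lemma sum_growth_le:
  obtains C where "0 < C" "\<And>\<gamma> Q. (\<And>n. 0 \<le> \<gamma> n) \<Longrightarrow>
    (\<Sum>q<Q. (\<Sum>n\<le>q. \<gamma> n * (1 / a) ^ n) powr p / 2 ^ q) \<le> C * (\<Sum>n<Q. \<gamma> n powr p)"
proof -
  \<comment> \<open>Any base strictly between 1 and 2 would do; 3/2 gives the ratio 3/4, whose
    geometric series has sum 4.\<close>
  obtain V where V: "0 < V" "\<And>q (I :: nat set) x. finite I \<Longrightarrow> (\<And>k. k \<in> I \<Longrightarrow> 0 \<le> x k) \<Longrightarrow>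
    (\<Sum>k\<in>I. x k) powr p \<le> V * (\<Sum>k\<in>I. (3 / 2) ^ level_dist q k * x k powr p)"
    using powr_sum_le_level_dist[OF p_pos, of "3 / 2"] by auto
  show ?thesis
  proof (rule that[of "V * 4"])
    show "0 < V * 4" using V by simp
    fix \<gamma> :: "nat \<Rightarrow> real" and Q assume \<gamma>: "\<And>n. 0 \<le> \<gamma> n"
    have pw: "((1 / a) ^ n) powr p = 2 ^ n" for n
    proof -
      have "((1 / a) ^ n) powr p = (1 / a powr p) ^ n"
        using a_pos by (simp add: powr_realpow[symmetric] powr_powr powr_divide mult.commute)
      then show ?thesis by (simp add: crit)
    qed
    have step: "(\<Sum>n\<le>q. \<gamma> n * (1 / a) ^ n) powr p / 2 ^ q \<le> V * (\<Sum>n\<le>q. \<gamma> n powr p * (3 / 4) ^ (q - n))" for q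
    proof -
      have "(\<Sum>n\<le>q. \<gamma> n * (1 / a) ^ n) powr p \<le> V * (\<Sum>n\<le>q. (3 / 2) ^ level_dist q n * (\<gamma> n * (1 / a) ^ n) powr p)"
        using \<gamma> a_pos by (intro V(2)) auto
      then have "(\<Sum>n\<le>q. \<gamma> n * (1 / a) ^ n) powr p / 2 ^ q \<le>
          V * (\<Sum>n\<le>q. (3 / 2) ^ level_dist q n * (\<gamma> n * (1 / a) ^ n) powr p) / 2 ^ q"
        by (rule divide_right_mono) simp
      also have "\<dots> = V * (\<Sum>n\<le>q. (3 / 2) ^ level_dist q n * (\<gamma> n * (1 / a) ^ n) powr p / 2 ^ q)"
        by (simp only: sum_divide_distrib[symmetric] times_divide_eq_right)
      also have "(\<Sum>n\<le>q. (3 / 2) ^ level_dist q n * (\<gamma> n * (1 / a) ^ n) powr p / 2 ^ q) =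
          (\<Sum>n\<le>q. \<gamma> n powr p * (3 / 4) ^ (q - n))"
      proof (intro sum.cong refl)
        fix n assume n: "n \<in> {..q}"
        have 1: "(2::real) ^ n / 2 ^ q = (1 / 2) ^ (q - n)" using n by (simp add: power_diff power_one_over)
        have "(3 / 2 :: real) ^ level_dist q n * (\<gamma> n * (1 / a) ^ n) powr p / 2 ^ q =
            \<gamma> n powr p * ((3 / 2) ^ (q - n) * (2 ^ n / 2 ^ q))"
          using n by (simp add: powr_mult pw level_dist_def)
        also have "(3 / 2 :: real) ^ (q - n) * (2 ^ n / 2 ^ q) = (3 / 2 * (1 / 2)) ^ (q - n)"
          unfolding 1 by (simp only: power_mult_distrib)
        finally show "(3 / 2) ^ level_dist q n * (\<gamma> n * (1 / a) ^ n) powr p / 2 ^ q = \<gamma> n powr p * (3 / 4) ^ (q - n)"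
          by simp
      qed
      finally show ?thesis .
    qed
    have "(\<Sum>q<Q. (\<Sum>n\<le>q. \<gamma> n * (1 / a) ^ n) powr p / 2 ^ q) \<le> (\<Sum>q<Q. V * (\<Sum>n\<le>q. \<gamma> n powr p * (3 / 4) ^ (q - n)))"
      by (intro sum_mono step)
    also have "\<dots> = V * (\<Sum>q<Q. \<Sum>n\<le>q. \<gamma> n powr p * (3 / 4) ^ (q - n))" by (simp only: sum_distrib_left)
    also have "(\<Sum>q<Q. \<Sum>n\<le>q. \<gamma> n powr p * (3 / 4) ^ (q - n)) = (\<Sum>n<Q. \<Sum>q\<in>{n..<Q}. \<gamma> n powr p * (3 / 4) ^ (q - n))"
      unfolding sum.Sigma[OF finite_lessThan ballI[OF finite_atMost]] sum.Sigma[OF finite_lessThan ballI[OF finite_atLeastLessThan]]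
      by (rule sum.reindex_bij_witness[of _ prod.swap prod.swap]) auto
    also have "\<dots> \<le> (\<Sum>n<Q. \<gamma> n powr p * 4)"
    proof (intro sum_mono)
      fix n assume "n \<in> {..<Q}"
      have "(\<Sum>q\<in>{n..<Q}. (3 / 4 :: real) ^ (q - n)) = (\<Sum>d\<in>(\<lambda>q. q - n) ` {n..<Q}. (3 / 4) ^ d)"
        by (subst sum.reindex) (auto simp: inj_on_def)
      also have "\<dots> \<le> (\<Sum>d. (3 / 4) ^ d)" by (intro sum_le_suminf summable_geometric) auto
      also have "\<dots> = 4" by (simp add: suminf_geometric)
      finally show "(\<Sum>q\<in>{n..<Q}. \<gamma> n powr p * (3 / 4) ^ (q - n)) \<le> \<gamma> n powr p * 4"
        unfolding sum_distrib_left[symmetric] by (intro mult_left_mono) auto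
    qed
    finally show "(\<Sum>q<Q. (\<Sum>n\<le>q. \<gamma> n * (1 / a) ^ n) powr p / 2 ^ q) \<le> V * 4 * (\<Sum>n<Q. \<gamma> n powr p)"
      using V(1) by (simp add: mult_left_mono mult_right_mono sum_distrib_left mult_ac)
  qed
qed

section \<open>The critical function and its partial sums\<close>

definition crit_partial :: "nat \<Rightarrow> complex \<Rightarrow> complex" where
  "crit_partial N z = (\<Sum>n<N. of_real (coef n) * level_prod {..<n} z)"

text \<open>At a point of level \<open>q\<close> all terms with \<open>n > q\<close> vanish, and at
  0 all products are 1, so the remainder after \<open>k\<close> terms has the value
  \<open>tail k\<close> there. The first fact keeps the values at the points small, the second
  forces growth of the function.\<close>

definition crit_fun :: "complex \<Rightarrow> complex" where
  "crit_fun z = (\<Sum>n. of_real (coef n) * level_prod {..<n} z)"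

lemma crit_partial_holomorphic: "crit_partial N holomorphic_on ball 0 1"
  unfolding crit_partial_def by (intro holomorphic_intros level_prod_holomorphic)

lemma norm_crit_term_le:
  assumes "norm z \<le> rad q"
  shows "norm (of_real (coef n) * level_prod {..<n} z) \<le> coef n * ((1 / a) ^ q * tail_const)"
  using norm_level_prod_le_split[OF assms, of 0 "{..<n}"] coef_nonneg[of n]
  by (simp add: norm_mult mult_left_mono)

lemma summable_crit_bound: "summable (\<lambda>n. coef (n + k) * ((1 / a) ^ q * tail_const))"
  using coef_sums[of k] by (intro summable_mult2) (auto simp: sums_iff)

lemma crit_fun_holomorphic: "crit_fun holomorphic_on ball 0 1"
proof (rule holomorphic_uniform_sequence[of _ crit_partial])
  fix x :: complex assume "x \<in> ball 0 1"
  then obtain q where q: "norm x < rad q" using ex_less_rad by auto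
  show "\<exists>d>0. cball x d \<subseteq> ball 0 1 \<and> uniform_limit (cball x d) crit_partial crit_fun sequentially"
  proof (intro exI[of _ "rad q - norm x"] conjI)
    have sub: "norm z \<le> rad q" if "z \<in> cball x (rad q - norm x)" for z
      using that norm_triangle_ineq2[of z x] by (auto simp: dist_norm norm_minus_commute)
    then show "cball x (rad q - norm x) \<subseteq> ball 0 1"
      using rad_lt_1[of q] by (fastforce simp del: rad_lt_1)
    show "uniform_limit (cball x (rad q - norm x)) crit_partial crit_fun sequentially"
      unfolding crit_partial_def[abs_def] crit_fun_def[abs_def]
      by (rule Weierstrass_m_test[where M="\<lambda>n. coef n * ((1 / a) ^ q * tail_const)"])
         (use norm_crit_term_le sub summable_crit_bound[of 0] in auto)
  qed (use q in simp)
qed (auto simp: crit_partial_holomorphic)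

lemma summable_crit_terms:
  assumes "norm z \<le> rad q"
  shows "summable (\<lambda>n. of_real (coef n) * level_prod {..<n} z)"
  by (rule summable_comparison_test'[of "\<lambda>n. coef n * ((1 / a) ^ q * tail_const)" 0])
     (use norm_crit_term_le[OF assms] summable_crit_bound[of 0 q] in auto)

lemma norm_crit_fun_diff_le:
  assumes "norm z \<le> rad q"
  shows "norm (crit_fun z - crit_partial k z) \<le> tail k * ((1 / a) ^ q * tail_const)"
proof -
  have "crit_fun z - crit_partial k z = (\<Sum>n. of_real (coef (n + k)) * level_prod {..<n + k} z)"
    unfolding crit_fun_def crit_partial_def by (rule suminf_minus_initial_segment[symmetric, OF summable_crit_terms[OF assms]])
  also have "norm \<dots> \<le> (\<Sum>n. coef (n + k) * ((1 / a) ^ q * tail_const))"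
    by (rule norm_suminf_le)
       (use summable_crit_bound norm_crit_term_le[OF assms] in auto)
  also have "\<dots> = tail k * ((1 / a) ^ q * tail_const)"
    using coef_sums[of k] by (subst suminf_mult2[symmetric]) (auto simp: sums_iff)
  finally show ?thesis .
qed

lemma crit_fun_pt:
  assumes "q < k" shows "crit_fun (pt q l) = crit_partial k (pt q l)"
  unfolding crit_fun_def crit_partial_def
proof (rule suminf_finite)
  fix n assume "n \<notin> {..<k}"
  then have "level_prod {..<n} (pt q l) = 0" using assms by (intro level_prod_pt_eq_0) auto
  then show "of_real (coef n) * level_prod {..<n} (pt q l) = 0" by simp
qed simp

lemma norm_crit_partial_le:
  assumes "norm z < 1"
  shows "norm (crit_partial (Suc q) z) \<le> (\<Sum>n\<le>q. coef n * (1 / a) ^ n)"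
  unfolding crit_partial_def lessThan_Suc_atMost
proof (rule sum_norm_le)
  fix n
  show "norm (of_real (coef n) * level_prod {..<n} z) \<le> coef n * (1 / a) ^ n"
    using norm_level_prod_le[OF assms, of "{..<n}"] coef_nonneg[of n] by (simp add: norm_mult mult_left_mono)
qed

lemma circle_sphere_continuous:
  "g holomorphic_on ball 0 1 \<Longrightarrow> continuous_on (sphere 0 (norm (complex_of_real (rad q)))) g"
  by (intro holomorphic_continuous_on_sphere) auto

lemma circle_mean_le_const:
  assumes "g holomorphic_on ball 0 1" "\<And>z. norm z = rad q \<Longrightarrow> norm (g z) \<le> B" "0 \<le> B"
  shows "mean p g q \<le> B powr p"
proof -
  have "mean p g q \<le> B powr p * circle_mean p (\<lambda>_. 1) (complex_of_real (rad q))"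
    unfolding mean_def using assms p_pos
    by (intro circle_mean_le_scale circle_sphere_continuous continuous_on_const) auto
  then show ?thesis by (simp add: circle_mean_def)
qed

text \<open>The truncation moves with the circle: on circle \<open>q\<close> the bound
  \<open>(1 / a) ^ n\<close> has the right order for \<open>n \<le> q\<close> only, and the terms
  beyond are treated separately through \<open>tail\<close>.\<close>

lemma summable_mean_crit_partial: "summable (\<lambda>q. mean p (crit_partial (Suc q)) q / 2 ^ q)"
proof -
  obtain C where C: "0 < C" "\<And>\<gamma> Q. (\<And>n. 0 \<le> \<gamma> n) \<Longrightarrow>
    (\<Sum>q<Q. (\<Sum>n\<le>q. \<gamma> n * (1 / a) ^ n) powr p / 2 ^ q) \<le> C * (\<Sum>n<Q. \<gamma> n powr p)"
    using sum_growth_le by blast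
  have "(\<Sum>q<Q. mean p (crit_partial (Suc q)) q / 2 ^ q) \<le> C * (\<Sum>n. coef n powr p)" for Q
  proof -
    have "(\<Sum>q<Q. mean p (crit_partial (Suc q)) q / 2 ^ q) \<le> (\<Sum>q<Q. (\<Sum>n\<le>q. coef n * (1 / a) ^ n) powr p / 2 ^ q)"
    proof (intro sum_mono divide_right_mono)
      fix q
      show "mean p (crit_partial (Suc q)) q \<le> (\<Sum>n\<le>q. coef n * (1 / a) ^ n) powr p"
        using a_pos coef_nonneg
        by (intro circle_mean_le_const crit_partial_holomorphic norm_crit_partial_le sum_nonneg) auto
    qed simp
    also have "\<dots> \<le> C * (\<Sum>n<Q. coef n powr p)" by (rule C(2)) (rule coef_nonneg)
    also have "\<dots> \<le> C * (\<Sum>n. coef n powr p)"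
      using C(1) by (intro mult_left_mono sum_le_suminf summable_coef_powr) auto
    finally show ?thesis .
  qed
  then show ?thesis by (intro summableI_nonneg_bounded) auto
qed

lemma crit_fun_0: "crit_fun 0 = of_real (tail 0)"
proof -
  have "(\<lambda>n. complex_of_real (coef n)) sums of_real (tail 0)"
    using coef_sums[of 0] by (simp add: sums_of_real_iff)
  then show ?thesis by (simp add: crit_fun_def sums_iff)
qed

lemma crit_partial_0: "crit_partial k 0 = of_real (tail 0 - tail k)"
  by (induction k) (simp_all add: crit_partial_def coef_def)

text \<open>The remainder \<open>D q\<close> vanishes on the levels below \<open>q\<close> and
  equals \<open>tail (Suc q)\<close> at 0, so \<open>mean_decay\<close> forces its mean over circle
  \<open>q\<close>, divided by \<open>2 ^ q\<close>, to be at least of order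
  \<open>tail (Suc q) powr p\<close>, a harmonic sequence. As the means of the partial sums are
  summable, those of \<open>crit_fun\<close> cannot be.\<close>

lemma crit_fun_not_bergman: "crit_fun \<notin> bergman_space p"
proof
  assume "crit_fun \<in> bergman_space p"
  then have s: "summable (\<lambda>q. mean p crit_fun q / 2 ^ q)" by (simp add: bergman_space_iff[OF p_pos])
  obtain C where C: "0 < C" "\<And>f k j. f holomorphic_on ball 0 1 \<Longrightarrow>
    (\<And>i l. k \<le> i \<Longrightarrow> i < k + j \<Longrightarrow> l < 2 ^ i \<Longrightarrow> f (pt i l) = 0) \<Longrightarrow>
    mean p f k \<le> C * (a powr p) ^ j * mean p f (k + j)"
    using mean_decay[OF p_pos] by blast
  define D where "D = (\<lambda>q z. crit_fun z - crit_partial (Suc q) z)"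
  have hD: "D q holomorphic_on ball 0 1" for q
    unfolding D_def by (intro holomorphic_intros crit_fun_holomorphic crit_partial_holomorphic)
  have low: "tail (Suc q) powr p \<le> C * (mean p (D q) q / 2 ^ q)" for q
  proof -
    have "tail (Suc q) powr p = circle_mean p (D q) 0"
      using tail_pos[of "Suc q"] by (simp add: D_def crit_fun_0 crit_partial_0 norm_of_real flip: of_real_diff)
    also have "\<dots> \<le> mean p (D q) 0"
      unfolding mean_def using p_pos a_lt_1 a_pos by (intro circle_mean_norm_mono hD) auto
    also have "\<dots> \<le> C * (a powr p) ^ q * mean p (D q) (0 + q)"
    proof (rule C(2)[OF hD])
      fix i l assume "i < 0 + q"
      then show "D q (pt i l) = 0" using crit_fun_pt[of i "Suc q" l] by (simp add: D_def)
    qed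
    finally show ?thesis by (simp add: crit power_one_over)
  qed
  have "mean p (D q) q / 2 ^ q \<le> 2 powr p * (mean p crit_fun q / 2 ^ q + mean p (crit_partial (Suc q)) q / 2 ^ q)" for q
  proof -
    have "mean p (D q) q \<le> 2 powr p * (mean p crit_fun q + mean p (crit_partial (Suc q)) q)"
      using circle_mean_add_le[OF circle_sphere_continuous[OF crit_fun_holomorphic]
        circle_sphere_continuous[OF holomorphic_on_minus[OF crit_partial_holomorphic]] p_pos, of "Suc q" q]
      by (simp add: mean_def D_def circle_mean_minus)
    then have "mean p (D q) q / 2 ^ q \<le> 2 powr p * (mean p crit_fun q + mean p (crit_partial (Suc q)) q) / 2 ^ q"
      by (rule divide_right_mono) simp
    then show ?thesis by (simp add: add_divide_distrib distrib_left)
  qed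
  then have up: "tail (Suc q) powr p \<le> C * (2 powr p * (mean p crit_fun q / 2 ^ q + mean p (crit_partial (Suc q)) q / 2 ^ q))" for q
    using low[of q] C(1) by (meson mult_left_mono order_trans less_imp_le)
  have "summable (\<lambda>q. C * (2 powr p * (mean p crit_fun q / 2 ^ q + mean p (crit_partial (Suc q)) q / 2 ^ q)))"
    by (intro summable_mult summable_add s summable_mean_crit_partial)
  then have "summable (\<lambda>q. tail (Suc q) powr p)"
    by (rule summable_comparison_test'[of _ 0]) (simp only: real_norm_def abs_of_nonneg[OF powr_ge_zero] up)
  then have "summable (\<lambda>q. 1 / real (Suc (Suc q)))"
    by (simp add: tail_powr add_ac)
  then have "summable (\<lambda>q. 1 / real q)"
    using summable_Suc_iff[of "\<lambda>q. 1 / real (Suc q)"] summable_Suc_iff[of "\<lambda>q. 1 / real q"] by simp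
  then show False using not_summable_harmonic[where 'a = real] by (simp add: inverse_eq_divide)
qed

text \<open>The difference vanishes at every point, and at the critical exponent its decay over
  \<open>j\<close> levels is \<open>1 / 2 ^ j\<close>, just the change of weight. Hence it suffices
  that \<open>mean p D q / 2 ^ q\<close> tends to 0, which can be shown although the corresponding
  terms for \<open>crit_fun\<close> are not summable.\<close>

lemma bergman_unique_crit:
  assumes g: "g \<in> bergman_space p" and eq: "\<And>k l. l < 2 ^ k \<Longrightarrow> g (pt k l) = crit_fun (pt k l)"
    and z: "z \<in> ball 0 1"
  shows "g z = crit_fun z"
proof -
  have hg: "g holomorphic_on ball 0 1" and s: "summable (\<lambda>q. mean p g q / 2 ^ q)"
    using g by (auto simp: bergman_space_iff[OF p_pos])
  obtain C where C: "0 < C" "\<And>f k j. f holomorphic_on ball 0 1 \<Longrightarrow>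
    (\<And>i l. k \<le> i \<Longrightarrow> i < k + j \<Longrightarrow> l < 2 ^ i \<Longrightarrow> f (pt i l) = 0) \<Longrightarrow>
    mean p f k \<le> C * (a powr p) ^ j * mean p f (k + j)"
    using mean_decay[OF p_pos] by blast
  define D where "D = (\<lambda>z. g z - crit_fun z)"
  have hD: "D holomorphic_on ball 0 1"
    unfolding D_def by (intro holomorphic_intros crit_fun_holomorphic hg)
  \<comment> \<open>\<open>R\<close> collects three null sequences: two consist of the terms of
    convergent series, the third comes from the remainder, which is at most of order
    \<open>tail (Suc q) * (1 / a) ^ q\<close> on circle \<open>q\<close>.\<close>
  define R where "R = (\<lambda>q. 2 powr p * (mean p g q / 2 ^ q + 2 powr p * (mean p (crit_partial (Suc q)) q / 2 ^ q + (tail (Suc q) * tail_const) powr p)))"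
  have T: "0 < tail_const" using tail_const_ge_1 by linarith
  have upD: "mean p D q / 2 ^ q \<le> R q" for q
  proof -
    have cs: "continuous_on (sphere 0 (norm (complex_of_real (rad q)))) g" if "g holomorphic_on ball 0 1" for g
      using that by (rule circle_sphere_continuous)
    define E where "E = (\<lambda>z. crit_fun z - crit_partial (Suc q) z)"
    have hE: "E holomorphic_on ball 0 1"
      unfolding E_def by (intro holomorphic_intros crit_fun_holomorphic crit_partial_holomorphic)
    have mE: "mean p E q \<le> (tail (Suc q) * tail_const) powr p * 2 ^ q"
    proof -
      have "mean p E q \<le> (tail (Suc q) * ((1 / a) ^ q * tail_const)) powr p"
        unfolding E_def using tail_pos[of "Suc q"] T a_pos norm_crit_fun_diff_le
        by (intro circle_mean_le_const hE[unfolded E_def]) auto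
      also have "\<dots> = (tail (Suc q) * tail_const) powr p * ((1 / a) ^ q) powr p"
        by (simp add: powr_mult)
      also have "((1 / a) ^ q) powr p = (1 / a powr p) ^ q"
        using a_pos by (simp add: powr_realpow[symmetric] powr_powr powr_divide mult.commute)
      finally show ?thesis by (simp add: crit)
    qed
    have "mean p D q \<le> 2 powr p * (mean p g q + mean p crit_fun q)"
      using circle_mean_add_le[OF cs[OF hg] cs[OF holomorphic_on_minus[OF crit_fun_holomorphic]] p_pos]
      by (simp add: mean_def D_def circle_mean_minus)
    also have "mean p crit_fun q \<le> 2 powr p * (mean p (crit_partial (Suc q)) q + mean p E q)"
      using circle_mean_add_le[OF cs[OF crit_partial_holomorphic[of "Suc q"]] cs[OF hE] p_pos]
      by (simp add: mean_def E_def)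
    also have "mean p E q \<le> (tail (Suc q) * tail_const) powr p * 2 ^ q" by (rule mE)
    finally have "mean p D q \<le> 2 powr p * (mean p g q + 2 powr p * (mean p (crit_partial (Suc q)) q + (tail (Suc q) * tail_const) powr p * 2 ^ q))"
      by simp
    then have "mean p D q / 2 ^ q \<le> 2 powr p * (mean p g q + 2 powr p * (mean p (crit_partial (Suc q)) q + (tail (Suc q) * tail_const) powr p * 2 ^ q)) / 2 ^ q"
      by (rule divide_right_mono) simp
    then show ?thesis by (simp add: R_def field_simps)
  qed
  have R0: "R \<longlonglongrightarrow> 0"
  proof -
    have "(\<lambda>q. (tail (Suc q) * tail_const) powr p) \<longlonglongrightarrow> 0"
    proof (rule tendsto_zero_powrI)
      show "(\<lambda>q. tail (Suc q) * tail_const) \<longlonglongrightarrow> 0"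
        by (intro tendsto_mult_left_zero LIMSEQ_Suc tail_tendsto_0)
    qed (use p_pos T tail_pos in \<open>auto simp: less_imp_le intro!: always_eventually\<close>)
    then have "R \<longlonglongrightarrow> 2 powr p * (0 + 2 powr p * (0 + 0))"
      unfolding R_def
      by (intro tendsto_mult tendsto_add tendsto_const summable_LIMSEQ_zero[OF s]
          summable_LIMSEQ_zero[OF summable_mean_crit_partial])
    then show ?thesis by simp
  qed
  have mean0: "mean p D k = 0" for k
  proof -
    have "mean p D k \<le> C * 2 ^ k * R (j + k)" for j
    proof -
      have "mean p D k \<le> C * (a powr p) ^ j * mean p D (k + j)"
        by (rule C(2)[OF hD]) (simp add: D_def eq)
      also have "\<dots> = C * 2 ^ k * (mean p D (j + k) / 2 ^ (j + k))"
        by (simp add: crit power_add power_one_over add.commute)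
      also have "\<dots> \<le> C * 2 ^ k * R (j + k)" using C(1) by (intro mult_left_mono upD) auto
      finally show ?thesis .
    qed
    moreover have "(\<lambda>j. C * 2 ^ k * R (j + k)) \<longlonglongrightarrow> 0"
      by (intro tendsto_mult_right_zero LIMSEQ_ignore_initial_segment R0)
    ultimately have "mean p D k \<le> 0" by (intro LIMSEQ_le_const[of _ 0]) auto
    then show ?thesis using mean_nonneg[of p D k] by linarith
  qed
  obtain q where q: "norm z < rad q" using z ex_less_rad by auto
  have "norm (D z) powr p \<le> 0"
    using norm_powr_le_mean[OF hD p_pos, of z q] q by (simp add: mean0)
  then show ?thesis by (simp add: D_def)
qed

lemma crit_fun_not_restriction:
  "\<not> (\<exists>g\<in>bergman_space p. \<forall>k l. l < 2 ^ k \<longrightarrow> g (pt k l) = crit_fun (pt k l))"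
proof
  assume "\<exists>g\<in>bergman_space p. \<forall>k l. l < 2 ^ k \<longrightarrow> g (pt k l) = crit_fun (pt k l)"
  then obtain g where g: "g \<in> bergman_space p" "\<And>k l. l < 2 ^ k \<Longrightarrow> g (pt k l) = crit_fun (pt k l)" by blast
  have "g z = crit_fun z" if "z \<in> ball 0 1" for z using bergman_unique_crit[OF g that] .
  then have "mean p g q = mean p crit_fun q" for q
    unfolding mean_def by (intro circle_mean_cong) auto
  then have "crit_fun \<in> bergman_space p"
    using g(1) crit_fun_holomorphic by (simp add: bergman_space_iff[OF p_pos])
  then show False using crit_fun_not_bergman by blast
qed

lemma crit_partial_bergman: "crit_partial k \<in> bergman_space p"
proof -
  define B where "B = (\<Sum>n<k. coef n * (1 / a) ^ n)"
  have B: "0 \<le> B" using a_pos coef_nonneg by (auto simp: B_def intro!: sum_nonneg)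
  have "norm (crit_partial k z) \<le> B" if "norm z < 1" for z
    unfolding crit_partial_def B_def
  proof (rule sum_norm_le)
    fix n
    show "norm (of_real (coef n) * level_prod {..<n} z) \<le> coef n * (1 / a) ^ n"
      using norm_level_prod_le[OF that, of "{..<n}"] coef_nonneg[of n] by (simp add: norm_mult mult_left_mono)
  qed
  then have "mean p (crit_partial k) q \<le> B powr p" for q
    by (intro circle_mean_le_const crit_partial_holomorphic B) auto
  then have le: "mean p (crit_partial k) q / 2 ^ q \<le> B powr p * (1 / 2) ^ q" for q
    by (simp add: power_one_over divide_right_mono)
  have "summable (\<lambda>q. mean p (crit_partial k) q / 2 ^ q)"
    by (rule summable_comparison_test'[of "\<lambda>q. B powr p * (1 / 2) ^ q" 0])
       (auto intro!: summable_mult summable_geometric simp: abs_of_nonneg simp del: power_one_over intro: le)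
  then show ?thesis by (simp add: bergman_space_iff[OF p_pos] crit_partial_holomorphic)
qed

text \<open>On level \<open>q\<close> the difference reduces to the terms with
  \<open>k \<le> n \<le> q\<close>, a finite sum covered by \<open>sum_growth_le\<close> for the
  truncated coefficients \<open>\<gamma>\<close>; the bound is a tail of a convergent
  series.\<close>

lemma level_sum_crit:
  obtains C where "0 < C" "\<And>k Q. (\<Sum>q<Q. level_sum p (\<lambda>z. crit_partial k z - crit_fun z) q) \<le> C * (\<Sum>n. coef (n + k) powr p)"
proof -
  obtain C where C: "0 < C" "\<And>\<gamma> Q. (\<And>n. 0 \<le> \<gamma> n) \<Longrightarrow>
    (\<Sum>q<Q. (\<Sum>n\<le>q. \<gamma> n * (1 / a) ^ n) powr p / 2 ^ q) \<le> C * (\<Sum>n<Q. \<gamma> n powr p)"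
    using sum_growth_le by blast
  show ?thesis
  proof (rule that[OF C(1)])
    fix k Q
    define \<gamma> where "\<gamma> = (\<lambda>n. if n < k then 0 else coef n)"
    have \<gamma>: "0 \<le> \<gamma> n" for n using coef_nonneg by (simp add: \<gamma>_def)
    have "norm (crit_partial k (pt q l) - crit_fun (pt q l)) \<le> (\<Sum>n\<le>q. \<gamma> n * (1 / a) ^ n)" for q l
    proof -
      have "crit_fun (pt q l) - crit_partial k (pt q l) = (\<Sum>n\<le>q. of_real (\<gamma> n) * level_prod {..<n} (pt q l))"
      proof (cases "k \<le> Suc q")
        case True
        have "crit_fun (pt q l) = (\<Sum>n<Suc q. of_real (coef n) * level_prod {..<n} (pt q l))"
          using crit_fun_pt[of q "Suc q" l] by (simp add: crit_partial_def)
        moreover have "crit_partial k (pt q l) = (\<Sum>n<Suc q. if n < k then of_real (coef n) * level_prod {..<n} (pt q l) else 0)"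
          unfolding crit_partial_def using True by (intro sum.mono_neutral_cong_left) auto
        ultimately show ?thesis
          unfolding lessThan_Suc_atMost[symmetric] by (simp only: sum_subtractf[symmetric]) (intro sum.cong refl, auto simp: \<gamma>_def)
      next
        case False
        then show ?thesis using crit_fun_pt[of q k l] by (auto simp: \<gamma>_def intro!: sum.neutral[symmetric])
      qed
      also have "norm \<dots> \<le> (\<Sum>n\<le>q. \<gamma> n * (1 / a) ^ n)"
      proof (rule sum_norm_le)
        fix n
        show "norm (of_real (\<gamma> n) * level_prod {..<n} (pt q l)) \<le> \<gamma> n * (1 / a) ^ n"
          using norm_level_prod_le[of "pt q l" "{..<n}"] \<gamma>[of n] by (simp add: norm_mult mult_left_mono)
      qed
      finally show ?thesis by (simp add: norm_minus_commute)
    qed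
    then have "level_sum p (\<lambda>z. crit_partial k z - crit_fun z) q \<le> (\<Sum>n\<le>q. \<gamma> n * (1 / a) ^ n) powr p / 2 ^ q" for q
    proof -
      assume le: "\<And>q l. norm (crit_partial k (pt q l) - crit_fun (pt q l)) \<le> (\<Sum>n\<le>q. \<gamma> n * (1 / a) ^ n)"
      have "level_sum p (\<lambda>z. crit_partial k z - crit_fun z) q \<le> (\<Sum>l<(2::nat) ^ q. (\<Sum>n\<le>q. \<gamma> n * (1 / a) ^ n) powr p) / 4 ^ q"
        unfolding level_sum_def using p_pos by (intro divide_right_mono sum_mono powr_mono2 le) auto
      then show ?thesis by (simp add: real_of_4_power)
    qed
    then have "(\<Sum>q<Q. level_sum p (\<lambda>z. crit_partial k z - crit_fun z) q) \<le> (\<Sum>q<Q. (\<Sum>n\<le>q. \<gamma> n * (1 / a) ^ n) powr p / 2 ^ q)"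
      by (rule sum_mono)
    also have "\<dots> \<le> C * (\<Sum>n<Q. \<gamma> n powr p)" by (rule C(2)) (rule \<gamma>)
    also have "(\<Sum>n<Q. \<gamma> n powr p) \<le> (\<Sum>n. coef (n + k) powr p)"
    proof -
      have "(\<Sum>n<Q. \<gamma> n powr p) \<le> (\<Sum>n\<in>(\<lambda>n. n + k) ` {..<Q}. coef n powr p)"
      proof -
        have "(\<Sum>n<Q. \<gamma> n powr p) = (\<Sum>n\<in>{k..<Q}. coef n powr p)"
          by (intro sum.mono_neutral_cong_right) (auto simp: \<gamma>_def)
        also have "\<dots> \<le> (\<Sum>n\<in>(\<lambda>n. n + k) ` {..<Q}. coef n powr p)"
        proof (intro sum_mono2 subsetI)
          fix n assume "n \<in> {k..<Q}"
          then have "n = (n - k) + k" "n - k \<in> {..<Q}" by auto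
          then show "n \<in> (\<lambda>n. n + k) ` {..<Q}" by (rule image_eqI)
        qed auto
        finally show ?thesis .
      qed
      also have "\<dots> = (\<Sum>n<Q. coef (n + k) powr p)" by (simp add: sum.reindex)
      also have "\<dots> \<le> (\<Sum>n. coef (n + k) powr p)"
        by (intro sum_le_suminf summable_ignore_initial_segment[OF summable_coef_powr]) auto
      finally show ?thesis .
    qed
    finally show "(\<Sum>q<Q. level_sum p (\<lambda>z. crit_partial k z - crit_fun z) q) \<le> C * (\<Sum>n. coef (n + k) powr p)"
      using C(1) by (simp add: mult_left_mono)
  qed
qed


lemma not_closed_range: "p \<notin> closed_range_exponents point_measure"
proof -
  obtain C where C: "0 < C" "\<And>k Q. (\<Sum>q<Q. level_sum p (\<lambda>z. crit_partial k z - crit_fun z) q) \<le> C * (\<Sum>n. coef (n + k) powr p)"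
    using level_sum_crit by blast
  have s: "summable (level_sum p (\<lambda>z. crit_partial k z - crit_fun z))" for k
    using C(2)[of k] by (intro summableI_nonneg_bounded) auto
  \<comment> \<open>For \<open>k = 0\<close> the partial sum is 0, so the same bound shows that
    \<open>crit_fun\<close> itself represents an element of the target space.\<close>
  have "level_sum p (\<lambda>z. crit_partial 0 z - crit_fun z) = level_sum p crit_fun"
    by (simp add: crit_partial_def level_sum_minus)
  then have "summable (level_sum p crit_fun)" using s[of 0] by simp
  then have f: "crit_fun \<in> Lp_fun p point_measure"
    by (simp add: Lp_fun_point_measure holomorphic_measurable_disk crit_fun_holomorphic)
  have "\<exists>g\<in>bergman_space p. (\<Sum>k. level_sum p (\<lambda>z. g z - crit_fun z) k) < e" if e: "0 < e" for e
  proof -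
    obtain N where N: "\<And>n. N \<le> n \<Longrightarrow> norm (\<Sum>i. coef (i + n) powr p) < e / C"
      using suminf_exist_split[OF _ summable_coef_powr, of "e / C"] e C(1) by auto
    have "(\<Sum>k. level_sum p (\<lambda>z. crit_partial N z - crit_fun z) k) \<le> C * (\<Sum>n. coef (n + N) powr p)"
      by (rule suminf_le_const[OF s C(2)])
    also have "\<dots> < C * (e / C)"
      using N[of N] C(1) by (intro mult_strict_left_mono) auto
    also have "\<dots> = e" using C(1) by simp
    finally show ?thesis using crit_partial_bergman by blast
  qed
  then show ?thesis
    using f crit_fun_not_restriction unfolding closed_range_iff[OF p_pos] agree_def by blast
qed

end

theorem proposition1p4:
  fixes p0 :: real
  assumes "0 < p0"
  shows "\<exists>\<mu>. bergman_carleson \<mu> \<and> closed_range_exponents \<mu> = {0<..} - {p0}"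
proof -
  define a :: real where "a = 2 powr (- 1 / p0)"
  \<comment> \<open>\<open>a powr p\<close> decreases in \<open>p\<close> and equals 1/2 exactly at
    \<open>p0\<close>, which separates the three cases.\<close>
  have a_powr: "a powr p = 2 powr (- (p / p0))" for p by (simp add: a_def powr_powr)
  have half: "1 / 2 = (2::real) powr (- 1)" by (simp add: powr_minus_divide)
  have "a < 2 powr 0" unfolding a_def using assms by (intro powr_less_mono) auto
  then interpret critical_exponent a p0
    using assms a_powr[of p0] by unfold_locales (simp_all add: a_def powr_minus_divide)
  have "p \<in> closed_range_exponents point_measure \<longleftrightarrow> p \<noteq> p0" if p: "0 < p" for p
  proof (cases p p0 rule: linorder_cases)
    case less
    then have "1 / 2 < a powr p"
      unfolding a_powr half using assms by (intro powr_less_mono) auto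
    then show ?thesis using closed_range_below[OF p] less by simp
  next
    case equal
    then show ?thesis using not_closed_range by simp
  next
    case greater
    then have "a powr p < 1 / 2"
      unfolding a_powr half using assms by (intro powr_less_mono) auto
    then show ?thesis using closed_range_above[OF p] greater by simp
  qed
  then have "closed_range_exponents point_measure = {0<..} - {p0}"
    by (auto simp: closed_range_exponents_def)
  then show ?thesis using bergman_carleson_point_measure by blast
qed

end
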